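(* Let $R$ be a commutative unital ring. Reduced Bar-Natan homology $\widetilde{\mathrm{BN}}(\mathcal L,p)$ of a link $\mathcal L$ with basepoint $p$, as a bigraded $R$-module, does not depend on the basepoint $p$. Moreover, if $\ell$ is the number of link components, there is an $R[H_1,\ldots,H_\ell]$-module structure on reduced Bar-Natan homology $\widetilde{\mathrm{BN}}(\mathcal L)$.
   Context: **Reduced Bar-Natan homology.** Take a diagram of an oriented link with basepoint $p$ away from the crossings, with $n$ crossings, $n_+$ positive and $n_-$ negative. The 0-resolution of a crossing is the smoothing respecting orientations of the strands which make the crossing positive; the 1-resolution is the other smoothing. For $v\in\{0,1\}^n$ let $D(v)$ be the resolved diagram. Let $A=R[H][x]/(x^2-Hx)$, with $q(1)=1$, $q(x)=-1$, $q(H)=-2$ and $H$ in homological grading $0$; merge maps are the multiplication of $A$ and split maps are $\Delta(1)=1\otimes x+x\otimes1-H\,1\otimes1$, $\Delta(x)=x\otimes x$. $\mathrm{CBN}=\bigoplus_v h^{|v|-n_-}q^{|v|+n_+-2n_-}A^{\otimes\#\text{circles of }D(v)}$ (tensor products over $R[H]$), with differential the sum of the edge maps of the cube with signs such that each square has an odd number of minus signs. The reduced complex is $q^{1}$ times the subcomplex in which the tensor factor of the circle through $p$ is $\langle x\rangle_{R[H]}\subset A$; its homology is the $R[H]$-module $\widetilde{\mathrm{BN}}(\mathcal L,p)$. In the second part, $H_i$ acts on $\widetilde{\mathrm{BN}}(\mathcal L)$ as $H$ acts on the version $\widetilde{\mathrm{BN}}(\mathcal L,p)$ with basepoint $p$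 on the $i$-th component, these versions being identified with one bigraded $R$-module $\widetilde{\mathrm{BN}}(\mathcal L)$ by the first part. *)

theory Defs
  imports
    "HOL-Algebra.Module"
    "HOL-Computational_Algebra.Polynomial"
    "HOL-Library.Poly_Mapping"
    "HOL-Library.Function_Algebras"
begin

section \<open>Oriented link diagrams\<close>

text \<open>
  Diagrams are given by oriented planar diagram codes: the crossings cut the link diagram into
  arcs, labelled by natural numbers, and a crossing records the arcs entering and leaving it along
  its two strands, together with its sign.  An arc that meets no crossing is a crossingless
  circle component.  A basepoint away from the crossings is recorded by the arc it lies on.
\<close>

datatype crossing = Crossing
  (positive: bool) (under_in: nat) (under_out: nat) (over_in: nat) (over_out: nat)

record link_diagram =
  arcs :: "nat set"
  crossings :: "crossing list"

text \<open>
  The four arcs around a crossing in counterclockwise order, starting at the incoming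
  under-strand.
\<close>

definition slots :: "crossing \<Rightarrow> nat list" where
  "slots c = (if positive c
     then [under_in c, over_out c, under_out c, over_in c]
     else [under_in c, over_in c, under_out c, over_out c])"

definition slot :: "link_diagram \<Rightarrow> nat \<Rightarrow> nat \<Rightarrow> nat" where
  "slot D k s = slots (crossings D ! k) ! s"

definition n_crossings :: "link_diagram \<Rightarrow> nat" where
  "n_crossings D = length (crossings D)"

definition n_pos :: "link_diagram \<Rightarrow> nat" where
  "n_pos D = length (filter positive (crossings D))"

definition n_neg :: "link_diagram \<Rightarrow> nat" where
  "n_neg D = length (filter (\<lambda>c. \<not> positive c) (crossings D))"

text \<open>The class of \<open>a\<close> under the equivalence relation generated by \<open>r\<close>.\<close>

definition gen_class :: "('a \<times> 'a) set \<Rightarrow> 'a \<Rightarrow> 'a set" where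
  "gen_class r a = (r \<union> r\<inverse>)\<^sup>* `` {a}"

definition well_formed :: "link_diagram \<Rightarrow> bool" where
  "well_formed D \<longleftrightarrow>
     finite (arcs D) \<and>
     (let ins = concat (map (\<lambda>c. [under_in c, over_in c]) (crossings D));
          outs = concat (map (\<lambda>c. [under_out c, over_out c]) (crossings D))
      in distinct ins \<and> distinct outs \<and> set ins = set outs \<and> set ins \<subseteq> arcs D)"

text \<open>
  Planarity.  The half-edges \<open>(k, s)\<close> of the underlying 4-valent graph also name its corners:
  \<open>(k, s)\<close> is the corner at crossing \<open>k\<close> between the slots \<open>s\<close> and \<open>s + 1\<close>.  If an
  arc joins the half-edges \<open>(k, s)\<close> and \<open>(k', s')\<close>, then the corners \<open>(k, s)\<close> and
  \<open>(k', s' - 1)\<close> lie on the same side of it.  The faces are the resulting classes of corners.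
  Every connected component of the graph (with at least one crossing) is drawn on its own sphere,
  and the code is planar if the Euler characteristic \<open>V - E + F\<close>, where \<open>E = 2 V\<close>, is
  \<open>2\<close> for each of them; as it is at most \<open>2\<close> for each, it suffices to compare the totals.
\<close>

definition half_edges :: "link_diagram \<Rightarrow> (nat \<times> nat) set" where
  "half_edges D = {..<n_crossings D} \<times> {..<4}"

definition face_rel :: "link_diagram \<Rightarrow> ((nat \<times> nat) \<times> (nat \<times> nat)) set" where
  "face_rel D = {((k, s), (k', (s' + 3) mod 4)) | k s k' s'.
     (k, s) \<in> half_edges D \<and> (k', s') \<in> half_edges D \<and> (k, s) \<noteq> (k', s') \<and>
     slot D k s = slot D k' s'}"

definition faces :: "link_diagram \<Rightarrow> (nat \<times> nat) set set" where
  "faces D = gen_class (face_rel D) ` half_edges D"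

definition graph_components :: "link_diagram \<Rightarrow> nat set set" where
  "graph_components D =
     gen_class {(k, k') | k s k' s'. (k, s) \<in> half_edges D \<and> (k', s') \<in> half_edges D \<and>
                                     slot D k s = slot D k' s'} ` {..<n_crossings D}"

definition planar :: "link_diagram \<Rightarrow> bool" where
  "planar D \<longleftrightarrow>
     int (n_crossings D) - int (2 * n_crossings D) + int (card (faces D))
       = 2 * int (card (graph_components D))"

definition is_link_diagram :: "link_diagram \<Rightarrow> bool" where
  "is_link_diagram D \<longleftrightarrow> well_formed D \<and> planar D"

definition link_components :: "link_diagram \<Rightarrow> nat set set" where
  "link_components D =
     gen_class (\<Union>c\<in>set (crossings D). {(under_in c, under_out c), (over_in c, over_out c)})
       ` arcs D"

section \<open>The cube of resolutions\<close>

text \<open>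
  A vertex \<open>v\<close> of the cube is the set of crossings that are 1-resolved.  In terms of the
  counterclockwise slots, the 0-resolution joins \<open>0\<close> with \<open>1\<close> and \<open>2\<close> with \<open>3\<close>, and the
  1-resolution joins \<open>0\<close> with \<open>3\<close> and \<open>1\<close> with \<open>2\<close>.  At a positive crossing the former is
  the smoothing that respects the orientation; at a negative crossing it is the one that respects
  the orientation after reversing one of the two strands, i.e. after making the crossing positive.
\<close>

definition smoothing_rel :: "link_diagram \<Rightarrow> nat set \<Rightarrow> (nat \<times> nat) set" where
  "smoothing_rel D v = (\<Union>k<n_crossings D.
     if k \<in> v then {(slot D k 0, slot D k 3), (slot D k 1, slot D k 2)}
     else {(slot D k 0, slot D k 1), (slot D k 2, slot D k 3)})"

text \<open>The circles of the resolved diagram \<open>D(v)\<close>, as sets of arcs.\<close>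

definition circle :: "link_diagram \<Rightarrow> nat set \<Rightarrow> nat \<Rightarrow> nat set" where
  "circle D v a = gen_class (smoothing_rel D v) a"

definition circles :: "link_diagram \<Rightarrow> nat set \<Rightarrow> nat set set" where
  "circles D v = circle D v ` arcs D"

section \<open>The Frobenius algebra\<close>

text \<open>
  \<open>R[H]\<close> is the type \<open>'r poly\<close>.  The algebra \<open>A = R[H][x]/(x\<^sup>2 - H x)\<close> is free over
  \<open>R[H]\<close> with basis \<open>1, x\<close>; the basis elements are named by booleans, \<open>False\<close> for \<open>1\<close>
  and \<open>True\<close> for \<open>x\<close>.  The following are the structure constants of its multiplication
  (\<open>mult_coeff a b c\<close> is the coefficient of \<open>c\<close> in \<open>a b\<close>) and of
  \<open>\<Delta>(1) = 1 \<otimes> x + x \<otimes> 1 - H 1 \<otimes> 1\<close>, \<open>\<Delta>(x) = x \<otimes> x\<close>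
  (\<open>comult_coeff a b c\<close> is the coefficient of \<open>b \<otimes> c\<close> in \<open>\<Delta>(a)\<close>).
\<close>

definition polyH :: "'r::comm_ring_1 poly" where
  "polyH = [:0, 1:]"

fun mult_coeff :: "bool \<Rightarrow> bool \<Rightarrow> bool \<Rightarrow> 'r::comm_ring_1 poly" where
  "mult_coeff False False c = (if c then 0 else 1)"
| "mult_coeff False True c = (if c then 1 else 0)"
| "mult_coeff True False c = (if c then 1 else 0)"
| "mult_coeff True True c = (if c then polyH else 0)"

fun comult_coeff :: "bool \<Rightarrow> bool \<Rightarrow> bool \<Rightarrow> 'r::comm_ring_1 poly" where
  "comult_coeff False False True = 1"
| "comult_coeff False True False = 1"
| "comult_coeff False False False = - polyH"
| "comult_coeff False True True = 0"
| "comult_coeff True b c = (if b \<and> c then 1 else 0)"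

lemma mult_coeff_quotient:
  "[:0, - polyH, 1:] dvd
     (monom 1 (of_bool a) * monom 1 (of_bool b)
       - (\<Sum>c\<in>UNIV. monom (mult_coeff a b c) (of_bool c)) :: 'r::comm_ring_1 poly poly)"
  by (cases a; cases b) (simp_all add: UNIV_bool monom_altdef)

section \<open>The Bar-Natan complex\<close>

text \<open>
  \<open>A\<^sup>\<otimes>\<^sup>n\<close>, with \<open>n\<close> the number of circles of \<open>D(v)\<close>, has the \<open>R[H]\<close>-basis of all
  labellings of these circles by \<open>1\<close> and \<open>x\<close>; a labelling is given by the set \<open>L\<close> of
  the circles labelled \<open>x\<close>.  An element of \<open>CBN\<close> is its coefficient function on the basis
  elements \<open>(v, L)\<close>.
\<close>

type_synonym gen = "nat set \<times> nat set set"
type_synonym 'r chain = "gen \<Rightarrow> 'r poly"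

definition gens :: "link_diagram \<Rightarrow> gen set" where
  "gens D = {(v, L). v \<subseteq> {..<n_crossings D} \<and> L \<subseteq> circles D v}"

definition CBN :: "link_diagram \<Rightarrow> 'r::comm_ring_1 chain set" where
  "CBN D = {f. \<forall>g. g \<notin> gens D \<longrightarrow> f g = 0}"

text \<open>
  The coefficient of \<open>(v \<union> {k}, T)\<close> in the image of \<open>(v, L)\<close> under the unsigned edge map
  that changes the resolution of the crossing \<open>k \<notin> v\<close>.  Slots \<open>0\<close> and \<open>2\<close> of \<open>k\<close> lie on
  different strands of either resolution, so they represent the at most two circles involved,
  before and after; all other circles are common to both resolved diagrams and keep their label.
\<close>

definition edge_coeff ::
    "link_diagram \<Rightarrow> nat set \<Rightarrow> nat \<Rightarrow> nat set set \<Rightarrow> nat set set \<Rightarrow> 'r::comm_ring_1 poly" where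
  "edge_coeff D v k L T =
     (let w = insert k v; a = slot D k 0; b = slot D k 2;
          common = circles D v - {circle D v a, circle D v b}
      in if L \<inter> common \<noteq> T \<inter> common then 0
         else if circle D v a \<noteq> circle D v b
         then mult_coeff (circle D v a \<in> L) (circle D v b \<in> L) (circle D w a \<in> T)
         else comult_coeff (circle D v a \<in> L) (circle D w a \<in> T) (circle D w b \<in> T))"

text \<open>
  An edge of the cube is a pair \<open>(v, k)\<close> with \<open>k \<notin> v\<close>, leading from \<open>v\<close> to
  \<open>v \<union> {k}\<close>; a sign assignment is given by the set of the edges carrying a minus sign.
\<close>

definition sign_assignment :: "link_diagram \<Rightarrow> (nat set \<times> nat) set \<Rightarrow> bool" where
  "sign_assignment D neg \<longleftrightarrow>
     (\<forall>v k l. v \<subseteq> {..<n_crossings D} \<and> k < n_crossings D \<and> l < n_crossings D \<and>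
              k \<notin> v \<and> l \<notin> v \<and> k \<noteq> l \<longrightarrow>
        odd (card ({(v, k), (insert k v, l), (v, l), (insert l v, k)} \<inter> neg)))"

definition differential ::
    "link_diagram \<Rightarrow> (nat set \<times> nat) set \<Rightarrow> 'r::comm_ring_1 chain \<Rightarrow> 'r chain" where
  "differential D neg f = (\<lambda>(w, T).
     if (w, T) \<in> gens D
     then \<Sum>k\<in>w. (if (w - {k}, k) \<in> neg then - 1 else 1) *
            (\<Sum>L\<in>Pow (circles D (w - {k})). edge_coeff D (w - {k}) k L T * f (w - {k}, L))
     else 0)"

text \<open>
  The gradings of a basis element of \<open>CBN\<close>, with \<open>q(1) = 1\<close> and \<open>q(x) = -1\<close>.
\<close>

definition h_degree :: "link_diagram \<Rightarrow> gen \<Rightarrow> int" where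
  "h_degree D g = int (card (fst g)) - int (n_neg D)"

definition q_degree :: "link_diagram \<Rightarrow> gen \<Rightarrow> int" where
  "q_degree D g = int (card (circles D (fst g) - snd g)) - int (card (snd g))
     + int (card (fst g)) + int (n_pos D) - 2 * int (n_neg D)"

section \<open>Reduced Bar-Natan homology\<close>

definition reduced_CBN :: "link_diagram \<Rightarrow> nat \<Rightarrow> 'r::comm_ring_1 chain set" where
  "reduced_CBN D p = {f \<in> CBN D. \<forall>v L. f (v, L) \<noteq> 0 \<longrightarrow> circle D v p \<in> L}"

text \<open>
  Homogeneity in the reduced complex: the summand \<open>1\<close> is its quantum shift, and each power of
  \<open>H\<close> contributes \<open>q(H) = -2\<close>.
\<close>

definition reduced_homogeneous :: "link_diagram \<Rightarrow> int \<Rightarrow> int \<Rightarrow> 'r::comm_ring_1 chain \<Rightarrow> bool" where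
  "reduced_homogeneous D i j f \<longleftrightarrow>
     (\<forall>g m. coeff (f g) m \<noteq> 0 \<longrightarrow>
        h_degree D g = i \<and> q_degree D g - 2 * int m + 1 = j)"

definition reduced_cycles ::
    "link_diagram \<Rightarrow> (nat set \<times> nat) set \<Rightarrow> nat \<Rightarrow> 'r::comm_ring_1 chain set" where
  "reduced_cycles D neg p = {f \<in> reduced_CBN D p. differential D neg f = 0}"

definition reduced_boundaries ::
    "link_diagram \<Rightarrow> (nat set \<times> nat) set \<Rightarrow> nat \<Rightarrow> 'r::comm_ring_1 chain set" where
  "reduced_boundaries D neg p = differential D neg ` reduced_CBN D p"

definition homology_class ::
    "link_diagram \<Rightarrow> (nat set \<times> nat) set \<Rightarrow> nat \<Rightarrow> 'r::comm_ring_1 chain \<Rightarrow> 'r chain set" where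
  "homology_class D neg p f = (\<lambda>b. f + b) ` reduced_boundaries D neg p"

record ('a, 'b) bigraded_module = "('a, 'b) module" +
  hpart :: "int \<Rightarrow> int \<Rightarrow> 'b set"

text \<open>
  The \<open>R[H]\<close>-module of cosets of boundaries, with its homogeneous parts \<open>hpart i j\<close>
  (homological degree \<open>i\<close>, quantum degree \<open>j\<close>).  The ring fields \<open>mult\<close> and \<open>one\<close> of
  the record play no role in a module.
\<close>

definition BN ::
    "link_diagram \<Rightarrow> (nat set \<times> nat) set \<Rightarrow> nat \<Rightarrow>
      ('r::comm_ring_1 poly, 'r chain set) bigraded_module" where
  "BN D neg p =
     \<lparr>carrier = homology_class D neg p ` reduced_cycles D neg p,
      monoid.mult = undefined,
      one = undefined,
      zero = reduced_boundaries D neg p,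
      add = (\<lambda>X Y. {f + g | f g. f \<in> X \<and> g \<in> Y}),
      module.smult = (\<lambda>c X. {(\<lambda>s. c * f s) + b | f b. f \<in> X \<and> b \<in> reduced_boundaries D neg p}),
      hpart = (\<lambda>i j. homology_class D neg p `
                  {f \<in> reduced_cycles D neg p. reduced_homogeneous D i j f})\<rparr>"

text \<open>
  Isomorphisms of bigraded \<open>R\<close>-modules between bigraded \<open>R[H]\<close>-modules, where \<open>R\<close> acts
  through the constant polynomials.
\<close>

definition bigraded_iso ::
    "('r::comm_ring_1 poly, 'b) bigraded_module \<Rightarrow> ('r poly, 'c) bigraded_module \<Rightarrow>
      ('b \<Rightarrow> 'c) \<Rightarrow> bool" where
  "bigraded_iso M N \<phi> \<longleftrightarrow>
     bij_betw \<phi> (carrier M) (carrier N) \<and>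
     (\<forall>X\<in>carrier M. \<forall>Y\<in>carrier M. \<phi> (X \<oplus>\<^bsub>M\<^esub> Y) = \<phi> X \<oplus>\<^bsub>N\<^esub> \<phi> Y) \<and>
     (\<forall>r. \<forall>X\<in>carrier M. \<phi> ([:r:] \<odot>\<^bsub>M\<^esub> X) = [:r:] \<odot>\<^bsub>N\<^esub> \<phi> X) \<and>
     (\<forall>i j. \<phi> ` hpart M i j = hpart N i j)"

section \<open>Modules over \<open>R[H\<^sub>1, \<dots>, H\<^sub>l]\<close>\<close>

text \<open>
  Polynomials are finitely supported coefficient functions on monomials, and monomials are
  finitely supported exponent functions; the variables are indexed by \<open>0, \<dots>, l - 1\<close>.
\<close>

type_synonym 'r mpoly = "(nat \<Rightarrow>\<^sub>0 nat) \<Rightarrow>\<^sub>0 'r"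

definition mpoly_ring :: "nat \<Rightarrow> 'r::comm_ring_1 mpoly ring" where
  "mpoly_ring l =
     \<lparr>carrier = {f. \<forall>m\<in>Poly_Mapping.keys f. Poly_Mapping.keys m \<subseteq> {..<l}},
      monoid.mult = (*), one = 1, zero = 0, add = (+)\<rparr>"

definition mpoly_const :: "'r::comm_ring_1 \<Rightarrow> 'r mpoly" where
  "mpoly_const r = Poly_Mapping.single 0 r"

definition mpoly_var :: "nat \<Rightarrow> 'r::comm_ring_1 mpoly" where
  "mpoly_var i = Poly_Mapping.single (Poly_Mapping.single i 1) 1"

text \<open>The abelian group underlying \<open>M\<close>, with a new scalar multiplication.\<close>

definition with_scalars ::
    "('a, 'b, 'm) module_scheme \<Rightarrow> ('c \<Rightarrow> 'b \<Rightarrow> 'b) \<Rightarrow> ('c, 'b) module" where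
  "with_scalars M act =
     \<lparr>carrier = carrier M, monoid.mult = monoid.mult M, one = one M, zero = zero M, add = add M,
      module.smult = act\<rparr>"

end

theory Submission
  imports Defs
begin

text \<open>
  Evaluating the circle variables of a chain at the roots \<open>0\<close> and \<open>H\<close> of \<open>x\<^sup>2 - H x\<close> is injective
  and makes the edge maps diagonal: a state with values in \<open>{0, H}\<close> survives an edge iff it is
  constant on the circles involved, and is multiplied by \<open>1\<close> for a merge and by \<open>\<plusminus>H\<close> for a split.
  Let \<open>\<tau>\<close> be the involution \<open>H \<mapsto> - H\<close>, \<open>x \<mapsto> x - H\<close>, which exchanges the two roots.  Between the
  reduced complexes of \<open>p\<close> and \<open>q\<close>, the map that is the identity on the states with equal values at
  \<open>p\<close> and \<open>q\<close> and \<open>- \<tau>\<close> on the others is integral, namely \<open>f \<mapsto> H\<^sup>-\<^sup>1 (x f + \<tau> ((H - x) f))\<close> with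
  \<open>x\<close> at \<open>q\<close>.  It carries \<open>H\<close> at \<open>p\<close> to the action of \<open>2 x - H\<close> with \<open>x\<close> at \<open>p\<close>; these actions
  commute.  Across a crossing, the action changes only by a sign up to homotopy.  Planarity provides
  a source-sink orientation of the arcs, by comparing the numbers of cocycles and coboundaries over
  the field with two elements.  It excludes one-to-one bifurcations and shows that the signs can be
  chosen consistently along each component; a sign given by the quantum grading implements them.
\<close>


section \<open>Equivalence classes and permutations\<close>

text \<open>A state with value \<open>H\<close> at \<open>p\<close> and \<open>0\<close> at
  \<open>q\<close> must go to one with value \<open>H\<close> at \<open>q\<close>. Complementing the
  state does this, but turns the split factor \<open>H\<close> into \<open>- H\<close>; composing
  with \<open>H \<mapsto> - H\<close> on coefficients compensates. Hence the isomorphism is only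
  \<open>R\<close>-linear, and \<open>H\<close> at \<open>p\<close> becomes an operator with values
  \<open>H\<close> and \<open>- H\<close>. Edge maps preserve states, so each of the two blocks of
  states could be given any sign; the sign \<open>- 1\<close> on the second block is dictated by
  integrality: modulo \<open>H\<close> the involution \<open>\<tau>\<close> is the identity, so
  \<open>x f + \<tau> ((H - x) f)\<close> vanishes there, while a difference would leave
  \<open>2 x f\<close>. Integrality shapes the whole argument: \<open>R\<close> is arbitrary,
  \<open>H\<close> is cancellable but not invertible, and \<open>2\<close> may vanish. Operators are
  therefore built on chains, and states only serve to verify identities between them.\<close>

lemma gen_class_self: "a \<in> gen_class r a"
  by (simp add: gen_class_def)

lemma gen_class_eq_iff: "gen_class r a = gen_class r b \<longleftrightarrow> b \<in> gen_class r a"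
proof -
  have "sym ((r \<union> r\<inverse>)\<^sup>*)" by (intro sym_rtrancl) (auto simp: sym_def)
  then have "(b, a) \<in> (r \<union> r\<inverse>)\<^sup>*" if "(a, b) \<in> (r \<union> r\<inverse>)\<^sup>*" for a b
    using that by (auto dest: symD)
  then show ?thesis unfolding gen_class_def
    by (auto simp: set_eq_iff) (meson rtrancl_trans)+
qed

lemma gen_class_step:
  assumes "(x, y) \<in> r" shows "x \<in> gen_class r a \<longleftrightarrow> y \<in> gen_class r a"
  using assms unfolding gen_class_def
  by (auto intro: rtrancl_into_rtrancl)

lemma gen_class_subset:
  assumes "a \<in> S" "\<And>x y. (x, y) \<in> r \<Longrightarrow> x \<in> S \<longleftrightarrow> y \<in> S"
  shows "gen_class r a \<subseteq> S"
proof
  fix x assume "x \<in> gen_class r a"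
  then have "(a, x) \<in> (r \<union> r\<inverse>)\<^sup>*" by (simp add: gen_class_def)
  then show "x \<in> S" by induction (use assms in auto)
qed

text \<open>Every step of a generating path inside the class touches it, and there the two relations
  agree. This is how circles away from a crossing survive a change of its resolution.\<close>

lemma gen_class_local:
  assumes "\<And>x y. x \<in> gen_class r a \<or> y \<in> gen_class r a \<Longrightarrow> (x, y) \<in> r \<longleftrightarrow> (x, y) \<in> r'"
  shows "gen_class r' a = gen_class r a"
proof
  show "gen_class r' a \<subseteq> gen_class r a"
    using assms by (intro gen_class_subset gen_class_self) (meson gen_class_step)
  show "gen_class r a \<subseteq> gen_class r' a"
  proof
    fix x assume "x \<in> gen_class r a"
    then have "(a, x) \<in> (r \<union> r\<inverse>)\<^sup>*" by (simp add: gen_class_def)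
    then show "x \<in> gen_class r' a"
    proof induction
      case base show ?case by (rule gen_class_self)
    next
      case (step y z)
      then have "y \<in> gen_class r a" by (simp add: gen_class_def)
      with step(2) assms have "(y, z) \<in> r' \<or> (z, y) \<in> r'" by auto
      with step(3) gen_class_step show ?case by metis
    qed
  qed
qed

section \<open>Cycles of permutations\<close>

lemma funpow_return:
  fixes f :: "'a \<Rightarrow> 'a"
  assumes "finite S" "f ` S \<subseteq> S" "inj_on f S" "x \<in> S"
  shows "\<exists>m>0. (f ^^ m) x = x"
proof -
  have fS: "(f ^^ i) x \<in> S" if "x \<in> S" for x i using that assms(2) by (induction i) auto
  have "\<not> inj_on (\<lambda>i. (f ^^ i) x) UNIV"
    using finite_subset[of "range (\<lambda>i. (f ^^ i) x)" S] fS[OF assms(4)] \<open>finite S\<close>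
      finite_imageD[of "\<lambda>i. (f ^^ i) x" UNIV] by auto
  then obtain i j where "i < j" "(f ^^ i) x = (f ^^ j) x"
    unfolding inj_on_def by (metis nat_neq_iff)
  moreover have "(f ^^ i) x = (f ^^ i) ((f ^^ k) x) \<Longrightarrow> x = (f ^^ k) x" for i k
    by (induction i) (use assms(3) fS assms(4) in \<open>auto simp: inj_on_def\<close>)
  moreover have "(f ^^ j) x = (f ^^ i) ((f ^^ (j - i)) x)"
    using \<open>i < j\<close> by (metis add_diff_inverse_nat comp_apply funpow_add less_imp_not_less)
  ultimately show ?thesis by (metis zero_less_diff)
qed

text \<open>On \<open>S\<close>, \<open>g\<close> is \<open>f\<close> preceded by the transposition
  of \<open>a\<close> and \<open>b\<close>; such a product splits a cycle through both points and
  joins two cycles otherwise. Until it meets \<open>a\<close> or \<open>b\<close> again, the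
  \<open>g\<close>-orbit of \<open>b\<close> runs along the \<open>f\<close>-orbit of
  \<open>a\<close>.\<close>

lemma transposed_orbits:
  fixes f g :: "'a \<Rightarrow> 'a"
  assumes "finite S" and f: "f ` S \<subseteq> S" "inj_on f S" and ab: "a \<in> S" "b \<in> S" "a \<noteq> b"
    and g: "g a = f b" "g b = f a" "\<And>x. x \<in> S \<Longrightarrow> x \<noteq> a \<Longrightarrow> x \<noteq> b \<Longrightarrow> g x = f x"
  shows "(\<exists>i. (f ^^ i) a = b) \<longleftrightarrow> (\<nexists>i. (g ^^ i) b = a)"
proof -
  have fS: "(f ^^ i) x \<in> S" if "x \<in> S" for x i using that f(1) by (induction i) auto
  show ?thesis
  proof
    assume "\<exists>i. (f ^^ i) a = b"
    then obtain m where m: "(f ^^ m) a = b" "\<And>i. i < m \<Longrightarrow> (f ^^ i) a \<noteq> b"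
      using exists_least_iff[of "\<lambda>i. (f ^^ i) a = b"] by auto
    have "m > 0" using m(1) ab(3) by (cases m) auto
    have na: "(f ^^ i) a \<noteq> a" if "0 < i" "i \<le> m" for i
    proof
      assume "(f ^^ i) a = a"
      then have "(f ^^ (m - i)) a = b"
        using m(1) that by (metis comp_apply funpow_add le_add_diff_inverse2)
      with m(2)[of "m - i"] that show False by auto
    qed
    have shift: "(g ^^ i) b = (f ^^ i) a" if "0 < i" "i \<le> m" for i
      using that
    proof (induction i)
      case (Suc i)
      show ?case
      proof (cases i)
        case (Suc j)
        with Suc.IH Suc.prems have "(g ^^ i) b = (f ^^ i) a" by auto
        with m(2)[of i] na[of i] Suc Suc.prems g(3)[OF fS[OF ab(1), of i]] show ?thesis by auto
      qed (use g in auto)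
    qed auto
    have "(g ^^ m) b = b" using shift[of m] m \<open>m > 0\<close> by auto
    then have "(g ^^ i) b = (g ^^ (i mod m)) b" for i
      by (metis funpow_mod_eq)
    moreover have "(g ^^ i) b \<noteq> a" if "i < m" for i
      using that shift[of i] na[of i] ab(3) by (cases "i = 0") auto
    ultimately show "\<nexists>i. (g ^^ i) b = a" using \<open>m > 0\<close> by (metis mod_less_divisor)
  next
    assume ng: "\<nexists>i. (g ^^ i) b = a"
    show "\<exists>i. (f ^^ i) a = b"
    proof (rule ccontr)
      assume nf: "\<nexists>i. (f ^^ i) a = b"
      \<comment> \<open>\<open>m\<close> is the length of the \<open>f\<close>-cycle of
        \<open>a\<close>, which misses \<open>b\<close>; \<open>g\<close> carries \<open>b\<close>
        along it and ends in \<open>a\<close>.\<close>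
      obtain m where m: "m > 0" "(f ^^ m) a = a" "\<And>i. 0 < i \<Longrightarrow> i < m \<Longrightarrow> (f ^^ i) a \<noteq> a"
        using funpow_return[OF assms(1) f ab(1)] exists_least_iff[of "\<lambda>i. i > 0 \<and> (f ^^ i) a = a"] by auto
      have "(g ^^ i) b = (f ^^ i) a" if "0 < i" "i \<le> m" for i
        using that
      proof (induction i)
        case (Suc i)
        show ?case
        proof (cases i)
          case (Suc j)
          with Suc.IH Suc.prems have "(g ^^ i) b = (f ^^ i) a" by auto
          moreover have "(f ^^ i) a \<noteq> b" using nf by blast
          ultimately show ?thesis using m(3)[of i] Suc Suc.prems g(3)[OF fS[OF ab(1), of i]] by auto
        qed (use g in auto)
      qed auto
      with m ng show False by (metis order_refl)
    qed
  qed
qed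

text \<open>\<open>C\<close> and \<open>C'\<close> are the class maps of two equivalence relations.\<close>

lemma class_surgery:
  assumes C: "\<And>x y. C x = C y \<longleftrightarrow> y \<in> C x" and C': "\<And>x y. C' x = C' y \<longleftrightarrow> y \<in> C' x"
    and s: "s1 \<in> C s0" "s3 \<in> C s2" "s3 \<in> C' s0" "s1 \<in> C' s2"
    and loc: "\<And>e. {s0, s1, s2, s3} \<inter> C e = {} \<Longrightarrow> C' e = C e"
    and loc': "\<And>e. {s0, s1, s2, s3} \<inter> C' e = {} \<Longrightarrow> C' e = C e"
    and ne: "C s0 \<noteq> C s2" and eq: "C' s0 = C' s2"
  shows "C' s0 = C s0 \<union> C s2" and "\<And>e. e \<notin> C s0 \<union> C s2 \<Longrightarrow> C' e = C e"
    and "C s0 \<inter> C s2 = {}"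
proof -
  have sym: "y \<in> C x \<longleftrightarrow> x \<in> C y" and sym': "y \<in> C' x \<longleftrightarrow> x \<in> C' y" for x y
    using C C' by metis+
  have s': "C s1 = C s0" "C s3 = C s2" "C' s3 = C' s0" "C' s1 = C' s0"
    using s C C' eq by metis+
  show "C s0 \<inter> C s2 = {}" using C ne by blast
  show other: "C' e = C e" if "e \<notin> C s0 \<union> C s2" for e
  proof -
    have "s \<notin> C e" if "C s = C s0 \<or> C s = C s2" for s
      using that sym \<open>e \<notin> C s0 \<union> C s2\<close> by auto
    then show ?thesis using s' by (intro loc) auto
  qed
  have "x \<in> C' s0 \<longleftrightarrow> x \<in> C s0 \<union> C s2" for x
  proof
    assume x: "x \<in> C' s0"
    show "x \<in> C s0 \<union> C s2"
    proof (rule ccontr)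
      assume n: "x \<notin> C s0 \<union> C s2"
      from other[OF this] x sym' have "s0 \<in> C x" by metis
      with n sym show False by blast
    qed
  next
    assume x: "x \<in> C s0 \<union> C s2"
    show "x \<in> C' s0"
    proof (rule ccontr)
      assume n: "x \<notin> C' s0"
      then have "s \<notin> C' x" if "C' s = C' s0" for s using that sym' C' by metis
      then have "{s0, s1, s2, s3} \<inter> C' x = {}" using s' eq by auto
      from loc'[OF this] \<open>\<And>s. C' s = C' s0 \<Longrightarrow> s \<notin> C' x\<close> eq x sym show False by auto
    qed
  qed
  then show "C' s0 = C s0 \<union> C s2" by blast
qed

section \<open>Evaluation of chains\<close>

lemma polyH_power_eq_monom: "polyH ^ n = monom (1 :: 'r::comm_ring_1) n"
  by (simp add: polyH_def monom_altdef)

text \<open>Multiplication by a power of \<open>H\<close> shifts coefficients, so it is injective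
  over every ring \<open>R\<close>. This justifies testing identities on states.\<close>

lemma polyH_power_cancel:
  fixes p q :: "'r::comm_ring_1 poly"
  shows "polyH ^ n * p = polyH ^ n * q \<longleftrightarrow> p = q"
proof
  assume "polyH ^ n * p = polyH ^ n * q"
  then have "coeff (polyH ^ n * p) (m + n) = coeff (polyH ^ n * q) (m + n)" for m by simp
  then show "p = q" by (simp add: polyH_power_eq_monom coeff_monom_mult poly_eq_iff)
qed simp

lemma polyH_cancel: "polyH * p = polyH * q \<longleftrightarrow> p = (q :: 'r::comm_ring_1 poly)"
  using polyH_power_cancel[of 1 p q] by simp

text \<open>The value of the basis element with label set \<open>L\<close> when each circle variable
  is set to one of the two roots, as prescribed by \<open>P\<close>.\<close>

definition weight :: "nat set \<Rightarrow> nat set set \<Rightarrow> 'r::comm_ring_1 poly" where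
  "weight P L = (\<Prod>C\<in>L. if C \<subseteq> P then polyH else 0)"

lemma weight_insert:
  "finite L \<Longrightarrow> C \<notin> L \<Longrightarrow> weight P (insert C L) = (if C \<subseteq> P then polyH else 0) * weight P L"
  by (simp add: weight_def)

text \<open>The circles before and after the surgery are parameters, so that the same coefficients
  serve an edge of the cube in both directions; the reverse direction is needed for a
  homotopy.\<close>

definition surgery_coeff ::
    "nat set set \<Rightarrow> nat set \<Rightarrow> nat set \<Rightarrow> nat set \<Rightarrow> nat set \<Rightarrow> nat set set \<Rightarrow> nat set set \<Rightarrow>
      'r::comm_ring_1 poly" where
  "surgery_coeff \<C> A B A' B' L T =
     (let common = \<C> - {A, B}
      in if L \<inter> common \<noteq> T \<inter> common then 0
         else if A \<noteq> B then mult_coeff (A \<in> L) (B \<in> L) (A' \<in> T)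
         else comult_coeff (A \<in> L) (A' \<in> T) (B' \<in> T))"

lemma sum_Pow_insert:
  assumes "finite K" "x \<notin> K"
  shows "(\<Sum>T\<in>Pow (insert x K). g T) = (\<Sum>T\<in>Pow K. g T) + (\<Sum>T\<in>Pow K. g (insert x T))"
proof -
  have "inj_on (insert x) (Pow K)" using assms(2) by (auto simp: inj_on_def)
  moreover have "Pow K \<inter> insert x ` Pow K = {}" using assms(2) by auto
  ultimately show ?thesis using assms(1) 
    by (simp add: Pow_insert sum.union_disjoint sum.reindex)
qed

lemma sum_Pow_delta:
  fixes g h :: "'a set \<Rightarrow> 'b::comm_ring_1"
  assumes "finite K" "M \<subseteq> K"
  shows "(\<Sum>T\<in>Pow K. g T * (if M \<noteq> T \<inter> K then 0 else h T)) = g M * h M"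
proof -
  have "(\<Sum>T\<in>Pow K. g T * (if M \<noteq> T \<inter> K then 0 else h T))
      = (\<Sum>T\<in>Pow K. if M = T then g T * h T else 0)"
    by (intro sum.cong) (auto simp: Int_absorb2)
  then show ?thesis using assms by simp
qed

text \<open>Setting \<open>x\<close> to a root of \<open>x^2 - H x\<close> is a ring homomorphism,
  so multiplying two factors with equal values does not change the evaluation.\<close>

lemma weight_merge:
  fixes P :: "nat set"
  assumes K: "finite K" "A \<notin> K" "B \<notin> K" "A \<noteq> B" "M \<notin> K" and L: "L \<subseteq> insert A (insert B K)"
    and P: "M \<subseteq> P \<longleftrightarrow> A \<subseteq> P" "M \<subseteq> P \<longleftrightarrow> B \<subseteq> P"
  shows "(\<Sum>T\<in>Pow (insert M K). weight P T * surgery_coeff (insert A (insert B K)) A B M M' L T)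
    = (weight P L :: 'r::comm_ring_1 poly)"
proof -
  define L' where "L' = L \<inter> K"
  have L': "L' \<subseteq> K" "finite L'" "A \<notin> L'" "B \<notin> L'" "M \<notin> L'"
    using K by (auto simp: L'_def intro: finite_subset)
  have common: "insert A (insert B K) - {A, B} = K" using K by auto
  \<comment> \<open>The coefficient freezes the labels of all other circles; only the label of the
    merged circle, recorded by \<open>U\<close>, remains to be summed over.\<close>
  have part: "(\<Sum>T\<in>Pow K. weight P (U \<union> T) *
       surgery_coeff (insert A (insert B K)) A B M M' L (U \<union> T))
    = weight P (U \<union> L') * (mult_coeff (A \<in> L) (B \<in> L) (M \<in> U) :: 'r poly)" if "U \<subseteq> {M}" for U
  proof -
    have "(\<Sum>T\<in>Pow K. weight P (U \<union> T) *
         surgery_coeff (insert A (insert B K)) A B M M' L (U \<union> T))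
      = (\<Sum>T\<in>Pow K. weight P (U \<union> T) *
          (if L' \<noteq> T \<inter> K then 0 else mult_coeff (A \<in> L) (B \<in> L) (M \<in> U)) :: 'r poly)"
    proof (rule sum.cong[OF refl])
      fix T assume "T \<in> Pow K"
      then have "(U \<union> T) \<inter> K = T \<inter> K" "M \<in> U \<union> T \<longleftrightarrow> M \<in> U" using that K by auto
      then show "weight P (U \<union> T) * surgery_coeff (insert A (insert B K)) A B M M' L (U \<union> T)
        = (weight P (U \<union> T) * (if L' \<noteq> T \<inter> K then 0 else mult_coeff (A \<in> L) (B \<in> L) (M \<in> U)) :: 'r poly)"
        by (simp add: surgery_coeff_def common Let_def L'_def[symmetric] K(4))
    qed
    also have "\<dots> = weight P (U \<union> L') * mult_coeff (A \<in> L) (B \<in> L) (M \<in> U)"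
      using K(1) L'(1) by (rule sum_Pow_delta)
    finally show ?thesis .
  qed
  have "L = L' \<union> (if A \<in> L then {A} else {}) \<union> (if B \<in> L then {B} else {})"
    using L by (auto simp: L'_def)
  then have "weight P L = (weight P (L' \<union> (if A \<in> L then {A} else {}) \<union> (if B \<in> L then {B} else {})) :: 'r poly)"
    by simp
  also have "\<dots> = weight P L' * (if A \<in> L then (if A \<subseteq> P then polyH else 0) else 1)
      * (if B \<in> L then (if B \<subseteq> P then polyH else 0) else 1)"
    using L' K(4) by (auto simp: weight_insert)
  finally show ?thesis
    using L' P K(1,5) part[of "{}"] part[of "{M}"]
    by (cases "A \<in> L"; cases "B \<in> L"; cases "M \<subseteq> P"; simp add: sum_Pow_insert weight_insert)
qed

text \<open>\<open>\<Delta>(1)\<close> evaluates to \<open>x + x' - H\<close>, which is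
  \<open>H\<close>, \<open>0\<close> or \<open>- H\<close>. \<open>\<Delta>(x)\<close> evaluates to
  \<open>x x'\<close>, which is the same multiple of the value of \<open>x\<close> on
  \<open>M\<close>, as this is \<open>H\<close> if both new circles lie in \<open>P\<close> and
  \<open>0\<close> otherwise.\<close>

lemma weight_split:
  fixes P :: "nat set"
  assumes K: "finite K" "A \<notin> K" "B \<notin> K" "A \<noteq> B" "M \<notin> K" and L: "L \<subseteq> insert M K"
    and P: "M \<subseteq> P \<longleftrightarrow> A \<subseteq> P \<and> B \<subseteq> P"
  shows "(\<Sum>T\<in>Pow (insert A (insert B K)). weight P T * surgery_coeff (insert M K) M M A B L T)
    = (if A \<subseteq> P \<and> B \<subseteq> P then polyH else if A \<subseteq> P \<or> B \<subseteq> P then 0 else - polyH)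
      * (weight P L :: 'r::comm_ring_1 poly)"
proof -
  define L' where "L' = L \<inter> K"
  have L': "L' \<subseteq> K" "finite L'" "A \<notin> L'" "B \<notin> L'" "M \<notin> L'"
    using K by (auto simp: L'_def intro: finite_subset)
  have common: "insert M K - {M, M} = K" "K - {M} = K" using K by auto
  have part: "(\<Sum>T\<in>Pow K. weight P (U \<union> T) * surgery_coeff (insert M K) M M A B L (U \<union> T))
    = weight P (U \<union> L') * (comult_coeff (M \<in> L) (A \<in> U) (B \<in> U) :: 'r poly)" if "U \<subseteq> {A, B}" for U
  proof -
    have "(\<Sum>T\<in>Pow K. weight P (U \<union> T) * surgery_coeff (insert M K) M M A B L (U \<union> T))
      = (\<Sum>T\<in>Pow K. weight P (U \<union> T) *
          (if L' \<noteq> T \<inter> K then 0 else comult_coeff (M \<in> L) (A \<in> U) (B \<in> U)) :: 'r poly)"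
    proof (rule sum.cong[OF refl])
      fix T assume "T \<in> Pow K"
      then have "(U \<union> T) \<inter> K = T \<inter> K" "A \<in> U \<union> T \<longleftrightarrow> A \<in> U" "B \<in> U \<union> T \<longleftrightarrow> B \<in> U"
        using that K by auto
      then show "weight P (U \<union> T) * surgery_coeff (insert M K) M M A B L (U \<union> T)
        = (weight P (U \<union> T) * (if L' \<noteq> T \<inter> K then 0 else comult_coeff (M \<in> L) (A \<in> U) (B \<in> U)) :: 'r poly)"
        by (simp add: surgery_coeff_def common Let_def L'_def[symmetric])
    qed
    also have "\<dots> = weight P (U \<union> L') * comult_coeff (M \<in> L) (A \<in> U) (B \<in> U)"
      using K(1) L'(1) by (rule sum_Pow_delta)
    finally show ?thesis .
  qed
  have "L = L' \<union> (if M \<in> L then {M} else {})"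
    using L by (auto simp: L'_def)
  then have "weight P L = (weight P (L' \<union> (if M \<in> L then {M} else {})) :: 'r poly)"
    by simp
  also have "\<dots> = weight P L' * (if M \<in> L then (if M \<subseteq> P then polyH else 0) else 1)"
    using L' K(4) by (auto simp: weight_insert)
  finally show ?thesis
    using L' P K part[of "{}"] part[of "{A}"] part[of "{B}"] part[of "{A, B}"]
    by (cases "M \<in> L"; cases "A \<subseteq> P"; cases "B \<subseteq> P"; simp add: sum_Pow_insert weight_insert insert_commute)
qed

text \<open>
  Each circle variable \<open>x\<close> is set to \<open>H\<close> on the circles contained in
  \<open>P\<close> and to \<open>0\<close> on the other ones.  These are the roots of \<open>x\<^sup>2 - H x\<close>, and the evaluations
  turn the edge maps and all operators below into multiplications by scalars.
\<close>

definition hat :: "link_diagram \<Rightarrow> 'r::comm_ring_1 chain \<Rightarrow> nat set \<Rightarrow> nat set \<Rightarrow> 'r poly" where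
  "hat D f v P = (\<Sum>L\<in>Pow (circles D v). weight P L * f (v, L))"

text \<open>A state is a set of arcs rather than of circles, so that the same \<open>P\<close> can
  be used at both ends of an edge of the cube.\<close>

definition compatible :: "link_diagram \<Rightarrow> nat set \<Rightarrow> nat set \<Rightarrow> bool" where
  "compatible D v P \<longleftrightarrow> (\<forall>(a, b)\<in>smoothing_rel D v. a \<in> P \<longleftrightarrow> b \<in> P)"

lemma compatible_uminus [simp]: "compatible D v (- P) \<longleftrightarrow> compatible D v P"
  by (auto simp: compatible_def)

lemma circle_eq_iff: "circle D v a = circle D v b \<longleftrightarrow> b \<in> circle D v a"
  by (simp add: circle_def gen_class_eq_iff)

lemma circle_self: "a \<in> circle D v a"
  by (simp add: circle_def gen_class_self)

lemma compatible_circle: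
  assumes "compatible D v P"
  shows "circle D v a \<subseteq> P \<longleftrightarrow> a \<in> P"
  using gen_class_subset[of a P "smoothing_rel D v"] assms circle_self[of a D v]
  by (auto simp: compatible_def circle_def)

lemma compatible_eq_mem:
  assumes "compatible D v P" "b \<in> circle D v a"
  shows "a \<in> P \<longleftrightarrow> b \<in> P"
  using assms compatible_circle circle_eq_iff by metis

lemma compatible_Union:
  assumes "Z \<subseteq> circles D v"
  shows "compatible D v (\<Union>Z)"
proof -
  have "x \<in> C \<longleftrightarrow> y \<in> C" if "(x, y) \<in> smoothing_rel D v" "C \<in> Z" for x y C
    using that assms gen_class_step[OF that(1)] by (auto simp: circles_def circle_def)
  then show ?thesis unfolding compatible_def by blast
qed

lemma circles_disjoint:
  assumes "C \<in> circles D v" "x \<in> C" shows "C = circle D v x"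
proof -
  obtain a where "C = circle D v a" using assms(1) by (auto simp: circles_def)
  with assms(2) show ?thesis using circle_eq_iff by blast
qed

lemma circles_nonempty: "C \<in> circles D v \<Longrightarrow> C \<noteq> {}"
  using circle_self by (auto simp: circles_def)

lemma circles_subset_Union:
  assumes "Z \<subseteq> circles D v" "C \<in> circles D v"
  shows "C \<subseteq> \<Union>Z \<longleftrightarrow> C \<in> Z"
proof
  assume "C \<subseteq> \<Union>Z"
  moreover obtain x where "x \<in> C" using circles_nonempty[OF assms(2)] by auto
  ultimately obtain C' where "C' \<in> Z" "x \<in> C'" by auto
  then show "C \<in> Z" using assms circles_disjoint \<open>x \<in> C\<close> by blast
qed auto

lemma hat_Union:
  fixes f :: "'r::comm_ring_1 chain"
  assumes "finite (arcs D)" "Z \<subseteq> circles D v"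
  shows "hat D f v (\<Union>Z) = (\<Sum>L\<in>Pow Z. polyH ^ card L * f (v, L))"
proof -
  have fin: "finite (circles D v)" using assms(1) by (simp add: circles_def)
  have "weight (\<Union>Z) L = (if L \<subseteq> Z then polyH ^ card L else (0 :: 'r poly))" if "L \<subseteq> circles D v" for L
  proof (cases "L \<subseteq> Z")
    case True
    then have "weight (\<Union>Z) L = (\<Prod>C\<in>L. polyH :: 'r poly)"
      unfolding weight_def by (intro prod.cong) auto
    then show ?thesis using True by simp
  next
    case False
    then obtain C where "C \<in> L" "C \<notin> Z" by blast
    then have "\<exists>C\<in>L. (if C \<subseteq> \<Union>Z then polyH else 0 :: 'r poly) = 0"
      using circles_subset_Union[OF assms(2), of C] that by (intro bexI[of _ C]) auto
    then show ?thesis using False finite_subset[OF that fin] unfolding weight_def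
      by (simp add: prod_zero)
  qed
  then have "hat D f v (\<Union>Z) = (\<Sum>L\<in>Pow (circles D v). if L \<subseteq> Z then polyH ^ card L * f (v, L) else 0)"
    unfolding hat_def by (intro sum.cong) auto
  also have "\<dots> = (\<Sum>L\<in>Pow Z. polyH ^ card L * f (v, L))"
    using assms(2) fin by (intro sum.mono_neutral_cong_right) auto
  finally show ?thesis .
qed

text \<open>Moebius inversion, in the form of an induction principle.\<close>

lemma hat_induct:
  fixes f :: "'r::comm_ring_1 chain"
  assumes fin: "finite (arcs D)" and Z: "Z \<subseteq> circles D v"
    and Q: "\<And>P. compatible D v P \<Longrightarrow> P \<subseteq> \<Union>Z \<Longrightarrow> Q (hat D f v P)"
    and diff: "\<And>p q. Q p \<Longrightarrow> Q q \<Longrightarrow> Q (p - q)"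
  shows "Q (polyH ^ card Z * f (v, Z))"
  using finite_subset[OF Z] Z Q
proof (induction Z rule: measure_induct_rule[of card])
  case (less Z)
  have finZ: "finite Z" using less.prems(2) fin by (auto simp: circles_def intro: finite_subset)
  have Q0: "Q 0" using diff[of "hat D f v (\<Union>Z)" "hat D f v (\<Union>Z)"]
      less.prems compatible_Union by simp
  have add: "Q (p + q)" if "Q p" "Q q" for p q using diff[OF that(1) diff[OF Q0 that(2)]] by simp
  have sum: "Q (sum g S)" if "finite S" "\<And>L. L \<in> S \<Longrightarrow> Q (g L)" for g :: "nat set set \<Rightarrow> 'r poly" and S
    using that by (induction S) (auto simp: Q0 add)
  have 1: "Q (\<Sum>L\<in>Pow Z - {Z}. polyH ^ card L * f (v, L))"
  proof (rule sum)
    fix L assume L: "L \<in> Pow Z - {Z}"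
    then have "card L < card Z" using finZ by (auto intro: psubset_card_mono)
    moreover have "P \<subseteq> \<Union>Z" if "P \<subseteq> \<Union>L" for P using that L by auto
    ultimately show "Q (polyH ^ card L * f (v, L))" 
      using L less.prems by (intro less.IH) (auto intro: finite_subset)
  qed (use finZ in auto)
  \<comment> \<open>The evaluation at \<open>\<Union>Z\<close> is the top term plus terms for proper
    subsets of \<open>Z\<close>, and those satisfy \<open>Q\<close> by induction.\<close>
  have 2: "hat D f v (\<Union>Z) = polyH ^ card Z * f (v, Z) + (\<Sum>L\<in>Pow Z - {Z}. polyH ^ card L * f (v, L))"
    using finZ by (simp add: hat_Union[OF fin less.prems(2)] sum.remove[of "Pow Z" Z])
  have "Q (hat D f v (\<Union>Z))" using less.prems compatible_Union by simp
  from diff[OF this 1] show ?case by (simp add: 2)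
qed

lemma hat_linear:
  "hat D (f + g) v P = hat D f v P + hat D g v P"
  "hat D (f - g) v P = hat D f v P - hat D g v P"
  "hat D (\<lambda>s. c * f s) v P = c * hat D f v P"
  "hat D 0 v P = 0"
  unfolding hat_def
     apply (simp add: distrib_left sum.distrib)
    apply (simp add: right_diff_distrib sum_subtractf)
   apply (simp add: sum_distrib_left mult.left_commute)
  apply simp
  done

text \<open>Moebius inversion recovers every coefficient up to a power of \<open>H\<close>, which
  cancels.\<close>

lemma hat_eqI:
  fixes f g :: "'r::comm_ring_1 chain"
  assumes "finite (arcs D)" "f \<in> CBN D" "g \<in> CBN D"
    and "\<And>v P. v \<subseteq> {..<n_crossings D} \<Longrightarrow> compatible D v P \<Longrightarrow> hat D f v P = hat D g v P"
  shows "f = g"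
proof (rule ext, clarify)
  fix v L
  show "f (v, L) = g (v, L)"
  proof (cases "(v, L) \<in> gens D")
    case True
    then have v: "v \<subseteq> {..<n_crossings D}" and L: "L \<subseteq> circles D v" by (simp_all add: gens_def)
    have 0: "hat D (f - g) v P = 0" if "compatible D v P" for P
      using assms(4)[OF v that] by (simp add: hat_linear)
    have "polyH ^ card L * (f - g) (v, L) = 0"
    proof (rule hat_induct[where Q = "\<lambda>p. p = 0" and f = "f - g", OF assms(1) L])
      fix P assume "compatible D v P" then show "hat D (f - g) v P = 0" by (rule 0)
    next
      fix p q :: "'r poly" assume "p = 0" "q = 0" then show "p - q = 0" by simp
    qed
    then have "polyH ^ card L * f (v, L) = polyH ^ card L * g (v, L)"
      by (simp only: minus_apply right_diff_distrib right_minus_eq)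
    then show ?thesis by (simp only: polyH_power_cancel)
  next
    case False
    then show ?thesis using assms(2,3) by (simp add: CBN_def)
  qed
qed

section \<open>Circles of the resolutions\<close>

text \<open>
  The arcs can be oriented such that at every crossing sources and sinks alternate; \<open>c\<close> tells
  where this orientation agrees with the one of the link.
\<close>

definition source_sink :: "link_diagram \<Rightarrow> (nat \<Rightarrow> bool) \<Rightarrow> bool" where
  "source_sink D c \<longleftrightarrow> (\<forall>x\<in>set (crossings D).
     c (over_out x) = c (under_in x) \<and> c (over_in x) = (\<not> c (under_in x)) \<and>
     c (under_out x) = (\<not> c (under_in x)))"

lemma distinct_concat_pairs:
  assumes "distinct (concat (map (\<lambda>x. [f x, g x]) xs))" "i < length xs" "j < length xs"
  shows "f (xs ! i) = f (xs ! j) \<longleftrightarrow> i = j" "g (xs ! i) = g (xs ! j) \<longleftrightarrow> i = j" "f (xs ! i) \<noteq> g (xs ! j)"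
proof -
  have "(f (xs ! i) = f (xs ! j) \<longleftrightarrow> i = j) \<and> (g (xs ! i) = g (xs ! j) \<longleftrightarrow> i = j) \<and> f (xs ! i) \<noteq> g (xs ! j)"
    using assms
  proof (induction xs arbitrary: i j)
    case (Cons x xs)
    have ne: "f x \<noteq> f (xs ! i)" "f x \<noteq> g (xs ! i)" "g x \<noteq> f (xs ! i)" "g x \<noteq> g (xs ! i)"
      if "i < length xs" for i
      using Cons.prems(1) nth_mem[OF that] by auto
    have "f x \<noteq> g x" using Cons.prems(1) by auto
    have dist: "distinct (concat (map (\<lambda>x. [f x, g x]) xs))" using Cons.prems(1) by auto
    show ?case
    proof (cases i)
      case 0
      show ?thesis
      proof (cases j)
        case (Suc j')
        with 0 ne[of j'] Cons.prems show ?thesis by simp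
      qed (use 0 \<open>f x \<noteq> g x\<close> in simp)
    next
      case (Suc i')
      show ?thesis
      proof (cases j)
        case 0
        with Suc ne[of i', THEN not_sym] Cons.prems show ?thesis by simp
      next
        case (Suc j')
        with \<open>i = Suc i'\<close> Cons.IH[OF dist, of i' j'] Cons.prems show ?thesis by simp
      qed
    qed
  qed simp
  then show "f (xs ! i) = f (xs ! j) \<longleftrightarrow> i = j" "g (xs ! i) = g (xs ! j) \<longleftrightarrow> i = j" "f (xs ! i) \<noteq> g (xs ! j)"
    by auto
qed

lemma set_concat_pairs: "set (concat (map (\<lambda>x. [f x, g x]) xs)) = (\<Union>k<length xs. {f (xs ! k), g (xs ! k)})"
  by (induction xs) (simp_all add: lessThan_Suc_eq_insert_0)

text \<open>Edges are undirected, because the backward edge maps of the homotopy are treated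
  together with those of the differential.\<close>

definition adjacent :: "link_diagram \<Rightarrow> nat \<Rightarrow> nat set \<Rightarrow> nat set \<Rightarrow> bool" where
  "adjacent D k v w \<longleftrightarrow> k < n_crossings D \<and> v \<subseteq> {..<n_crossings D} \<and> w \<subseteq> {..<n_crossings D} \<and>
     (k \<notin> v \<and> w = insert k v \<or> k \<notin> w \<and> v = insert k w)"

lemma adjacent_sym: "adjacent D k v w \<longleftrightarrow> adjacent D k w v"
  by (auto simp: adjacent_def)

lemma circle_step:
  assumes "(x, y) \<in> smoothing_rel D v \<union> (smoothing_rel D v)\<inverse>"
  shows "circle D v x = circle D v y"
  using assms
proof
  assume "(x, y) \<in> smoothing_rel D v"
  from gen_class_step[OF this, of x] show ?thesis by (simp add: circle_def gen_class_self gen_class_eq_iff)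
next
  assume "(x, y) \<in> (smoothing_rel D v)\<inverse>"
  then have "(y, x) \<in> smoothing_rel D v" by simp
  from gen_class_step[OF this, of x] show ?thesis by (simp add: circle_def gen_class_self gen_class_eq_iff)
qed

lemma compatible_iff:
  "compatible D v P \<longleftrightarrow> (\<forall>k<n_crossings D.
     if k \<in> v then (slot D k 0 \<in> P \<longleftrightarrow> slot D k 3 \<in> P) \<and> (slot D k 1 \<in> P \<longleftrightarrow> slot D k 2 \<in> P)
     else (slot D k 0 \<in> P \<longleftrightarrow> slot D k 1 \<in> P) \<and> (slot D k 2 \<in> P \<longleftrightarrow> slot D k 3 \<in> P))"
  unfolding compatible_def smoothing_rel_def by (simp only: ball_UN) (auto split: if_splits)

text \<open>The two resolutions match slots \<open>0\<close> and \<open>2\<close> with slots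
  \<open>1\<close> and \<open>3\<close> in the two possible ways, so \<open>P\<close> fits both
  exactly if it is constant on all four arcs.\<close>

lemma compatible_adjacent:
  assumes "adjacent D k v w" "compatible D w P"
  shows "compatible D v P \<longleftrightarrow> (slot D k 0 \<in> P \<longleftrightarrow> slot D k 2 \<in> P)"
proof -
  have k: "k < n_crossings D" and vw: "k \<in> v \<longleftrightarrow> k \<notin> w" "\<And>j. j \<noteq> k \<Longrightarrow> j \<in> v \<longleftrightarrow> j \<in> w"
    using assms(1) by (auto simp: adjacent_def)
  define S where "S = (\<lambda>v k. if k \<in> v then (slot D k 0 \<in> P \<longleftrightarrow> slot D k 3 \<in> P) \<and> (slot D k 1 \<in> P \<longleftrightarrow> slot D k 2 \<in> P)
     else (slot D k 0 \<in> P \<longleftrightarrow> slot D k 1 \<in> P) \<and> (slot D k 2 \<in> P \<longleftrightarrow> slot D k 3 \<in> P))"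
  have S: "compatible D v P \<longleftrightarrow> (\<forall>k<n_crossings D. S v k)" for v
    unfolding compatible_iff S_def by (rule refl)
  have "S v j = S w j" if "j \<noteq> k" for j using vw(2)[OF that] by (simp add: S_def)
  then have "compatible D v P \<longleftrightarrow> S v k" using k assms(2) unfolding S by metis
  moreover have "S w k" using assms(2) k unfolding S by blast
  ultimately show ?thesis using vw(1) by (cases "k \<in> v") (auto simp: S_def)
qed

text \<open>The evaluation of \<open>2 x - H\<close>, and the factor contributed by splitting the circle through \<open>a\<close>.\<close>

definition split_weight :: "nat \<Rightarrow> nat set \<Rightarrow> 'r::comm_ring_1 poly" where
  "split_weight a P = (if a \<in> P then polyH else - polyH)"

locale wf_diagram =
  fixes D :: link_diagram
  assumes wf: "well_formed D"
begin

abbreviation "n \<equiv> n_crossings D"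
abbreviation "ui k \<equiv> under_in (crossings D ! k)"
abbreviation "uo k \<equiv> under_out (crossings D ! k)"
abbreviation "oi k \<equiv> over_in (crossings D ! k)"
abbreviation "oo k \<equiv> over_out (crossings D ! k)"
abbreviation "pos k \<equiv> positive (crossings D ! k)"
abbreviation "arc \<equiv> slot D"
abbreviation "vertex v \<equiv> v \<subseteq> {..<n}"
abbreviation "fits \<equiv> compatible D"
abbreviation "reduced \<equiv> reduced_CBN D"
abbreviation "circ v k \<equiv> circle D v (slot D k 0)"
abbreviation "circ' v k \<equiv> circle D v (slot D k 2)"

lemma finite_arcs: "finite (arcs D)"
  using wf by (simp add: well_formed_def)

lemma finite_circles: "finite (circles D v)"
  using finite_arcs by (simp add: circles_def)

lemma ins_distinct:
  assumes "k < n" "j < n"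
  shows "ui k = ui j \<longleftrightarrow> k = j" "oi k = oi j \<longleftrightarrow> k = j" "ui k \<noteq> oi j"
    "uo k = uo j \<longleftrightarrow> k = j" "oo k = oo j \<longleftrightarrow> k = j" "uo k \<noteq> oo j"
  using wf assms distinct_concat_pairs[of under_in over_in "crossings D" k j]
    distinct_concat_pairs[of under_out over_out "crossings D" k j]
  by (simp_all add: well_formed_def Let_def n_crossings_def)

lemma slots_eq:
  "arc k 0 = ui k" "arc k 2 = uo k"
  "arc k 1 = (if pos k then oo k else oi k)"
  "arc k 3 = (if pos k then oi k else oo k)"
  "arc k (Suc 0) = (if pos k then oo k else oi k)"
  by (simp_all add: slot_def slots_def numeral_3_eq_3 numeral_2_eq_2)

text \<open>Crossingless circle components are left out: no smoothing touches them, so they have no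
  successor arc.\<close>

definition ends :: "nat set" where "ends = (\<Union>k<n. {ui k, oi k})"

lemma ends_eq: "ends = (\<Union>k<n. {uo k, oo k})" and ends_subset: "ends \<subseteq> arcs D"
  using wf unfolding well_formed_def Let_def set_concat_pairs
    ends_def n_crossings_def by blast+

lemma finite_ends: "finite ends" by (simp add: ends_def)

lemma strand_ends: "k < n \<Longrightarrow> ui k \<in> ends" "k < n \<Longrightarrow> oi k \<in> ends" "k < n \<Longrightarrow> uo k \<in> ends" "k < n \<Longrightarrow> oo k \<in> ends"
  using ends_eq by (auto simp: ends_def)

lemma slot_ends: "k < n \<Longrightarrow> s < 4 \<Longrightarrow> arc k s \<in> ends"
  using strand_ends[of k] slots_eq[of k] by (cases "s = 0 \<or> s = 1 \<or> s = 2 \<or> s = 3") auto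

lemma slot_arcs: "k < n \<Longrightarrow> s < 4 \<Longrightarrow> arc k s \<in> arcs D"
  using slot_ends ends_subset by blast

end

locale sourced_diagram = wf_diagram +
  fixes c :: "nat \<Rightarrow> bool"
  assumes source_sink: "source_sink D c"
begin

lemma colour:
  assumes "k < n"
  shows "c (oo k) = c (ui k)" "c (oi k) = (\<not> c (ui k))" "c (uo k) = (\<not> c (ui k))"
  using source_sink assms nth_mem[of k "crossings D"] by (auto simp: source_sink_def n_crossings_def)

text \<open>The sinks and sources at a crossing, distinguished by their colours.\<close>

definition sink :: "nat \<Rightarrow> bool \<Rightarrow> nat" where
  "sink k b = (if c (ui k) then (if b then ui k else uo k) else (if b then oi k else oo k))"

definition source :: "nat \<Rightarrow> bool \<Rightarrow> nat" where
  "source k b = (if c (ui k) then (if b then oo k else oi k) else (if b then uo k else ui k))"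

text \<open>True for the smoothing that violates the orientation of the link; passing through it
  switches the colour.\<close>

definition crossed :: "nat set \<Rightarrow> nat \<Rightarrow> bool" where
  "crossed v k \<longleftrightarrow> (k \<in> v \<longleftrightarrow> pos k)"

text \<open>Every smoothing pairs the sinks of a crossing with its sources, so a resolution is a
  permutation of the arcs at crossings. Its cycles are the circles, traversed along the source-sink
  orientation.\<close>

definition succ_arc :: "nat set \<Rightarrow> nat \<Rightarrow> nat" where
  "succ_arc v e = (case the_inv_into ({..<n} \<times> UNIV) (\<lambda>(k, b). sink k b) e of
     (k, b) \<Rightarrow> source k (b \<noteq> crossed v k))"

lemma sink_colour: "k < n \<Longrightarrow> c (sink k b) = b" and source_colour: "k < n \<Longrightarrow> c (source k b) = b"
  using colour[of k] by (auto simp: sink_def source_def)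

lemma sink_eq_iff:
  assumes "k < n" "j < n" shows "sink k b = sink j b' \<longleftrightarrow> k = j \<and> b = b'"
proof -
  have "b = b'" if "sink k b = sink j b'" using that sink_colour assms by metis
  moreover have "k = j" if "sink k b = sink j b"
    using that ins_distinct[OF assms] ins_distinct[OF assms(2,1)] unfolding sink_def by (auto split: if_splits)
  ultimately show ?thesis by auto
qed

lemma source_eq_iff:
  assumes "k < n" "j < n" shows "source k b = source j b' \<longleftrightarrow> k = j \<and> b = b'"
proof -
  have "b = b'" if "source k b = source j b'" using that source_colour assms by metis
  moreover have "k = j" if "source k b = source j b"
    using that ins_distinct[OF assms] ins_distinct[OF assms(2,1)] unfolding source_def by (auto split: if_splits)
  ultimately show ?thesis by auto
qed

lemma ends_sink:
  assumes "e \<in> ends" shows "\<exists>k<n. \<exists>b. e = sink k b"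
proof (cases "c e")
  case True
  from assms obtain k where "k < n" "e = ui k \<or> e = oi k" by (auto simp: ends_def)
  with True colour[of k] show ?thesis by (intro exI[of _ k] conjI exI[of _ True]) (auto simp: sink_def)
next
  case False
  from assms obtain k where "k < n" "e = uo k \<or> e = oo k" by (auto simp: ends_eq)
  with False colour[of k] show ?thesis by (intro exI[of _ k] conjI exI[of _ False]) (auto simp: sink_def)
qed

lemma sink_ends: "k < n \<Longrightarrow> sink k b \<in> ends" and source_ends: "k < n \<Longrightarrow> source k b \<in> ends"
  using strand_ends by (auto simp: sink_def source_def)

lemma succ_arc_sink: "k < n \<Longrightarrow> succ_arc v (sink k b) = source k (b \<noteq> crossed v k)"
proof -
  assume k: "k < n"
  have "inj_on (\<lambda>(k, b). sink k b) ({..<n} \<times> UNIV)" by (auto simp: inj_on_def sink_eq_iff)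
  from the_inv_into_f_f[OF this, of "(k, b)"] k show ?thesis by (simp add: succ_arc_def)
qed

lemma succ_arc_inj: "inj_on (succ_arc v) ends"
proof (rule inj_onI)
  fix x y assume xy: "x \<in> ends" "y \<in> ends" "succ_arc v x = succ_arc v y"
  obtain k b where k: "k < n" "x = sink k b" using ends_sink[OF xy(1)] by blast
  obtain j b' where j: "j < n" "y = sink j b'" using ends_sink[OF xy(2)] by blast
  show "x = y" using xy(3) unfolding k(2) j(2) succ_arc_sink[OF k(1)] succ_arc_sink[OF j(1)] source_eq_iff[OF k(1) j(1)]
      sink_eq_iff[OF k(1) j(1)] by auto
qed

lemma succ_arc_ends: "succ_arc v ` ends \<subseteq> ends"
  using ends_sink succ_arc_sink source_ends by fastforce

lemma smoothing_succ:
  assumes "e \<in> ends" shows "(e, succ_arc v e) \<in> smoothing_rel D v \<union> (smoothing_rel D v)\<inverse>"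
proof -
  obtain k b where k: "k < n" "e = sink k b" using ends_sink[OF assms] by blast
  let ?S = "if k \<in> v then {(arc k 0, arc k 3), (arc k 1, arc k 2)}
     else {(arc k 0, arc k 1), (arc k 2, arc k 3)}"
  have "(sink k b, source k (b \<noteq> crossed v k)) \<in> ?S \<union> ?S\<inverse>"
    by (cases b; cases "c (ui k)"; cases "k \<in> v"; cases "pos k")
       (simp_all add: sink_def source_def crossed_def slots_eq)
  moreover have "?S \<subseteq> smoothing_rel D v" unfolding smoothing_rel_def using k(1) by blast
  ultimately show ?thesis unfolding k(2) succ_arc_sink[OF k(1)] by blast
qed

lemma smoothing_cases:
  assumes "(x, y) \<in> smoothing_rel D v"
  shows "x \<in> ends \<and> y = succ_arc v x \<or> y \<in> ends \<and> x = succ_arc v y"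
proof -
  obtain k where k: "k < n" "(x, y) \<in> (if k \<in> v then {(arc k 0, arc k 3), (arc k 1, arc k 2)}
     else {(arc k 0, arc k 1), (arc k 2, arc k 3)})"
    using assms unfolding smoothing_rel_def by blast
  have "(if k \<in> v then {(arc k 0, arc k 3), (arc k 1, arc k 2)}
      else {(arc k 0, arc k 1), (arc k 2, arc k 3)})
    \<subseteq> (\<Union>b. {(sink k b, source k (b \<noteq> crossed v k)), (source k (b \<noteq> crossed v k), sink k b)})"
    by (cases "c (ui k)"; cases "k \<in> v"; cases "pos k")
       (simp_all add: sink_def source_def crossed_def slots_eq UNIV_bool)
  with k(2) have "(x, y) \<in> (\<Union>b. {(sink k b, source k (b \<noteq> crossed v k)), (source k (b \<noteq> crossed v k), sink k b)})"
    by blast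
  then obtain b where "x = sink k b \<and> y = source k (b \<noteq> crossed v k) \<or> y = sink k b \<and> x = source k (b \<noteq> crossed v k)"
    by blast
  then show ?thesis using succ_arc_sink[OF k(1)] sink_ends[OF k(1)] by auto
qed

text \<open>A circle is generated by undirected steps, an orbit by forward ones. Backward steps are
  covered because iterating a permutation of a finite set returns to the start.\<close>

lemma circle_orbit:
  assumes "a \<in> ends" shows "b \<in> circle D v a \<longleftrightarrow> (\<exists>i. (succ_arc v ^^ i) a = b)"
proof
  let ?f = "succ_arc v"
  have fe: "(?f ^^ i) a \<in> ends" for i
    by (induction i) (use assms succ_arc_ends in auto)
  assume b: "b \<in> circle D v a"
  have "circle D v a \<subseteq> {x. \<exists>i. (?f ^^ i) a = x}" unfolding circle_def
  proof (rule gen_class_subset)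
    show "a \<in> {x. \<exists>i. (?f ^^ i) a = x}" by (auto intro: exI[of _ 0])
    have step: "(\<exists>i. (?f ^^ i) a = x) \<longleftrightarrow> (\<exists>i. (?f ^^ i) a = ?f x)" if "x \<in> ends" for x
    proof
      assume "\<exists>i. (?f ^^ i) a = x" then show "\<exists>i. (?f ^^ i) a = ?f x" by (metis funpow.simps(2) comp_apply)
    next
      assume "\<exists>i. (?f ^^ i) a = ?f x"
      then obtain i where i: "(?f ^^ i) a = ?f x" by blast
      obtain m where m: "m > 0" "(?f ^^ m) a = a"
        using funpow_return[OF finite_ends succ_arc_ends succ_arc_inj assms] by blast
      have "(?f ^^ (i + m)) a = ?f x" using i m by (simp add: funpow_add)
      then have "?f ((?f ^^ (i + m - 1)) a) = ?f x" using m(1) by (cases "i + m") auto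
      then have "(?f ^^ (i + m - 1)) a = x" using succ_arc_inj fe that by (metis inj_onD)
      then show "\<exists>i. (?f ^^ i) a = x" by blast
    qed
    fix x y assume "(x, y) \<in> smoothing_rel D v"
    from smoothing_cases[OF this] step show "x \<in> {x. \<exists>i. (?f ^^ i) a = x} \<longleftrightarrow> y \<in> {x. \<exists>i. (?f ^^ i) a = x}"
      by auto
  qed
  with b show "\<exists>i. (?f ^^ i) a = b" by auto
next
  assume "\<exists>i. (succ_arc v ^^ i) a = b"
  then obtain i where i: "(succ_arc v ^^ i) a = b" by blast
  have "(succ_arc v ^^ i) a \<in> circle D v a \<and> (succ_arc v ^^ i) a \<in> ends" for i
  proof (induction i)
    case 0 then show ?case using assms circle_self by simp
  next
    case (Suc i)
    then have "succ_arc v ((succ_arc v ^^ i) a) \<in> circle D v a"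
      using circle_step[OF smoothing_succ, of "(succ_arc v ^^ i) a" v] circle_eq_iff by blast
    with Suc show ?case using succ_arc_ends by auto
  qed
  with i show "b \<in> circle D v a" by blast
qed

lemma circle_slots:
  assumes "k < n"
  shows "k \<in> v \<Longrightarrow> circle D v (arc k 3) = circle D v (arc k 0)"
    "k \<in> v \<Longrightarrow> circle D v (arc k 1) = circle D v (arc k 2)"
    "k \<notin> v \<Longrightarrow> circle D v (arc k 1) = circle D v (arc k 0)"
    "k \<notin> v \<Longrightarrow> circle D v (arc k 3) = circle D v (arc k 2)"
proof -
  show "k \<in> v \<Longrightarrow> circle D v (arc k 3) = circle D v (arc k 0)"
    "k \<in> v \<Longrightarrow> circle D v (arc k 1) = circle D v (arc k 2)"
    "k \<notin> v \<Longrightarrow> circle D v (arc k 1) = circle D v (arc k 0)"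
    "k \<notin> v \<Longrightarrow> circle D v (arc k 3) = circle D v (arc k 2)"
    by (rule circle_step, unfold smoothing_rel_def, use assms in \<open>force split: if_splits\<close>)+
qed

text \<open>There are no one-to-one bifurcations.\<close>

lemma circle_bifurcation:
  assumes "adjacent D k v w"
  shows "circ v k = circ' v k \<longleftrightarrow>
    circ w k \<noteq> circ' w k"
proof -
  have k: "k < n" and kv: "k \<in> v \<longleftrightarrow> k \<notin> w" and jv: "\<And>j. j \<noteq> k \<Longrightarrow> j \<in> v \<longleftrightarrow> j \<in> w"
    using assms by (auto simp: adjacent_def)
  let ?a = "sink k True" and ?b = "sink k False"
  have cr: "crossed v k \<longleftrightarrow> \<not> crossed w k" "\<And>j. j \<noteq> k \<Longrightarrow> crossed v j \<longleftrightarrow> crossed w j"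
    using kv jv by (auto simp: crossed_def)
  \<comment> \<open>Flipping \<open>crossed\<close> at \<open>k\<close> exchanges the successors of
    its two sinks and nothing else: the permutation is multiplied by a transposition.\<close>
  have "succ_arc w x = succ_arc v x" if "x \<in> ends" "x \<noteq> ?a" "x \<noteq> ?b" for x
  proof -
    from ends_sink[OF that(1)] obtain j b where j: "j < n" "x = sink j b" by blast
    with that(2,3) have "j \<noteq> k" by (cases b) auto
    with j cr(2) show ?thesis by (simp add: succ_arc_sink)
  qed
  moreover have "succ_arc w ?a = succ_arc v ?b" "succ_arc w ?b = succ_arc v ?a"
    using cr(1) by (simp_all add: succ_arc_sink[OF k])
  moreover have "?a \<noteq> ?b" using sink_eq_iff[OF k k] by simp
  ultimately have "(\<exists>i. (succ_arc v ^^ i) ?a = ?b) \<longleftrightarrow> (\<nexists>i. (succ_arc w ^^ i) ?b = ?a)"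
    using sink_ends[OF k] by (intro transposed_orbits[OF finite_ends succ_arc_ends succ_arc_inj])
  then have *: "circle D v ?a = circle D v ?b \<longleftrightarrow> circle D w ?b \<noteq> circle D w ?a"
    using circle_orbit sink_ends[OF k] circle_eq_iff by blast
  show ?thesis
  proof (cases "c (ui k)")
    case True
    with * show ?thesis by (auto simp: sink_def slots_eq)
  next
    case False
    \<comment> \<open>Here the sinks lie on the over-strand; in either resolution each of them
      shares a circle with slot \<open>0\<close> or slot \<open>2\<close>.\<close>
    then have "{?a, ?b} = {arc k 1, arc k 3}" by (auto simp: sink_def slots_eq)
    then have circ: "circle D v (arc k 1) = circle D v (arc k 3) \<longleftrightarrow> circle D w (arc k 1) \<noteq> circle D w (arc k 3)"
      using * by (auto simp: doubleton_eq_iff)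
    then show ?thesis
    proof (cases "k \<in> v")
      case True
      with kv have "k \<notin> w" by blast
      with circ True show ?thesis
        unfolding circle_slots(1,2)[OF k True] circle_slots(3,4)[OF k \<open>k \<notin> w\<close>] by metis
    next
      case False
      with kv have "k \<in> w" by blast
      with circ False show ?thesis
        unfolding circle_slots(3,4)[OF k False] circle_slots(1,2)[OF k \<open>k \<in> w\<close>] by metis
    qed
  qed
qed

section \<open>Change of the circles along an edge of the cube\<close>

lemma smoothing_adjacent:
  assumes "adjacent D k v w" and "x \<notin> arc k ` {..<4} \<or> y \<notin> arc k ` {..<4}"
  shows "(x, y) \<in> smoothing_rel D v \<longleftrightarrow> (x, y) \<in> smoothing_rel D w"
proof -
  have jv: "j \<in> v \<longleftrightarrow> j \<in> w" if "j \<noteq> k" for j using assms(1) that by (auto simp: adjacent_def)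
  let ?S = "\<lambda>v j. (x, y) \<in> (if j \<in> v then {(arc j 0, arc j 3), (arc j 1, arc j 2)}
     else {(arc j 0, arc j 1), (arc j 2, arc j 3)})"
  have "?S v j = ?S w j" for j
  proof (cases "j = k")
    case True
    have "arc k s \<in> arc k ` {..<4}" if "s < 4" for s using that by simp
    from this[of 0] this[of 1] this[of 2] this[of 3] assms(2)
    have "\<not> ?S v k" "\<not> ?S w k" by (auto split: if_splits)
    then show ?thesis unfolding True by blast
  qed (simp add: jv)
  then show ?thesis unfolding smoothing_rel_def by (simp only: UN_iff)
qed

lemma circle_adjacent:
  assumes "adjacent D k v w" and "arc k ` {..<4} \<inter> circle D v e = {}"
  shows "circle D w e = circle D v e"
  unfolding circle_def
proof (rule gen_class_local)
  fix x y assume "x \<in> gen_class (smoothing_rel D v) e \<or> y \<in> gen_class (smoothing_rel D v) e"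
  then have "x \<notin> arc k ` {..<4} \<or> y \<notin> arc k ` {..<4}"
    using assms(2) unfolding circle_def by blast
  then show "(x, y) \<in> smoothing_rel D v \<longleftrightarrow> (x, y) \<in> smoothing_rel D w"
    by (rule smoothing_adjacent[OF assms(1)])
qed

text \<open>Stated in the direction in which two circles become one; a split is the same statement
  with \<open>v\<close> and \<open>w\<close> exchanged. \<open>K\<close> collects the circles away
  from \<open>k\<close>.\<close>

lemma circle_merge:
  assumes adj: "adjacent D k v w" and ne: "circ v k \<noteq> circ' v k"
  defines "A \<equiv> circ v k" and "B \<equiv> circ' v k"
  obtains K where "finite K" "A \<notin> K" "B \<notin> K" "A \<union> B \<notin> K"
    "circles D v = insert A (insert B K)" "circles D w = insert (A \<union> B) K"
    "circ w k = A \<union> B" "circ' w k = A \<union> B"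
proof -
  have k: "k < n" and kv: "k \<in> v \<longleftrightarrow> k \<notin> w" and jv: "\<And>j. j \<noteq> k \<Longrightarrow> j \<in> v \<longleftrightarrow> j \<in> w"
    using adj by (auto simp: adjacent_def)
  have eq: "circ w k = circ' w k" using circle_bifurcation[OF adj] ne by blast
  \<comment> \<open>\<open>t1\<close> and \<open>t3\<close> are the partners of slots
    \<open>0\<close> and \<open>2\<close> at \<open>v\<close>; at \<open>w\<close> the partners are
    exchanged.\<close>
  define t1 where "t1 = (if k \<in> v then arc k 3 else arc k 1)"
  define t3 where "t3 = (if k \<in> v then arc k 1 else arc k 3)"
  have ts: "{arc k 0, t1, arc k 2, t3} = arc k ` {..<4}"
    by (auto simp: t1_def t3_def numeral_eq_Suc lessThan_Suc)
  note S = class_surgery[of "circle D v" "circle D w" t1 "arc k 0" t3 "arc k 2"]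
  have S': "circ w k = A \<union> B" "\<And>e. e \<notin> A \<union> B \<Longrightarrow> circle D w e = circle D v e"
  proof -
    have 1: "t1 \<in> circ v k" "t3 \<in> circ' v k"
      "t3 \<in> circ w k" "t1 \<in> circ' w k"
      unfolding circle_eq_iff[symmetric]
    proof (atomize (full), cases "k \<in> v")
      case True
      with kv have "k \<notin> w" by blast
      from True have t: "t1 = arc k 3" "t3 = arc k 1" by (simp_all add: t1_def t3_def)
      show "(circ v k = circle D v t1 \<and> circ' v k = circle D v t3) \<and>
        circ w k = circle D w t3 \<and> circ' w k = circle D w t1"
        unfolding t by (simp only: circle_slots(1,2)[OF k True] circle_slots(3,4)[OF k \<open>k \<notin> w\<close>])
    next
      case False
      with kv have "k \<in> w" by blast
      from False have t: "t1 = arc k 1" "t3 = arc k 3" by (simp_all add: t1_def t3_def)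
      show "(circ v k = circle D v t1 \<and> circ' v k = circle D v t3) \<and>
        circ w k = circle D w t3 \<and> circ' w k = circle D w t1"
        unfolding t by (simp only: circle_slots(3,4)[OF k False] circle_slots(1,2)[OF k \<open>k \<in> w\<close>])
    qed
    have 2: "circle D w e = circle D v e" if "{arc k 0, t1, arc k 2, t3} \<inter> circle D v e = {}" for e
      using circle_adjacent[OF adj] that unfolding ts .
    have 3: "circle D w e = circle D v e" if "{arc k 0, t1, arc k 2, t3} \<inter> circle D w e = {}" for e
      using circle_adjacent[OF adj[unfolded adjacent_sym[of D k v]], symmetric] that unfolding ts .
    show "circ w k = A \<union> B" unfolding A_def B_def
      by (rule S(1)) (fact circle_eq_iff 1 2 3 ne eq)+
    show "circle D w e = circle D v e" if "e \<notin> A \<union> B" for e using that unfolding A_def B_def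
      by (rule S(2)[rotated -1]) (fact circle_eq_iff 1 2 3 ne eq)+
  qed
  define K where "K = circle D v ` (arcs D - (A \<union> B))"
  have AB: "circle D v e = A \<longleftrightarrow> e \<in> A" "circle D v e = B \<longleftrightarrow> e \<in> B" for e
    unfolding A_def B_def using circle_eq_iff by metis+
  have sA: "arc k 0 \<in> A" "arc k 2 \<in> B" by (auto simp: A_def B_def circle_self)
  have arcsAB: "arc k 0 \<in> arcs D" "arc k 2 \<in> arcs D" using slot_arcs k by auto
  have K': "K = circle D w ` (arcs D - (A \<union> B))" unfolding K_def using S'(2) by (intro image_cong) auto
  have w: "circle D w e = A \<union> B" if "e \<in> A \<union> B" for e using S'(1) that circle_eq_iff by metis
  show ?thesis
  proof
    show "finite K" using finite_arcs by (simp add: K_def)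
    show "A \<notin> K" "B \<notin> K" using AB by (auto simp: K_def)
    show "A \<union> B \<notin> K"
    proof
      assume "A \<union> B \<in> K"
      then obtain e where "e \<notin> A \<union> B" "A \<union> B = circle D v e" by (auto simp: K_def)
      then show False using circle_self by blast
    qed
    have "e \<in> arcs D \<Longrightarrow> circle D v e \<in> insert A (insert B K)" for e using AB K_def by blast
    then show "circles D v = insert A (insert B K)" using arcsAB by (auto simp: circles_def K_def A_def B_def)
    have "e \<in> arcs D \<Longrightarrow> circle D w e \<in> insert (A \<union> B) K" for e using w K' by blast
    moreover have "A \<union> B \<in> circle D w ` arcs D" using arcsAB S'(1) by blast
    ultimately show "circles D w = insert (A \<union> B) K" by (auto simp: circles_def K')
    show "circ w k = A \<union> B" "circ' w k = A \<union> B" using S' eq by auto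
  qed
qed

abbreviation "surgery v w k \<equiv> surgery_coeff (circles D v) (circ v k) (circ' v k)
  (circ w k) (circ' w k)"

definition edge_weight :: "nat set \<Rightarrow> nat \<Rightarrow> nat set \<Rightarrow> 'r::comm_ring_1 poly" where
  "edge_weight v k P = (if circ v k \<noteq> circ' v k then 1
     else split_weight (arc k 0) P)"

text \<open>A merge is never obstructed, since a state of the merged circle is constant on the two
  circles before. After a split, a state that separates the two new circles does not fit
  \<open>v\<close>, and exactly there \<open>\<Delta>\<close> evaluates to \<open>0\<close>.\<close>

lemma surgery_hat:
  fixes f :: "nat set set \<Rightarrow> 'r::comm_ring_1 poly"
  assumes adj: "adjacent D k v w" and P: "fits w P"
  shows "(\<Sum>T\<in>Pow (circles D w). weight P T * (\<Sum>L\<in>Pow (circles D v).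
      surgery v w k L T * f L))
    = (if fits v P then edge_weight v k P * (\<Sum>L\<in>Pow (circles D v). weight P L * f L) else 0)"
    (is "?lhs = _")
proof -
  let ?s = "surgery v w k :: _ \<Rightarrow> _ \<Rightarrow> 'r poly"
  have "?lhs = (\<Sum>T\<in>Pow (circles D w). \<Sum>L\<in>Pow (circles D v). (weight P T * ?s L T) * f L)"
    by (simp add: sum_distrib_left mult.assoc)
  also have "\<dots> = (\<Sum>L\<in>Pow (circles D v). (\<Sum>T\<in>Pow (circles D w). weight P T * ?s L T) * f L)"
    by (subst sum.swap) (simp add: sum_distrib_right)
  also have "\<dots> = (\<Sum>L\<in>Pow (circles D v).
      ((if fits v P then edge_weight v k P else 0) * weight P L) * f L)"
  proof (intro sum.cong refl arg_cong2[where f = "(*)"])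
    fix L assume L: "L \<in> Pow (circles D v)"
    note Pv = compatible_adjacent[OF adj P]
    have sub: "circle D v (arc k s) \<subseteq> P \<longleftrightarrow> arc k s \<in> P" if "fits v P" for s
      using compatible_circle that by blast
    have subw: "circle D w (arc k s) \<subseteq> P \<longleftrightarrow> arc k s \<in> P" for s
      using compatible_circle P by blast
    show "(\<Sum>T\<in>Pow (circles D w). weight P T * ?s L T) =
      (if fits v P then edge_weight v k P else 0) * weight P L"
    proof (cases "circ v k = circ' v k")
      case False
      obtain K where K: "finite K" "circ v k \<notin> K" "circ' v k \<notin> K"
        "circ v k \<union> circ' v k \<notin> K"
        "circles D v = insert (circ v k) (insert (circ' v k) K)"
        "circles D w = insert (circ v k \<union> circ' v k) K"
        "circ w k = circ v k \<union> circ' v k"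
        "circ' w k = circ v k \<union> circ' v k"
        using circle_merge[OF adj False] by blast
      have "arc k 0 \<in> P \<longleftrightarrow> arc k 2 \<in> P" using subw[of 0] subw[of 2] K(7,8) by simp
      then have c: "fits v P" using Pv by blast
      show ?thesis
        using weight_merge[OF K(1-3) False K(4), of L P] L sub[OF c, of 0] sub[OF c, of 2] subw[of 0] subw[of 2] c False
        by (simp add: K(5-8) edge_weight_def)
    next
      case True
      then have ne: "circ w k \<noteq> circ' w k" using circle_bifurcation[OF adj] by blast
      obtain K where K: "finite K" "circ w k \<notin> K" "circ' w k \<notin> K"
        "circ w k \<union> circ' w k \<notin> K"
        "circles D w = insert (circ w k) (insert (circ' w k) K)"
        "circles D v = insert (circ w k \<union> circ' w k) K"
        "circ v k = circ w k \<union> circ' w k"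
        "circ' v k = circ w k \<union> circ' w k"
        using circle_merge[OF adj[unfolded adjacent_sym[of D k v]] ne] by blast
      show ?thesis
        using weight_split[OF K(1-3) ne K(4), of L P] L
        by (cases "arc k 0 \<in> P"; cases "arc k 2 \<in> P")
           (simp_all add: K(5-8) edge_weight_def split_weight_def subw Pv)
    qed
  qed
  also have "\<dots> = (if fits v P then edge_weight v k P * (\<Sum>L\<in>Pow (circles D v). weight P L * f L) else 0)"
    by (simp add: sum_distrib_left mult.assoc)
  finally show ?thesis .
qed

end

section \<open>Planarity\<close>

context wf_diagram
begin

section \<open>Half-edges as heads and tails of arcs\<close>

definition arc_of :: "nat \<times> nat \<Rightarrow> nat" where "arc_of h = slot D (fst h) (snd h)"

definition in_half :: "(nat \<times> nat) set" where
  "in_half = {(k, s). k < n \<and> (s = 0 \<or> s = (if pos k then 3 else 1))}"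

definition out_half :: "(nat \<times> nat) set" where
  "out_half = {(k, s). k < n \<and> (s = 2 \<or> s = (if pos k then 1 else 3))}"

lemma half_edges_split: "half_edges D = in_half \<union> out_half" "in_half \<inter> out_half = {}"
proof -
  have "(k, s) \<in> half_edges D \<longleftrightarrow> (k, s) \<in> in_half \<union> out_half" for k s
    by (cases "pos k"; cases "k < n";
        simp add: half_edges_def in_half_def out_half_def; presburger)
  then show "half_edges D = in_half \<union> out_half" by (simp add: set_eq_iff)
  have "(k, s) \<notin> in_half \<inter> out_half" for k s
    by (cases "pos k"; simp add: in_half_def out_half_def; presburger)
  then show "in_half \<inter> out_half = {}" by auto
qed

lemma arc_of_in_half: "(k, s) \<in> in_half \<Longrightarrow> arc_of (k, s) = (if s = 0 then ui k else oi k)"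
  and arc_of_out_half: "(k, s) \<in> out_half \<Longrightarrow> arc_of (k, s) = (if s = 2 then uo k else oo k)"
  by (cases "pos k"; auto simp: in_half_def out_half_def arc_of_def slots_eq)+

lemma finite_half_edges: "finite (half_edges D)"
  by (simp add: half_edges_def)

lemma bij_half:
  assumes S: "S = (\<Union>k<n. {(k, a k), (k, b k)})"
    and arcs: "\<And>k. arc k (a k) = f k" "\<And>k. arc k (b k) = g k" and E: "ends = (\<Union>k<n. {f k, g k})"
    and inj: "\<And>k j. k < n \<Longrightarrow> j < n \<Longrightarrow> (f k = f j \<longleftrightarrow> k = j) \<and> (g k = g j \<longleftrightarrow> k = j) \<and> f k \<noteq> g j"
  shows "bij_betw arc_of S ends"
  unfolding bij_betw_def
proof
  show "inj_on arc_of S"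
  proof (rule inj_onI)
    fix h h' assume h: "h \<in> S" "h' \<in> S" "arc_of h = arc_of h'"
    then obtain k j where k: "k < n" "j < n" "h = (k, a k) \<or> h = (k, b k)" "h' = (j, a j) \<or> h' = (j, b j)"
      unfolding S by blast
    then show "h = h'" using h(3) inj[OF k(1,2)] inj[OF k(2,1)] by (auto simp: arc_of_def arcs)
  qed
  show "arc_of ` S = ends" by (simp add: S E image_UN arc_of_def arcs)
qed

lemma bij_in: "bij_betw arc_of in_half ends"
  by (rule bij_half[where a = "\<lambda>_. 0" and b = "\<lambda>k. if pos k then 3 else 1" and f = ui and g = oi])
     (auto simp: in_half_def ends_def slots_eq ins_distinct)

lemma bij_out: "bij_betw arc_of out_half ends"
  by (rule bij_half[where a = "\<lambda>_. 2" and b = "\<lambda>k. if pos k then 1 else 3" and f = uo and g = oo])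
     (auto simp: out_half_def ends_eq slots_eq ins_distinct)

definition head :: "nat \<Rightarrow> nat \<times> nat" where "head = the_inv_into in_half arc_of"
definition tail :: "nat \<Rightarrow> nat \<times> nat" where "tail = the_inv_into out_half arc_of"

lemma head_tail:
  "e \<in> ends \<Longrightarrow> head e \<in> in_half" "e \<in> ends \<Longrightarrow> tail e \<in> out_half"
  "e \<in> ends \<Longrightarrow> arc_of (head e) = e" "e \<in> ends \<Longrightarrow> arc_of (tail e) = e"
  "h \<in> in_half \<Longrightarrow> head (arc_of h) = h" "h \<in> out_half \<Longrightarrow> tail (arc_of h) = h"
  using bij_in bij_out unfolding bij_betw_def head_def tail_def
  by (metis the_inv_into_into order_refl, metis the_inv_into_into order_refl, metis f_the_inv_into_f,
      metis f_the_inv_into_f, metis the_inv_into_f_f, metis the_inv_into_f_f)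

lemma arc_of_ends: "h \<in> half_edges D \<Longrightarrow> arc_of h \<in> ends"
  using bij_in bij_out half_edges_split(1) unfolding bij_betw_def by blast

lemma card_ends: "card ends = 2 * n"
proof -
  have "card ends = card in_half" "card ends = card out_half"
    using bij_betw_same_card[OF bij_in] bij_betw_same_card[OF bij_out] by simp_all
  moreover have "card (half_edges D) = card in_half + card out_half"
    using half_edges_split finite_half_edges by (simp add: card_Un_disjoint)
  ultimately show ?thesis by (simp add: half_edges_def)
qed

text \<open>Each arc has one head and one tail, so products over arcs can be regrouped by
  half-edges, and from there by faces or by crossings.\<close>

lemma prod_half_edges:
  fixes g :: "nat \<times> nat \<Rightarrow> int"
  assumes "U \<subseteq> ends"
  shows "(\<Prod>e\<in>U. g (head e) * g (tail e)) = (\<Prod>h\<in>half_edges D. if arc_of h \<in> U then g h else 1)"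
proof -
  have part: "(\<Prod>e\<in>U. g (i e)) = (\<Prod>h\<in>A. if arc_of h \<in> U then g h else 1)"
    if A: "bij_betw arc_of A ends" "finite A" "\<And>h. h \<in> A \<Longrightarrow> i (arc_of h) = h" for A i
  proof -
    have "bij_betw arc_of {h \<in> A. arc_of h \<in> U} U"
      using A(1) assms unfolding bij_betw_def by (auto intro: inj_on_subset)
    then have "(\<Prod>e\<in>U. g (i e)) = (\<Prod>h\<in>{h \<in> A. arc_of h \<in> U}. g (i (arc_of h)))"
      using prod.reindex_bij_betw[of arc_of "{h \<in> A. arc_of h \<in> U}" U "\<lambda>e. g (i e)"] by simp
    also have "\<dots> = (\<Prod>h\<in>{h \<in> A. arc_of h \<in> U}. g h)" by (intro prod.cong) (auto simp: A(3))
    also have "\<dots> = (\<Prod>h\<in>A. if arc_of h \<in> U then g h else 1)" using A(2) by (rule prod.inter_filter)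
    finally show ?thesis .
  qed
  have fin: "finite in_half" "finite out_half" using finite_half_edges half_edges_split(1) by simp_all
  have "(\<Prod>e\<in>U. g (head e)) = (\<Prod>h\<in>in_half. if arc_of h \<in> U then g h else 1)"
    using bij_in fin(1) by (rule part) (rule head_tail(5))
  moreover have "(\<Prod>e\<in>U. g (tail e)) = (\<Prod>h\<in>out_half. if arc_of h \<in> U then g h else 1)"
    using bij_out fin(2) by (rule part) (rule head_tail(6))
  ultimately show ?thesis
    by (simp add: prod.distrib half_edges_split(1) prod.union_disjoint[OF fin half_edges_split(2)])
qed

section \<open>Faces and cocycles modulo two\<close>

abbreviation face :: "nat \<times> nat \<Rightarrow> (nat \<times> nat) set" where "face h \<equiv> gen_class (face_rel D) h"

lemma face_subset: "h \<in> half_edges D \<Longrightarrow> face h \<subseteq> half_edges D"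
  by (rule gen_class_subset) (auto simp: face_rel_def half_edges_def)

lemma finite_faces: "finite (faces D)"
  by (simp add: faces_def finite_half_edges)

lemma faces_Union: "\<Union>(faces D) = half_edges D"
proof
  show "\<Union>(faces D) \<subseteq> half_edges D"
    unfolding faces_def using face_subset by (intro UN_least)
  show "half_edges D \<subseteq> \<Union>(faces D)"
  proof
    fix h assume "h \<in> half_edges D"
    then show "h \<in> \<Union>(faces D)" unfolding faces_def by (intro UN_I[of h] gen_class_self)
  qed
qed

lemma face_mem:
  assumes "f \<in> faces D" "h \<in> f" shows "face h = f"
proof -
  obtain x where "f = face x" using assms(1) unfolding faces_def by (rule imageE)
  then show ?thesis using assms(2) gen_class_eq_iff[of "face_rel D" x h] by simp
qed

lemma prod_faces: "(\<Prod>f\<in>faces D. \<Prod>h\<in>f. g h) = (\<Prod>h\<in>half_edges D. g h :: int)"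
proof -
  have "f \<inter> f' = {}" if "f \<in> faces D" "f' \<in> faces D" "f \<noteq> f'" for f f'
  proof (rule equals0I)
    fix h assume "h \<in> f \<inter> f'"
    then have "face h = f" "face h = f'" using that face_mem by blast+
    with that(3) show False by simp
  qed
  moreover have "finite f" if "f \<in> faces D" for f
    using finite_subset[OF _ finite_half_edges] that faces_Union by blast
  ultimately have "(\<Prod>h\<in>\<Union>(faces D). g h) = (\<Prod>f\<in>faces D. \<Prod>h\<in>f. g h)"
    using prod.Union_disjoint[of "faces D" g] by (simp add: comp_def)
  then show ?thesis by (simp add: faces_Union)
qed

text \<open>The parity with which \<open>U\<close> meets the boundary walk of \<open>f\<close>:
  after the corner \<open>(k, s)\<close> the walk follows the arc in slot \<open>s\<close>.\<close>

definition face_sign :: "nat set \<Rightarrow> (nat \<times> nat) set \<Rightarrow> int" where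
  "face_sign U f = (\<Prod>h\<in>f. if arc_of h \<in> U then - 1 else 1)"

definition cocycles :: "nat set set" where
  "cocycles = {U. U \<subseteq> ends \<and> (\<forall>f\<in>faces D. face_sign U f = 1)}"

text \<open>Read as corners, the head and the tail of an arc lie on its two sides, so the product of
  their colours tells whether the colouring changes across the arc.\<close>

definition face_colour :: "(nat \<times> nat) set set \<Rightarrow> nat \<times> nat \<Rightarrow> int" where
  "face_colour S h = (if face h \<in> S then - 1 else 1)"

lemma prod_one_minus_one:
  fixes a :: "'b \<Rightarrow> int"
  assumes "\<And>x. x \<in> A \<Longrightarrow> a x = 1 \<or> a x = - 1"
  shows "(\<Prod>x\<in>A. a x) = 1 \<or> (\<Prod>x\<in>A. a x) = - 1"
  using assms
proof (induction A rule: infinite_finite_induct)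
  case (insert x A)
  have "a x = 1 \<or> a x = - 1" using insert.prems by simp
  moreover have "prod a A = 1 \<or> prod a A = - 1" using insert.prems by (intro insert.IH) simp
  ultimately show ?case using insert.hyps by auto
qed simp_all

text \<open>A multiple of the indicator of "all signs are \<open>1\<close>", in a form that expands
  into a sum over subsets.\<close>

lemma prod_plus_one:
  fixes a :: "'b \<Rightarrow> int"
  assumes "finite A" "\<And>x. x \<in> A \<Longrightarrow> a x = 1 \<or> a x = - 1"
  shows "(\<Prod>x\<in>A. a x + 1) = (if \<forall>x\<in>A. a x = 1 then 2 ^ card A else 0)"
proof (cases "\<forall>x\<in>A. a x = 1")
  case False
  then obtain x where x: "x \<in> A" "a x \<noteq> 1" by blast
  then have "a x + 1 = 0" using assms(2)[of x] by simp
  then have "(\<Prod>x\<in>A. a x + 1) = 0" using assms(1) x(1) by (intro prod_zero) auto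
  then show ?thesis using False by simp
qed simp

text \<open>Poisson summation for the coboundary of the faces, over the field with two elements.\<close>

lemma face_colour_sum:
  fixes t :: int
  assumes t: "t = 1 \<or> t = - 1"
  shows "2 ^ (2 * n) * int (card {S \<in> Pow (faces D). \<forall>e\<in>ends. t * (face_colour S (head e) * face_colour S (tail e)) = 1})
    = 2 ^ card (faces D) * (\<Sum>U\<in>cocycles. t ^ card U)"
proof -
  let ?g = "\<lambda>S e. t * (face_colour S (head e) * face_colour S (tail e))"
  have "2 ^ (2 * n) * int (card {S \<in> Pow (faces D). \<forall>e\<in>ends. ?g S e = 1})
    = (\<Sum>S\<in>Pow (faces D). if \<forall>e\<in>ends. ?g S e = 1 then 2 ^ card ends else 0)"
    using finite_faces by (simp add: card_ends flip: sum.inter_filter)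
  also have "\<dots> = (\<Sum>S\<in>Pow (faces D). \<Prod>e\<in>ends. ?g S e + 1)"
    using t by (intro sum.cong refl prod_plus_one[symmetric] finite_ends) (auto simp: face_colour_def)
  \<comment> \<open>Expanding over arcs introduces the sets \<open>U\<close>. After exchanging the
    sums, the sum over \<open>S\<close> is itself an expanded product over faces, which vanishes
    unless \<open>U\<close> is a cocycle.\<close>
  also have "\<dots> = (\<Sum>S\<in>Pow (faces D). \<Sum>U\<in>Pow ends. \<Prod>e\<in>U. ?g S e)"
    by (simp add: prod_add[OF finite_ends])
  also have "\<dots> = (\<Sum>U\<in>Pow ends. \<Sum>S\<in>Pow (faces D). \<Prod>e\<in>U. ?g S e)"
    by (rule sum.swap)
  also have "\<dots> = (\<Sum>U\<in>Pow ends. if U \<in> cocycles then 2 ^ card (faces D) * t ^ card U else 0)"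
  proof (rule sum.cong[OF refl])
    fix U assume U: "U \<in> Pow ends"
    have "(\<Prod>e\<in>U. ?g S e) = t ^ card U * (\<Prod>f\<in>S. face_sign U f)" if S: "S \<in> Pow (faces D)" for S
    proof -
      have "(\<Prod>e\<in>U. ?g S e) = t ^ card U * (\<Prod>h\<in>half_edges D. if arc_of h \<in> U then face_colour S h else 1)"
        using prod_half_edges[of U "face_colour S"] U by (simp add: prod.distrib)
      also have "(\<Prod>h\<in>half_edges D. if arc_of h \<in> U then face_colour S h else 1)
        = (\<Prod>f\<in>faces D. \<Prod>h\<in>f. if arc_of h \<in> U then face_colour S h else 1)"
        by (rule prod_faces[symmetric])
      also have "\<dots> = (\<Prod>f\<in>faces D. if f \<in> S then face_sign U f else 1)"
      proof (rule prod.cong[OF refl])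
        fix f assume f: "f \<in> faces D"
        have "(\<Prod>h\<in>f. if arc_of h \<in> U then face_colour S h else 1)
          = (\<Prod>h\<in>f. if arc_of h \<in> U then (if f \<in> S then - 1 else 1) else 1)"
          using face_mem[OF f] by (intro prod.cong) (auto simp: face_colour_def)
        then show "(\<Prod>h\<in>f. if arc_of h \<in> U then face_colour S h else 1) = (if f \<in> S then face_sign U f else 1)"
          by (simp add: face_sign_def)
      qed
      also have "\<dots> = (\<Prod>f\<in>S. face_sign U f)"
        using S finite_faces by (simp add: prod.If_cases Int_absorb1 Collect_conj_eq[symmetric])
      finally show ?thesis .
    qed
    then have "(\<Sum>S\<in>Pow (faces D). \<Prod>e\<in>U. ?g S e) = t ^ card U * (\<Sum>S\<in>Pow (faces D). \<Prod>f\<in>S. face_sign U f)"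
      by (simp add: sum_distrib_left)
    also have "(\<Sum>S\<in>Pow (faces D). \<Prod>f\<in>S. face_sign U f) = (\<Prod>f\<in>faces D. face_sign U f + 1)"
      by (simp add: prod_add[OF finite_faces])
    also have "\<dots> = (if \<forall>f\<in>faces D. face_sign U f = 1 then 2 ^ card (faces D) else 0)"
      by (intro prod_plus_one finite_faces) (unfold face_sign_def, rule prod_one_minus_one, simp)
    finally show "(\<Sum>S\<in>Pow (faces D). \<Prod>e\<in>U. ?g S e) = (if U \<in> cocycles then 2 ^ card (faces D) * t ^ card U else 0)"
      using U by (simp add: cocycles_def)
  qed
  also have "\<dots> = (\<Sum>U\<in>{U \<in> Pow ends. U \<in> cocycles}. 2 ^ card (faces D) * t ^ card U)"
    using finite_ends by (intro sum.inter_filter[symmetric]) simp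
  also have "{U \<in> Pow ends. U \<in> cocycles} = cocycles" by (auto simp: cocycles_def)
  finally show ?thesis by (simp add: sum_distrib_left)
qed

section \<open>Boundary walks of faces\<close>

definition mate :: "nat \<times> nat \<Rightarrow> nat \<times> nat" where
  "mate h = (if h \<in> in_half then tail (arc_of h) else head (arc_of h))"

text \<open>The next corner on the boundary walk of the same face; \<open>+ 3\<close> stands for
  \<open>- 1\<close> modulo the four slots.\<close>

definition next_corner :: "nat \<times> nat \<Rightarrow> nat \<times> nat" where
  "next_corner h = (fst (mate h), (snd (mate h) + 3) mod 4)"

lemma mate:
  assumes "h \<in> half_edges D"
  shows "mate h \<in> half_edges D" "mate h \<noteq> h" "arc_of (mate h) = arc_of h" "mate (mate h) = h"
proof -
  have e: "arc_of h \<in> ends" using assms by (rule arc_of_ends)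
  note ht = head_tail(1-4)[OF e]
  have "mate h \<in> half_edges D \<and> mate h \<noteq> h \<and> arc_of (mate h) = arc_of h \<and> mate (mate h) = h"
  proof (cases "h \<in> in_half")
    case True
    then have "mate h = tail (arc_of h)" by (simp add: mate_def)
    moreover have "tail (arc_of h) \<notin> in_half" using ht(2) half_edges_split by blast
    ultimately show ?thesis using ht True head_tail(5)[OF True] half_edges_split by (auto simp: mate_def)
  next
    case False
    then have h: "h \<in> out_half" using assms half_edges_split by blast
    have "mate h = head (arc_of h)" using False by (simp add: mate_def)
    then show ?thesis using ht h head_tail(6)[OF h] half_edges_split False by (auto simp: mate_def)
  qed
  then show "mate h \<in> half_edges D" "mate h \<noteq> h" "arc_of (mate h) = arc_of h" "mate (mate h) = h" by auto
qed

lemma mate_unique: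
  assumes "h \<in> half_edges D" "h' \<in> half_edges D" "arc_of h = arc_of h'" "h \<noteq> h'"
  shows "h' = mate h"
proof -
  have "h \<in> in_half \<longleftrightarrow> h' \<notin> in_half"
    using assms half_edges_split head_tail(5,6) by (metis UnE)
  then show ?thesis
    using assms half_edges_split(1) head_tail(5,6) unfolding mate_def by (metis UnE)
qed

lemma next_corner:
  assumes "h \<in> half_edges D"
  shows "next_corner h \<in> half_edges D" "(h, next_corner h) \<in> face_rel D" "face (next_corner h) = face h"
proof -
  note m = mate[OF assms]
  show "next_corner h \<in> half_edges D" using m(1) by (auto simp: next_corner_def half_edges_def)
  obtain k s where h: "h = (k, s)" by (cases h)
  obtain k' s' where h': "mate h = (k', s')" by (cases "mate h")
  show rel: "(h, next_corner h) \<in> face_rel D"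
    using m assms unfolding face_rel_def next_corner_def h' arc_of_def by (auto simp: h h')
  show "face (next_corner h) = face h"
    using gen_class_step[OF rel, of h] gen_class_self gen_class_eq_iff by metis
qed

lemma mate_pair:
  assumes "h \<in> half_edges D" shows "{h, mate h} = {head (arc_of h), tail (arc_of h)}"
proof (cases "h \<in> in_half")
  case True
  then show ?thesis by (simp add: mate_def head_tail(5))
next
  case False
  then have "h \<in> out_half" using assms half_edges_split(1) by blast
  with False show ?thesis by (simp add: mate_def head_tail(6) insert_commute)
qed

lemma face_turn:
  assumes "(k, s) \<in> half_edges D" shows "face (k, (s + 3) mod 4) = face (mate (k, s))"
proof -
  note mm = mate[OF assms]
  have "next_corner (mate (k, s)) = (k, (s + 3) mod 4)" by (simp add: next_corner_def mm)
  then show ?thesis using next_corner(3)[OF mm(1)] by simp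
qed

lemma next_corner_inj: "inj_on next_corner (half_edges D)"
proof (rule inj_onI)
  fix h h' assume h: "h \<in> half_edges D" "h' \<in> half_edges D" "next_corner h = next_corner h'"
  have "((a + 3) mod 4 + 1) mod 4 = a" if "a < 4" for a :: nat
  proof -
    have "a = 0 \<or> a = 1 \<or> a = 2 \<or> a = 3" using that by arith
    then show ?thesis by (elim disjE) simp_all
  qed
  then have turn_inj: "a = b" if "(a + 3) mod 4 = (b + 3) mod 4" "a < 4" "b < 4" for a b :: nat using that by metis
  have "snd (mate h) < 4" "snd (mate h') < 4" using mate(1)[OF h(1)] mate(1)[OF h(2)] by (auto simp: half_edges_def)
  moreover have "fst (mate h) = fst (mate h')" "(snd (mate h) + 3) mod 4 = (snd (mate h') + 3) mod 4"
    using h(3) by (simp_all add: next_corner_def)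
  ultimately have "mate h = mate h'" using turn_inj by (intro prod_eqI)
  then have "mate (mate h) = mate (mate h')" by simp
  then show "h = h'" by (simp only: mate(4)[OF h(1)] mate(4)[OF h(2)])
qed

lemma next_corner_face: "f \<in> faces D \<Longrightarrow> bij_betw next_corner f f"
proof -
  assume f: "f \<in> faces D"
  then have sub: "f \<subseteq> half_edges D" using faces_Union by blast
  have "next_corner ` f \<subseteq> f"
  proof
    fix x assume "x \<in> next_corner ` f"
    then obtain h where h: "h \<in> f" "x = next_corner h" by blast
    then have "face x = f" using next_corner(3)[of h] face_mem[OF f] sub by auto
    then show "x \<in> f" using gen_class_self[of x "face_rel D"] by simp
  qed
  moreover have "inj_on next_corner f" using next_corner_inj sub by (rule inj_on_subset)
  ultimately show ?thesis using finite_subset[OF sub finite_half_edges] by (simp add: bij_betw_def endo_inj_surj)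
qed

section \<open>Coboundaries of vertex sets and connected components\<close>

definition coboundary :: "nat set \<Rightarrow> nat set" where
  "coboundary T = {e \<in> ends. fst (head e) \<in> T \<longleftrightarrow> fst (tail e) \<notin> T}"

lemma coboundary_mate:
  assumes "h \<in> half_edges D"
  shows "arc_of h \<in> coboundary T \<longleftrightarrow> (fst h \<in> T \<longleftrightarrow> fst (mate h) \<notin> T)"
proof (cases "h \<in> in_half")
  case True
  then show ?thesis using head_tail(5)[OF True] arc_of_ends[OF assms] by (simp add: coboundary_def mate_def)
next
  case False
  then have h: "h \<in> out_half" using assms half_edges_split by blast
  show ?thesis using head_tail(6)[OF h] False arc_of_ends[OF assms] by (auto simp: coboundary_def mate_def)
qed

definition vertex_sign :: "nat set \<Rightarrow> nat \<times> nat \<Rightarrow> int" where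
  "vertex_sign T h = (if fst h \<in> T then - 1 else 1)"

lemma vertex_sign_square: "vertex_sign T h * vertex_sign T h = 1"
  by (simp add: vertex_sign_def)

text \<open>A boundary walk is closed: the sign of each corner occurs once at the start and once at
  the end of a step.\<close>

lemma coboundary_cocycle: "coboundary T \<in> cocycles"
proof -
  have "face_sign (coboundary T) f = 1" if f: "f \<in> faces D" for f
  proof -
    have sub: "f \<subseteq> half_edges D" using f faces_Union by blast
    have "face_sign (coboundary T) f = (\<Prod>h\<in>f. vertex_sign T h * vertex_sign T (next_corner h))"
      unfolding face_sign_def
    proof (rule prod.cong[OF refl])
      fix h assume "h \<in> f"
      then have "h \<in> half_edges D" using sub by blast
      from coboundary_mate[OF this, of T]
      show "(if arc_of h \<in> coboundary T then - 1 else 1) = vertex_sign T h * vertex_sign T (next_corner h)"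
        by (cases "fst h \<in> T"; cases "fst (mate h) \<in> T") (simp_all add: vertex_sign_def next_corner_def)
    qed
    also have "\<dots> = (\<Prod>h\<in>f. vertex_sign T h) * (\<Prod>h\<in>f. vertex_sign T (next_corner h))" by (rule prod.distrib)
    also have "(\<Prod>h\<in>f. vertex_sign T (next_corner h)) = (\<Prod>h\<in>f. vertex_sign T h)"
      by (rule prod.reindex_bij_betw[OF next_corner_face[OF f]])
    finally show ?thesis by (simp add: vertex_sign_square flip: prod.distrib)
  qed
  then show ?thesis by (auto simp: cocycles_def coboundary_def)
qed

text \<open>The graph is 4-valent, so the sign of each crossing occurs four times in the product
  over half-edges. This parity makes the signed count of cocycles positive.\<close>

lemma coboundary_even: "(- 1) ^ card (coboundary T) = (1 :: int)"
proof -
  have sub: "coboundary T \<subseteq> ends" by (auto simp: coboundary_def)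
  have "(- 1) ^ card (coboundary T) = (\<Prod>e\<in>coboundary T. - 1 :: int)" by simp
  also have "\<dots> = (\<Prod>e\<in>ends. vertex_sign T (head e) * vertex_sign T (tail e))"
  proof (rule prod.mono_neutral_cong_left[OF finite_ends sub])
    show "\<forall>e\<in>ends - coboundary T. vertex_sign T (head e) * vertex_sign T (tail e) = 1"
      by (auto simp: coboundary_def vertex_sign_def)
  qed (auto simp: coboundary_def vertex_sign_def)
  also have "\<dots> = (\<Prod>h\<in>half_edges D. if arc_of h \<in> ends then vertex_sign T h else 1)"
    by (rule prod_half_edges) simp
  also have "\<dots> = (\<Prod>h\<in>half_edges D. vertex_sign T h)" by (intro prod.cong) (auto simp: arc_of_ends)
  also have "\<dots> = (\<Prod>k<n. \<Prod>s<4. vertex_sign T (k, s))"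
    unfolding half_edges_def by (subst prod.cartesian_product) simp
  also have "\<dots> = 1" by (intro prod.neutral) (simp add: vertex_sign_def)
  finally show ?thesis .
qed

definition graph_rel :: "(nat \<times> nat) set" where
  "graph_rel = {(k, k') | k s k' s'. (k, s) \<in> half_edges D \<and> (k', s') \<in> half_edges D \<and> arc k s = arc k' s'}"

definition representative :: "nat set \<Rightarrow> nat" where "representative C = (SOME k. C = gen_class graph_rel k)"

lemma graph_components_eq: "graph_components D = gen_class graph_rel ` {..<n}"
  by (simp add: graph_components_def graph_rel_def)

lemma representative: "gen_class graph_rel (representative (gen_class graph_rel k)) = gen_class graph_rel k"
  unfolding representative_def by (rule someI2[of _ k]) auto

text \<open>A set of crossings that is closed under passing along arcs is a union of connected
  components.\<close>

lemma representative_closed: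
  assumes "\<And>h. h \<in> half_edges D \<Longrightarrow> fst h \<in> X \<longleftrightarrow> fst (mate h) \<in> X"
  shows "k \<in> X \<longleftrightarrow> representative (gen_class graph_rel k) \<in> X"
proof -
  have step: "x \<in> X \<longleftrightarrow> y \<in> X" if xy: "(x, y) \<in> graph_rel" for x y
  proof -
    obtain s s' where h: "(x, s) \<in> half_edges D" "(y, s') \<in> half_edges D" "arc x s = slot D y s'"
      using xy unfolding graph_rel_def by auto
    show ?thesis
    proof (cases "(x, s) = (y, s')")
      case False
      then have "(y, s') = mate (x, s)" using mate_unique[OF h(1,2)] h(3) by (simp add: arc_of_def)
      then show ?thesis using assms[OF h(1)] by (metis fst_conv)
    qed simp
  qed
  have "gen_class graph_rel k \<subseteq> X" if "k \<in> X" for k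
    using that step by (rule gen_class_subset)
  moreover have "k \<in> gen_class graph_rel (representative (gen_class graph_rel k))"
    "representative (gen_class graph_rel k) \<in> gen_class graph_rel k"
    using representative[of k] gen_class_self[of k] gen_class_self[of "representative (gen_class graph_rel k)" graph_rel]
    by simp_all
  ultimately show ?thesis by blast
qed

text \<open>Two vertex sets with equal coboundary agree or disagree on whole components, so a
  coboundary and the values at one representative per component determine the set.\<close>

lemma card_coboundaries: "2 ^ n \<le> card (range coboundary) * 2 ^ card (graph_components D)"
proof -
  let ?c = "\<lambda>T. {C \<in> graph_components D. representative C \<in> T}"
  have fin: "finite (graph_components D)" by (simp add: graph_components_eq)
  have fin': "finite (range coboundary)"
    using finite_ends by (rule finite_subset[rotated, OF finite_Pow_iff[THEN iffD2]]) (auto simp: coboundary_def)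
  have "inj_on (\<lambda>T. (coboundary T, ?c T)) (Pow {..<n})"
  proof (rule inj_onI)
    fix T T' assume T: "T \<in> Pow {..<n}" "T' \<in> Pow {..<n}" and eq: "(coboundary T, ?c T) = (coboundary T', ?c T')"
    define X where "X = {k. k \<in> T \<longleftrightarrow> k \<in> T'}"
    have X: "fst h \<in> X \<longleftrightarrow> fst (mate h) \<in> X" if "h \<in> half_edges D" for h
      using coboundary_mate[OF that, of T] coboundary_mate[OF that, of T'] eq by (auto simp: X_def)
    have "k \<in> X" if "k < n" for k
    proof -
      have "gen_class graph_rel k \<in> graph_components D" using that by (simp add: graph_components_eq)
      then have "representative (gen_class graph_rel k) \<in> X" using eq by (auto simp: X_def)
      then show ?thesis using representative_closed[OF X] by blast
    qed
    then show "T = T'" using T by (auto simp: X_def)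
  qed
  then have "card (Pow {..<n}) \<le> card (range coboundary \<times> Pow (graph_components D))"
    using fin fin' by (intro card_inj_on_le) auto
  then show ?thesis by (simp add: card_cartesian_product card_Pow fin)
qed

text \<open>A colouring that changes across no arc is constant around each crossing, hence on each
  connected component.\<close>

lemma card_closed_colourings:
  "card {S \<in> Pow (faces D). \<forall>e\<in>ends. 1 * (face_colour S (head e) * face_colour S (tail e)) = 1}
    \<le> 2 ^ card (graph_components D)" (is "card ?K \<le> _")
proof -
  let ?c = "\<lambda>S. {C \<in> graph_components D. face (representative C, 0) \<in> S}"
  have fin: "finite (graph_components D)" by (simp add: graph_components_eq)
  have const: "face (k, s) \<in> S \<longleftrightarrow> face (representative (gen_class graph_rel k), 0) \<in> S"
    if S: "S \<in> ?K" and k: "k < n" "s < 4" for S k s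
  proof -
    have m: "face h \<in> S \<longleftrightarrow> face (mate h) \<in> S" if h: "h \<in> half_edges D" for h
    proof -
      have e: "arc_of h \<in> ends" using h by (rule arc_of_ends)
      then have "face (head (arc_of h)) \<in> S \<longleftrightarrow> face (tail (arc_of h)) \<in> S"
        using S by (auto simp: face_colour_def split: if_splits)
      then show ?thesis using mate_pair[OF h] by (auto simp: doubleton_eq_iff)
    qed
    have turn: "face (k, (s + 3) mod 4) \<in> S \<longleftrightarrow> face (k, s) \<in> S" if "(k, s) \<in> half_edges D" for k s
      unfolding face_turn[OF that] using m[OF that] by simp
    have same: "face (k, s) \<in> S \<longleftrightarrow> face (k, 0) \<in> S" if "k < n" "s < 4" for k s
    proof -
      have "face (k, 3) \<in> S \<longleftrightarrow> face (k, 0) \<in> S" "face (k, 0) \<in> S \<longleftrightarrow> face (k, 1) \<in> S"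
        "face (k, 1) \<in> S \<longleftrightarrow> face (k, 2) \<in> S"
        using turn[of k 0] turn[of k 1] turn[of k 2] that by (simp_all add: half_edges_def)
      moreover have "s = 0 \<or> s = 1 \<or> s = 2 \<or> s = 3" using that(2) by auto
      ultimately show ?thesis by auto
    qed
    have "fst h \<in> {k. face (k, 0) \<in> S} \<longleftrightarrow> fst (mate h) \<in> {k. face (k, 0) \<in> S}" if h: "h \<in> half_edges D" for h
    proof -
      have "fst h < n" "snd h < 4" "fst (mate h) < n" "snd (mate h) < 4"
        using h mate(1)[OF h] by (simp_all add: half_edges_def mem_Times_iff)
      then show ?thesis using m[OF h] same[of "fst h" "snd h"] same[of "fst (mate h)" "snd (mate h)"] by simp
    qed
    from representative_closed[of "{k. face (k, 0) \<in> S}", OF this] same[OF k] show ?thesis by simp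
  qed
  have "inj_on ?c ?K"
  proof (rule inj_onI)
    fix S S' assume S: "S \<in> ?K" "S' \<in> ?K" and eq: "?c S = ?c S'"
    have "face h \<in> S \<longleftrightarrow> face h \<in> S'" if h: "h \<in> half_edges D" for h
    proof -
      obtain k s where ks: "h = (k, s)" "k < n" "s < 4" using h by (auto simp: half_edges_def)
      then have "gen_class graph_rel k \<in> graph_components D" by (simp add: graph_components_eq)
      then show ?thesis using const[OF S(1) ks(2,3)] const[OF S(2) ks(2,3)] eq ks(1) by auto
    qed
    moreover have "S \<subseteq> face ` half_edges D" "S' \<subseteq> face ` half_edges D" using S by (auto simp: faces_def)
    ultimately show "S = S'" by blast
  qed
  then have "card ?K \<le> card (Pow (graph_components D))" using fin by (intro card_inj_on_le) auto
  then show ?thesis by (simp add: card_Pow fin)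
qed

theorem planar_source_sink:
  assumes "planar D"
  shows "\<exists>c. source_sink D c"
proof -
  let ?C = "card (graph_components D)" and ?F = "card (faces D)"
  have F: "?F = n + 2 * ?C" using assms by (simp add: planar_def)
  have fin: "finite cocycles" using finite_ends by (rule finite_subset[rotated, OF finite_Pow_iff[THEN iffD2]]) (auto simp: cocycles_def)
  let ?K = "card {S \<in> Pow (faces D). \<forall>e\<in>ends. 1 * (face_colour S (head e) * face_colour S (tail e)) = 1}"
  have "2 ^ (2 * n) * int ?K = 2 ^ ?F * int (card cocycles)" using face_colour_sum[of 1] by simp
  then have "2 ^ ?F * card cocycles = 2 ^ (2 * n) * ?K" by (simp flip: of_nat_eq_iff[where 'a = int])
  also have "\<dots> \<le> 2 ^ (2 * n) * 2 ^ ?C" using card_closed_colourings by simp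
  also have "\<dots> \<le> 2 ^ n * (card (range coboundary) * 2 ^ ?C) * 2 ^ ?C"
    using card_coboundaries by (simp add: mult_2 power_add)
  also have "\<dots> = 2 ^ ?F * card (range coboundary)" unfolding F by (simp add: power_add mult_2)
  finally have "card cocycles \<le> card (range coboundary)" by simp
  moreover have "range coboundary \<subseteq> cocycles" using coboundary_cocycle by blast
  ultimately have "cocycles = range coboundary" using card_seteq[OF fin] by blast
  \<comment> \<open>First cohomology modulo two vanishes. All cocycles are therefore of even size,
    the signed count equals the unsigned one, and its positivity yields a checkerboard colouring
    \<open>S\<close> of the faces.\<close>
  then have "(\<Sum>U\<in>cocycles. (- 1) ^ card U) = (\<Sum>U\<in>cocycles. 1 :: int)"
    using coboundary_even by (intro sum.cong) auto
  moreover have "cocycles \<noteq> {}" using coboundary_cocycle by blast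
  ultimately have "2 ^ ?F * (\<Sum>U\<in>cocycles. (- 1) ^ card U) > (0 :: int)" using fin by (simp add: card_gt_0_iff)
  then have "card {S \<in> Pow (faces D). \<forall>e\<in>ends. - 1 * (face_colour S (head e) * face_colour S (tail e)) = 1} \<noteq> 0"
    using face_colour_sum[of "- 1"] by (metis mult_zero_right of_nat_0 less_irrefl)
  then obtain S where S: "\<forall>e\<in>ends. - 1 * (face_colour S (head e) * face_colour S (tail e)) = 1"
    by (metis (mono_tags, lifting) card.empty empty_Collect_eq)
  define P where "P h \<longleftrightarrow> face h \<in> S" for h
  have opp: "P (tail e) \<longleftrightarrow> \<not> P (head e)" if "e \<in> ends" for e
    using S that by (auto simp: P_def face_colour_def split: if_splits)
  have m: "P (mate h) \<longleftrightarrow> \<not> P h" if h: "h \<in> half_edges D" for h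
    using mate_pair[OF h] opp[OF arc_of_ends[OF h]] by (auto simp: doubleton_eq_iff)
  have turn: "P (k, (s + 3) mod 4) \<longleftrightarrow> \<not> P (k, s)" if "k < n" "s < 4" for k s
  proof -
    have h: "(k, s) \<in> half_edges D" using that by (simp add: half_edges_def)
    show ?thesis using m[OF h] unfolding P_def face_turn[OF h] .
  qed
  have T: "P (k, 3) \<longleftrightarrow> \<not> P (k, 0)" "P (k, 1) \<longleftrightarrow> \<not> P (k, 0)" "P (k, 2) \<longleftrightarrow> P (k, 0)" if "k < n" for k
    using turn[OF that, of 0] turn[OF that, of 1] turn[OF that, of 2] by auto
  \<comment> \<open>The colour of the corner at its head decides whether an arc keeps its direction.
    With this choice a half-edge points into its crossing exactly if its corner satisfies
    \<open>P\<close>, and \<open>P\<close> alternates around a crossing.\<close>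
  define c where "c e = P (head e)" for e
  have "c (oo k) = c (ui k) \<and> c (oi k) = (\<not> c (ui k)) \<and> c (uo k) = (\<not> c (ui k))" if k: "k < n" for k
  proof -
    let ?i = "(k, if pos k then 3 else 1)" and ?o = "(k, if pos k then 1 else 3)"
    have half: "(k, 0) \<in> in_half" "?i \<in> in_half" "(k, 2) \<in> out_half" "?o \<in> out_half"
      using k by (simp_all add: in_half_def out_half_def)
    have hd: "head (ui k) = (k, 0)" "head (oi k) = ?i" "tail (uo k) = (k, 2)" "tail (oo k) = ?o"
      using head_tail(5)[OF half(1)] head_tail(5)[OF half(2)] head_tail(6)[OF half(3)] head_tail(6)[OF half(4)]
      unfolding arc_of_in_half[OF half(1)] arc_of_in_half[OF half(2)]
        arc_of_out_half[OF half(3)] arc_of_out_half[OF half(4)] by (simp_all split: if_splits)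
    have "P (k, 2) \<longleftrightarrow> \<not> c (uo k)" "P ?o \<longleftrightarrow> \<not> c (oo k)" "P (k, 0) \<longleftrightarrow> c (ui k)" "P ?i \<longleftrightarrow> c (oi k)"
      using opp[OF strand_ends(3)[OF k]] opp[OF strand_ends(4)[OF k]] by (simp_all only: c_def hd)
    moreover have "P ?o \<longleftrightarrow> \<not> P (k, 0)" "P ?i \<longleftrightarrow> \<not> P (k, 0)" using T[OF k] by (simp_all split: if_splits)
    ultimately show ?thesis using T(3)[OF k] by blast
  qed
  then have "source_sink D c" unfolding source_sink_def n_crossings_def by (metis in_set_conv_nth)
  then show ?thesis by blast
qed

end

section \<open>Operators on chains\<close>

definition bar :: "'r::comm_ring_1 poly \<Rightarrow> 'r poly" where
  "bar p = pcompose p [:0, - 1:]"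

lemma coeff_bar: "coeff (bar p) m = (- 1) ^ m * coeff p m"
  by (simp add: bar_def coeff_pcompose_linear)

lemma bar_simps [simp]:
  "bar (p + q) = bar p + bar q" "bar (p - q) = bar p - bar q" "bar (p * q) = bar p * bar q"
  "bar (- p) = - bar p" "bar 0 = 0" "bar 1 = 1" "bar [:r:] = [:r:]" "bar polyH = - polyH"
  "bar (bar p) = p"
proof -
  show "bar (bar p) = p"
    by (simp add: poly_eq_iff coeff_bar mult.assoc[symmetric] power_mult_distrib[symmetric])
qed (simp_all add: bar_def pcompose_add pcompose_diff pcompose_mult pcompose_uminus pcompose_1
    polyH_def pcompose_pCons)

lemma bar_sum: "bar (sum f A) = (\<Sum>x\<in>A. bar (f x))"
  and bar_prod: "bar (prod g A) = (\<Prod>x\<in>A. bar (g x))"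
  by (simp_all add: bar_def pcompose_sum pcompose_prod)

lemma bar_split_weight: "bar (split_weight a (- P)) = split_weight a P" "bar (split_weight a P) = - split_weight a P"
  by (simp_all add: split_weight_def)

lemma polyH_poly_shift:
  assumes "coeff p 0 = 0" shows "polyH * poly_shift 1 p = p"
  using assms by (simp add: polyH_def poly_eq_iff coeff_pCons coeff_poly_shift split: nat.split)

lemma coeff_0_minus_polyH_power: "coeff ((- polyH) ^ n * p) 0 = (if n = 0 then coeff p 0 else 0)"
  by (cases n) (simp_all add: coeff_mult polyH_def)

section \<open>Operators that are scalar on states\<close>

definition scalar_chain :: "link_diagram \<Rightarrow> (nat set \<Rightarrow> 'r::comm_ring_1 poly) \<Rightarrow> 'r chain \<Rightarrow> 'r chain \<Rightarrow> bool" where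
  "scalar_chain D u f g \<longleftrightarrow> g \<in> CBN D \<and>
     (\<forall>v\<subseteq>{..<n_crossings D}. \<forall>P. compatible D v P \<longrightarrow> hat D g v P = u P * hat D f v P)"

text \<open>Not every family of scalars comes from an operator over \<open>R[H]\<close>, so a lift
  to chains is required; by \<open>hat_eqI\<close> it is unique, and \<open>multiply\<close> may
  choose it. The scalar depends on the state but not on the vertex, so that edge maps respect
  it.\<close>

definition multiplier :: "link_diagram \<Rightarrow> (nat set \<Rightarrow> 'r::comm_ring_1 poly) \<Rightarrow> bool" where
  "multiplier D u \<longleftrightarrow> (\<forall>f\<in>CBN D. \<exists>g. scalar_chain D u f g)"

definition multiply :: "link_diagram \<Rightarrow> (nat set \<Rightarrow> 'r::comm_ring_1 poly) \<Rightarrow> 'r chain \<Rightarrow> 'r chain" where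
  "multiply D u f = (SOME g. scalar_chain D u f g)"

lemma CBN_closed:
  "0 \<in> CBN D" "f \<in> CBN D \<Longrightarrow> g \<in> CBN D \<Longrightarrow> f + g \<in> CBN D" "f \<in> CBN D \<Longrightarrow> g \<in> CBN D \<Longrightarrow> f - g \<in> CBN D"
  "f \<in> CBN D \<Longrightarrow> (\<lambda>s. a * f s) \<in> CBN D"
  by (simp_all add: CBN_def)

lemma multiply:
  assumes "multiplier D u" "f \<in> CBN D"
  shows "multiply D u f \<in> CBN D"
    and "v \<subseteq> {..<n_crossings D} \<Longrightarrow> compatible D v P \<Longrightarrow> hat D (multiply D u f) v P = u P * hat D f v P"
proof -
  have "scalar_chain D u f (multiply D u f)"
    unfolding multiply_def using assms someI_ex[of "scalar_chain D u f"] unfolding multiplier_def by blast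
  then show "multiply D u f \<in> CBN D"
    and "v \<subseteq> {..<n_crossings D} \<Longrightarrow> compatible D v P \<Longrightarrow> hat D (multiply D u f) v P = u P * hat D f v P"
    by (auto simp: scalar_chain_def)
qed

lemma multiplierI:
  assumes "\<And>f. f \<in> CBN D \<Longrightarrow> F f \<in> CBN D"
    and "\<And>f v P. f \<in> CBN D \<Longrightarrow> v \<subseteq> {..<n_crossings D} \<Longrightarrow> compatible D v P \<Longrightarrow> hat D (F f) v P = u P * hat D f v P"
  shows "multiplier D u"
  unfolding multiplier_def scalar_chain_def using assms by blast

lemma multiplier_const: "multiplier D (\<lambda>_. a)"
  by (rule multiplierI[of _ "\<lambda>f s. a * f s"]) (simp_all add: CBN_closed hat_linear)

lemma multiplier_add:
  assumes "multiplier D u" "multiplier D w" shows "multiplier D (\<lambda>P. u P + w P)"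
  by (rule multiplierI[of _ "\<lambda>f. multiply D u f + multiply D w f"])
     (simp_all only: CBN_closed hat_linear multiply[OF assms(1)] multiply[OF assms(2)] distrib_right)

lemma multiplier_mult:
  assumes "multiplier D u" "multiplier D w" shows "multiplier D (\<lambda>P. u P * w P)"
  by (rule multiplierI[of _ "\<lambda>f. multiply D u (multiply D w f)"])
     (simp_all only: multiply[OF assms(1)] multiply[OF assms(2)] mult.assoc)

lemma multiplier_sum: "(\<And>i. i \<in> I \<Longrightarrow> multiplier D (u i)) \<Longrightarrow> multiplier D (\<lambda>P. \<Sum>i\<in>I. u i P)"
  by (induction I rule: infinite_finite_induct) (auto intro: multiplier_add multiplier_const)

lemma multiplier_prod: "(\<And>i. i \<in> I \<Longrightarrow> multiplier D (u i)) \<Longrightarrow> multiplier D (\<lambda>P. \<Prod>i\<in>I. u i P)"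
  by (induction I rule: infinite_finite_induct) (auto intro: multiplier_mult multiplier_const)

lemma multiplier_power: "multiplier D u \<Longrightarrow> multiplier D (\<lambda>P. u P ^ m)"
  by (induction m) (auto intro: multiplier_mult multiplier_const)

text \<open>Multiplication by the variable \<open>x\<close> of the circle through \<open>q\<close>.\<close>

definition x_op :: "link_diagram \<Rightarrow> nat \<Rightarrow> 'r::comm_ring_1 chain \<Rightarrow> 'r chain" where
  "x_op D q f = (\<lambda>(v, L). if (v, L) \<in> gens D \<and> circle D v q \<in> L
     then f (v, L - {circle D v q}) + polyH * f (v, L) else 0)"

text \<open>The \<open>R\<close>-linear automorphism with \<open>H \<mapsto> - H\<close> and \<open>x \<mapsto> x - H\<close> in every tensor factor.\<close>

definition tau :: "link_diagram \<Rightarrow> 'r::comm_ring_1 chain \<Rightarrow> 'r chain" where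
  "tau D f = (\<lambda>(v, L). if (v, L) \<in> gens D
     then \<Sum>M | M \<subseteq> circles D v \<and> L \<subseteq> M. (- polyH) ^ card (M - L) * bar (f (v, M)) else 0)"

text \<open>
  With \<open>y = H - x\<close>, the isomorphism of the reduced complexes sends \<open>f\<close> to
  \<open>H\<^sup>-\<^sup>1 (x f + \<tau> (y f))\<close>, where \<open>x\<close> and \<open>y\<close> belong to the new basepoint.
\<close>

definition move_base :: "link_diagram \<Rightarrow> nat \<Rightarrow> 'r::comm_ring_1 chain \<Rightarrow> 'r chain" where
  "move_base D q f = (\<lambda>s. poly_shift 1 ((x_op D q f + tau D ((\<lambda>s. polyH * f s) - x_op D q f)) s))"

text \<open>The sign changes when the degree changes by \<open>2\<close>, the degree of
  \<open>H\<close> up to sign; \<open>div\<close> makes this work for odd degrees as well.\<close>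

definition grading_sign :: "int \<Rightarrow> 'r::comm_ring_1" where
  "grading_sign j = (if even (j div 2) then 1 else - 1)"

text \<open>The sign of the unshifted quantum degree of each term: \<open>bar\<close> accounts for
  the powers of \<open>H\<close> in the coefficient. It anticommutes with \<open>H\<close> but
  commutes with the differential, which preserves the quantum degree.\<close>

definition sign_op :: "link_diagram \<Rightarrow> 'r::comm_ring_1 chain \<Rightarrow> 'r chain" where
  "sign_op D f = (\<lambda>s. grading_sign (q_degree D s) * bar (f s))"

text \<open>The quantum degree of the labelling by \<open>1\<close> only. As \<open>x\<close> and
  \<open>H\<close> both cost \<open>2\<close> relative to \<open>1\<close>, it is also the degree of
  a constant term in any evaluation at \<open>v\<close>.\<close>

definition vertex_degree :: "link_diagram \<Rightarrow> nat set \<Rightarrow> int" where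
  "vertex_degree D v = int (card (circles D v)) + int (card v) + int (n_pos D) - 2 * int (n_neg D)"

lemma grading_sign_add_two: "grading_sign (j + 2) = - (grading_sign j :: 'r::comm_ring_1)"
proof -
  have "(j + 2) div 2 = j div 2 + 1" by simp
  then show ?thesis by (simp add: grading_sign_def)
qed

lemma grading_sign_diff_even: "grading_sign (j - 2 * int m) = (- 1) ^ m * (grading_sign j :: 'r::comm_ring_1)"
proof (induction m)
  case (Suc m)
  have "grading_sign (j - 2 * int m) = - (grading_sign (j - 2 * int (Suc m)) :: 'r)"
    using grading_sign_add_two[of "j - 2 * int (Suc m)"] by (simp add: algebra_simps)
  then have "grading_sign (j - 2 * int (Suc m)) = - (grading_sign (j - 2 * int m) :: 'r)" by simp
  then show ?case unfolding Suc by simp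
qed simp

context sourced_diagram
begin

lemma card_circles_diff:
  assumes "L \<subseteq> circles D v"
  shows "q_degree D (v, L) = vertex_degree D v - 2 * int (card L)"
  using assms finite_subset[OF assms finite_circles] card_mono[OF finite_circles assms]
  by (simp add: q_degree_def vertex_degree_def card_Diff_subset)

lemma x_op_CBN: "x_op D q f \<in> CBN D"
  and tau_CBN: "tau D f \<in> CBN D"
  and sign_op_CBN: "f \<in> CBN D \<Longrightarrow> sign_op D f \<in> CBN D"
  by (auto simp: x_op_def tau_def sign_op_def CBN_def)

lemma move_base_CBN: "f \<in> CBN D \<Longrightarrow> move_base D q f \<in> CBN D"
  using x_op_CBN[of q f] tau_CBN[of "(\<lambda>s. polyH * f s) - x_op D q f"]
  by (simp add: move_base_def CBN_def)

lemma hat_x_op: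
  fixes f :: "'r::comm_ring_1 chain"
  assumes "q \<in> arcs D" "vertex v" "fits v P"
  shows "hat D (x_op D q f) v P = (if q \<in> P then polyH else 0) * hat D f v P"
proof -
  define C where "C = circle D v q"
  define K where "K = circles D v - {C}"
  have K: "circles D v = insert C K" "finite K" "C \<notin> K"
    using assms(1) finite_circles by (auto simp: K_def C_def circles_def)
  have *: "weight P (insert C L) = (if q \<in> P then polyH else 0) * (weight P L :: 'r poly)"
      "C \<notin> L" "insert C L - {C} = L" if "L \<in> Pow K" for L
  proof -
    show "C \<notin> L" using that K(3) by blast
    then show "insert C L - {C} = L" by blast
    have "finite L" using that K(2) finite_subset by blast
    then show "weight P (insert C L) = (if q \<in> P then polyH else 0) * (weight P L :: 'r poly)"
      using compatible_circle[OF assms(3), of q] \<open>C \<notin> L\<close> by (simp add: C_def weight_insert)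
  qed
  have 1: "weight P L * x_op D q f (v, L) = 0" if "L \<in> Pow K" for L
    using *(2)[OF that] by (simp add: x_op_def C_def)
  have 2: "weight P (insert C L) * x_op D q f (v, insert C L)
      = (if q \<in> P then polyH else 0) * (weight P L * f (v, L) + weight P (insert C L) * f (v, insert C L))"
    if "L \<in> Pow K" for L
  proof -
    have "(v, insert C L) \<in> gens D" using that K assms(2) by (auto simp: gens_def)
    then have "x_op D q f (v, insert C L) = f (v, L) + polyH * f (v, insert C L)"
      using *(3)[OF that] by (simp add: x_op_def C_def)
    then show ?thesis by (simp add: *(1)[OF that] algebra_simps)
  qed
  show ?thesis unfolding hat_def K(1)
    by (simp add: sum_Pow_insert[OF K(2,3)] 1 2 sum_distrib_left sum.distrib distrib_left)
qed

text \<open>The sum in \<open>tau\<close> is the expansion of \<open>x - H\<close> in each factor of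
  a monomial. At \<open>P\<close> such a factor is \<open>0\<close> or \<open>- H\<close>, the
  conjugate of the value of \<open>x\<close> at \<open>- P\<close>.\<close>

lemma hat_tau:
  fixes f :: "'r::comm_ring_1 chain"
  assumes "vertex v" "fits v P"
  shows "hat D (tau D f) v P = bar (hat D f v (- P))"
proof -
  let ?X = "circles D v"
  have "hat D (tau D f) v P
    = (\<Sum>L\<in>Pow ?X. \<Sum>M\<in>Pow ?X. if L \<subseteq> M then weight P L * ((- polyH) ^ card (M - L) * bar (f (v, M))) else 0)"
    unfolding hat_def
  proof (rule sum.cong[OF refl])
    fix L assume "L \<in> Pow ?X"
    then have "(v, L) \<in> gens D" using assms(1) by (simp add: gens_def)
    then have "tau D f (v, L) = (\<Sum>M\<in>{M \<in> Pow ?X. L \<subseteq> M}. (- polyH) ^ card (M - L) * bar (f (v, M)))"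
      by (simp add: tau_def)
    also have "\<dots> = (\<Sum>M\<in>Pow ?X. if L \<subseteq> M then (- polyH) ^ card (M - L) * bar (f (v, M)) else 0)"
      using finite_circles by (intro sum.inter_filter) simp
    finally show "weight P L * tau D f (v, L)
      = (\<Sum>M\<in>Pow ?X. if L \<subseteq> M then weight P L * ((- polyH) ^ card (M - L) * bar (f (v, M))) else 0)"
      by (simp add: sum_distrib_left if_distrib cong: if_cong)
  qed
  also have "\<dots> = (\<Sum>M\<in>Pow ?X. \<Sum>L\<in>Pow ?X. if L \<subseteq> M then weight P L * ((- polyH) ^ card (M - L) * bar (f (v, M))) else 0)"
    by (rule sum.swap)
  also have "\<dots> = (\<Sum>M\<in>Pow ?X. bar (weight (- P) M * f (v, M)))"
  proof (rule sum.cong[OF refl])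
    fix M assume M: "M \<in> Pow ?X"
    then have fin: "finite M" using finite_circles finite_subset by blast
    have "(\<Sum>L\<in>Pow ?X. if L \<subseteq> M then weight P L * ((- polyH) ^ card (M - L) * bar (f (v, M))) else 0)
      = (\<Sum>L\<in>{L \<in> Pow ?X. L \<subseteq> M}. weight P L * ((- polyH) ^ card (M - L) * bar (f (v, M))))"
      using finite_circles by (intro sum.inter_filter[symmetric]) simp
    also have "{L \<in> Pow ?X. L \<subseteq> M} = Pow M" using M by auto
    also have "(\<Sum>L\<in>Pow M. weight P L * ((- polyH) ^ card (M - L) * bar (f (v, M))))
      = (\<Sum>L\<in>Pow M. (\<Prod>C\<in>L. if C \<subseteq> P then polyH else 0) * (\<Prod>C\<in>M - L. - (polyH :: 'r poly))) * bar (f (v, M))"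
      by (simp add: weight_def sum_distrib_right mult.assoc)
    also have "(\<Sum>L\<in>Pow M. (\<Prod>C\<in>L. if C \<subseteq> P then polyH else 0) * (\<Prod>C\<in>M - L. - (polyH :: 'r poly)))
      = (\<Prod>C\<in>M. (if C \<subseteq> P then polyH else 0) + - polyH)"
      by (rule prod_add[OF fin, symmetric])
    also have "\<dots> = (\<Prod>C\<in>M. bar (if C \<subseteq> - P then polyH else 0))"
    proof (rule prod.cong[OF refl])
      fix C assume "C \<in> M"
      then obtain a where C: "C = circle D v a" using M by (auto simp: circles_def)
      show "(if C \<subseteq> P then polyH else 0) + - polyH = bar (if C \<subseteq> - P then polyH else (0 :: 'r poly))"
        using compatible_circle[OF assms(2), of a] compatible_circle[of D v "- P" a] assms(2)
        by (simp add: C)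
    qed
    finally show "(\<Sum>L\<in>Pow ?X. if L \<subseteq> M then weight P L * ((- polyH) ^ card (M - L) * bar (f (v, M))) else 0)
      = bar (weight (- P) M * f (v, M))" by (simp add: weight_def bar_prod)
  qed
  finally show ?thesis by (simp add: hat_def bar_sum)
qed

lemma hat_move_base:
  assumes "q \<in> arcs D" "vertex v" "fits v P"
  shows "hat D (move_base D q f) v P = (if q \<in> P then hat D f v P - bar (hat D f v (- P)) else 0)"
proof -
  define h where "h = (\<lambda>s. polyH * f s) - x_op D q f"
  have P': "fits v (- P)" using assms(3) by simp
  \<comment> \<open>Divisibility by \<open>H\<close>: modulo \<open>H\<close> only the term
    \<open>M = L\<close> of \<open>tau\<close> survives, and it cancels \<open>x f\<close>.\<close>
  have 0: "coeff ((x_op D q f + tau D h) s) 0 = 0" for s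
  proof (cases "s \<in> gens D")
    case True
    obtain v L where s: "s = (v, L)" by (cases s)
    have L: "L \<subseteq> circles D v" using True by (simp add: gens_def s)
    let ?S = "{M. M \<subseteq> circles D v \<and> L \<subseteq> M}"
    have fin: "finite ?S" using finite_circles by simp
    have "coeff (tau D h s) 0 = (\<Sum>M\<in>?S. coeff ((- polyH) ^ card (M - L) * bar (h (v, M))) 0)"
      using True by (simp add: tau_def s coeff_sum)
    also have "\<dots> = (\<Sum>M\<in>?S. if M = L then coeff (bar (h (v, M))) 0 else 0)"
    proof (rule sum.cong[OF refl])
      fix M assume M: "M \<in> ?S"
      then have "finite M" using finite_circles finite_subset by blast
      then have "card (M - L) = 0 \<longleftrightarrow> M = L" using M by auto
      then show "coeff ((- polyH) ^ card (M - L) * bar (h (v, M))) 0 = (if M = L then coeff (bar (h (v, M))) 0 else 0)"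
        by (simp add: coeff_0_minus_polyH_power)
    qed
    also have "\<dots> = coeff (bar (h s)) 0" using fin L by (simp add: s)
    also have "\<dots> = - coeff (x_op D q f s) 0" by (simp add: coeff_bar h_def polyH_def)
    finally show ?thesis by simp
  next
    case False
    then show ?thesis using x_op_CBN[of q f] tau_CBN[of h] by (cases s) (simp add: CBN_def)
  qed
  have "(\<lambda>s. polyH * move_base D q f s) = x_op D q f + tau D h"
    unfolding move_base_def h_def[symmetric] using 0 by (simp only: polyH_poly_shift)
  then have "polyH * hat D (move_base D q f) v P = hat D (x_op D q f + tau D h) v P"
    by (metis hat_linear(3))
  also have "\<dots> = polyH * (if q \<in> P then hat D f v P - bar (hat D f v (- P)) else 0)"
    unfolding h_def
    by (simp add: hat_linear(1,2,3) hat_x_op[OF assms] hat_tau[OF assms(2,3)] hat_x_op[OF assms(1,2) P'] algebra_simps)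
  finally show ?thesis unfolding polyH_cancel .
qed

text \<open>Each label \<open>x\<close> changes the grading sign, and conjugating its value
  \<open>H\<close> changes it back; one sign per vertex remains.\<close>

lemma hat_sign_op:
  fixes f :: "'r::comm_ring_1 chain"
  assumes "vertex v" "fits v P"
  shows "hat D (sign_op D f) v P = grading_sign (vertex_degree D v) * bar (hat D f v P)"
  unfolding hat_def bar_sum sum_distrib_left
proof (rule sum.cong[OF refl])
  fix L assume "L \<in> Pow (circles D v)"
  then have L: "L \<subseteq> circles D v" by simp
  have "bar (weight P L :: 'r poly) = (\<Prod>C\<in>L. - 1 * (if C \<subseteq> P then polyH else 0))"
    unfolding weight_def bar_prod by (intro prod.cong) auto
  also have "\<dots> = (- 1) ^ card L * weight P L" unfolding weight_def prod.distrib by simp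
  finally have w: "bar (weight P L) = (- 1) ^ card L * (weight P L :: 'r poly)" .
  show "weight P L * sign_op D f (v, L) = grading_sign (vertex_degree D v) * bar (weight P L * f (v, L))"
    unfolding w sign_op_def card_circles_diff[OF L] grading_sign_diff_even bar_simps(3)
    by (simp only: mult_ac)
qed

lemma multiplier_arc: "q \<in> arcs D \<Longrightarrow> multiplier D (\<lambda>P. if q \<in> P then polyH else 0)"
  unfolding multiplier_def scalar_chain_def
  using x_op_CBN hat_x_op by blast

lemma multiplier_split_weight: "q \<in> arcs D \<Longrightarrow> multiplier D (split_weight q :: _ \<Rightarrow> 'r::comm_ring_1 poly)"
proof -
  assume "q \<in> arcs D"
  then have "multiplier D (\<lambda>P. (if q \<in> P then polyH else 0) + ((if q \<in> P then polyH else 0) + - (polyH :: 'r poly)))"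
    by (intro multiplier_add multiplier_arc multiplier_const)
  also have "(\<lambda>P. (if q \<in> P then polyH else 0) + ((if q \<in> P then polyH else 0) + - polyH)) = (split_weight q :: _ \<Rightarrow> 'r poly)"
    by (rule ext) (simp add: split_weight_def)
  finally show ?thesis .
qed

section \<open>Reduced and homogeneous chains in terms of states\<close>

lemma reduced_iff_hat:
  fixes f :: "'r::comm_ring_1 chain"
  assumes "p \<in> arcs D"
  shows "f \<in> reduced p \<longleftrightarrow> f \<in> CBN D \<and>
    (\<forall>v\<subseteq>{..<n}. \<forall>P. fits v P \<longrightarrow> p \<notin> P \<longrightarrow> hat D f v P = 0)"
proof (intro iffI conjI allI impI)
  fix v P assume f: "f \<in> reduced p" and P: "fits v P" "p \<notin> P"
  have "weight P L * f (v, L) = 0" if L: "L \<in> Pow (circles D v)" for L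
  proof (cases "circle D v p \<in> L")
    case True
    have "\<not> circle D v p \<subseteq> P" using compatible_circle[OF P(1)] P(2) by blast
    with True have "weight P L = (0 :: 'r poly)" unfolding weight_def
      using finite_subset[OF _ finite_circles] L by (intro prod_zero) auto
    then show ?thesis by simp
  next
    case False
    then have "f (v, L) = 0" using f unfolding reduced_CBN_def by blast
    then show ?thesis by simp
  qed
  then show "hat D f v P = 0" unfolding hat_def by (intro sum.neutral ballI)
next
  show "f \<in> reduced p \<Longrightarrow> f \<in> CBN D" by (simp add: reduced_CBN_def)
next
  assume f: "f \<in> CBN D \<and> (\<forall>v\<subseteq>{..<n}. \<forall>P. fits v P \<longrightarrow> p \<notin> P \<longrightarrow> hat D f v P = 0)"
  have "f (v, L) = 0" if "circle D v p \<notin> L" for v L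
  proof (cases "(v, L) \<in> gens D")
    case True
    then have v: "vertex v" and L: "L \<subseteq> circles D v" by (simp_all add: gens_def)
    \<comment> \<open>Moebius inversion for \<open>L\<close> only uses states inside
      \<open>\<Union>L\<close>, and these avoid \<open>p\<close> unless the circle of
      \<open>p\<close> belongs to \<open>L\<close>.\<close>
    have "p \<notin> \<Union>L" using that circles_disjoint L by blast
    then have 0: "hat D f v P = 0" if "fits v P" "P \<subseteq> \<Union>L" for P
      using f v that by blast
    have "polyH ^ card L * f (v, L) = 0"
      by (rule hat_induct[where Q = "\<lambda>p. p = 0" and f = f, OF finite_arcs L]) (simp_all add: 0)
    then show ?thesis using polyH_power_cancel[of "card L" "f (v, L)" 0] by simp
  next
    case False
    then show ?thesis using f by (simp add: CBN_def)
  qed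
  then show "f \<in> reduced p" using f unfolding reduced_CBN_def by blast
qed

text \<open>A label \<open>x\<close> and a factor \<open>H\<close> both lower the quantum degree by
  \<open>2\<close>, so evaluation and its inversion preserve degrees.\<close>

lemma homogeneous_iff_hat:
  fixes f :: "'r::comm_ring_1 chain"
  assumes f: "f \<in> CBN D"
  shows "reduced_homogeneous D i j f \<longleftrightarrow>
    (\<forall>v\<subseteq>{..<n}. \<forall>P. fits v P \<longrightarrow> (\<forall>m. coeff (hat D f v P) m \<noteq> 0 \<longrightarrow>
       int (card v) - int (n_neg D) = i \<and> vertex_degree D v - 2 * int m + 1 = j))"
    (is "_ \<longleftrightarrow> (\<forall>v\<subseteq>_. \<forall>P. _ \<longrightarrow> ?Q v (hat D f v P))")
proof (intro iffI allI impI)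
  fix v P m assume hom: "reduced_homogeneous D i j f" and m: "coeff (hat D f v P) m \<noteq> 0"
  have "(\<Sum>L\<in>Pow (circles D v). coeff (weight P L * f (v, L)) m) \<noteq> 0"
    using m by (simp add: hat_def coeff_sum)
  then obtain L where L: "L \<in> Pow (circles D v)" "coeff (weight P L * f (v, L)) m \<noteq> 0"
    by (meson sum.neutral)
  have "weight P L = (polyH ^ card L :: 'r poly) \<or> weight P L = (0 :: 'r poly)"
  proof (cases "\<forall>C\<in>L. C \<subseteq> P")
    case True
    then have "weight P L = (\<Prod>C\<in>L. polyH :: 'r poly)" unfolding weight_def by (intro prod.cong) auto
    then show ?thesis by simp
  next
    case False
    then have "weight P L = (0 :: 'r poly)" unfolding weight_def
      using finite_subset[OF _ finite_circles] L(1) by (intro prod_zero) auto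
    then show ?thesis by simp
  qed
  with L(2) have "coeff (monom 1 (card L) * f (v, L)) m \<noteq> 0" by (auto simp: polyH_power_eq_monom)
  then have "card L \<le> m" "coeff (f (v, L)) (m - card L) \<noteq> 0"
    by (auto simp: coeff_monom_mult split: if_splits)
  moreover from this hom have "h_degree D (v, L) = i \<and> q_degree D (v, L) - 2 * int (m - card L) + 1 = j"
    unfolding reduced_homogeneous_def by blast
  ultimately show "int (card v) - int (n_neg D) = i \<and> vertex_degree D v - 2 * int m + 1 = j"
    using card_circles_diff[of L v] L(1) by (simp add: h_degree_def of_nat_diff)
next
  assume Q: "\<forall>v\<subseteq>{..<n}. \<forall>P. fits v P \<longrightarrow> ?Q v (hat D f v P)"
  show "reduced_homogeneous D i j f" unfolding reduced_homogeneous_def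
  proof (intro allI impI)
    fix s m assume m: "coeff (f s) m \<noteq> 0"
    then have "s \<in> gens D" using f unfolding CBN_def by fastforce
    obtain v L where s: "s = (v, L)" by (cases s)
    have v: "vertex v" and L: "L \<subseteq> circles D v" using \<open>s \<in> gens D\<close> by (simp_all add: gens_def s)
    have "?Q v (polyH ^ card L * f (v, L))"
    proof (rule hat_induct[where Q = "?Q v" and f = f, OF finite_arcs L])
      fix p q :: "'r poly" assume "?Q v p" "?Q v q"
      then show "?Q v (p - q)" by (metis coeff_diff diff_self)
    qed (use Q v in blast)
    moreover have "coeff (polyH ^ card L * f (v, L)) (m + card L) \<noteq> 0"
      using m by (simp add: polyH_power_eq_monom coeff_monom_mult s)
    ultimately have "int (card v) - int (n_neg D) = i \<and> vertex_degree D v - 2 * int (m + card L) + 1 = j"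
      by blast
    then show "h_degree D s = i \<and> q_degree D s - 2 * int m + 1 = j"
      by (simp add: s h_degree_def card_circles_diff[OF L])
  qed
qed

end

section \<open>The differential\<close>

lemma edge_coeff_eq:
  "edge_coeff D v k L T = surgery_coeff (circles D v) (circle D v (slot D k 0)) (circle D v (slot D k 2))
    (circle D (insert k v) (slot D k 0)) (circle D (insert k v) (slot D k 2)) L T"
  by (simp add: edge_coeff_def surgery_coeff_def Let_def)

context sourced_diagram
begin

lemma card_circles_adjacent:
  assumes "adjacent D k v w"
  shows "circ v k \<noteq> circ' v k \<Longrightarrow> card (circles D v) = card (circles D w) + 1"
    and "circ v k = circ' v k \<Longrightarrow> card (circles D w) = card (circles D v) + 1"
proof -
  have *: "card (circles D x) = card (circles D y) + 1"
    if xy: "adjacent D k x y" "circ x k \<noteq> circ' x k" for x y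
  proof -
    obtain K where K: "finite K" "circ x k \<notin> K" "circ' x k \<notin> K"
      "circ x k \<union> circ' x k \<notin> K"
      "circles D x = insert (circ x k) (insert (circ' x k) K)"
      "circles D y = insert (circ x k \<union> circ' x k) K"
      by (rule circle_merge[OF xy])
    then show ?thesis using xy(2) by simp
  qed
  show "circ v k \<noteq> circ' v k \<Longrightarrow> card (circles D v) = card (circles D w) + 1"
    using *[OF assms] .
  assume "circ v k = circ' v k"
  then have "circ w k \<noteq> circ' w k" using circle_bifurcation[OF assms] by blast
  with * assms show "card (circles D w) = card (circles D v) + 1" using adjacent_sym by blast
qed

lemma edge_weight_cases:
  assumes "adjacent D k v w"
  shows "card (circles D v) = card (circles D w) + 1 \<and> edge_weight v k P = (1 :: 'r::comm_ring_1 poly) \<or>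
    card (circles D w) = card (circles D v) + 1 \<and>
      edge_weight v k P = (split_weight (arc k 0) P :: 'r poly)"
  using card_circles_adjacent[OF assms] by (auto simp: edge_weight_def)

text \<open>Reading the type of an edge off the numbers of circles makes the two paths around a
  square comparable.\<close>

lemma edge_weight_alt:
  assumes "adjacent D k v w"
  shows "edge_weight v k P = (if card (circles D v) < card (circles D w)
      then split_weight (arc k 0) P else (1 :: 'r::comm_ring_1 poly))"
    and "card (circles D w) = card (circles D v) + 1 \<or> card (circles D v) = card (circles D w) + 1"
  using edge_weight_cases[OF assms, where 'r = 'r, of P] by auto

lemma compatible_slots:
  assumes "adjacent D k v w" "fits v P" "fits w P" "s < 4"
  shows "arc k s \<in> P \<longleftrightarrow> arc k 0 \<in> P"
proof -
  have k: "k < n" and kv: "k \<in> v \<longleftrightarrow> k \<notin> w" using assms(1) by (auto simp: adjacent_def)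
  note * = assms(2,3)[unfolded compatible_iff, THEN spec, THEN mp, OF k]
  have "arc k 1 \<in> P \<longleftrightarrow> arc k 0 \<in> P" "arc k 2 \<in> P \<longleftrightarrow> arc k 0 \<in> P" "arc k 3 \<in> P \<longleftrightarrow> arc k 0 \<in> P"
    using * kv by (cases "k \<in> v"; simp)+
  moreover have "s = 0 \<or> s = 1 \<or> s = 2 \<or> s = 3" using assms(4) by auto
  ultimately show ?thesis by auto
qed

text \<open>All four arcs at \<open>j\<close> lie on the same side of \<open>P\<close>, so a circle
  on the other side does not reach this crossing.\<close>

lemma circle_separated:
  assumes adj: "adjacent D j v w" and P: "fits v P" "fits w P"
    and a: "a \<in> P \<longleftrightarrow> arc j 0 \<notin> P"
  shows "circle D w a = circle D v a"
  unfolding circle_def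
proof (rule gen_class_local)
  fix x y assume xy: "x \<in> gen_class (smoothing_rel D v) a \<or> y \<in> gen_class (smoothing_rel D v) a"
  show "(x, y) \<in> smoothing_rel D v \<longleftrightarrow> (x, y) \<in> smoothing_rel D w"
  proof (cases "x \<in> arc j ` {..<4}")
    case False
    then show ?thesis using smoothing_adjacent[OF adj] by blast
  next
    case True
    then obtain s where "s < 4" "x = arc j s" by auto
    then have x: "x \<in> P \<longleftrightarrow> a \<notin> P" using compatible_slots[OF adj P] a by blast
    have "x \<notin> circle D v a" using compatible_eq_mem[OF P(1)] x by blast
    with xy have "y \<in> circle D v a" by (simp add: circle_def)
    then have "y \<in> P \<longleftrightarrow> a \<in> P" using compatible_eq_mem[OF P(1)] by blast
    with x P show ?thesis unfolding compatible_def by blast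
  qed
qed

text \<open>Backward edges are allowed, so this covers associativity, coassociativity and the
  Frobenius relation at once. If both crossings lie on the same side of \<open>P\<close>, only the
  number of splits matters, and the circle counts at \<open>x\<close> and \<open>t\<close> determine
  it. Otherwise neither crossing affects the circles at the other.\<close>

lemma edge_weight_square:
  assumes kj: "k \<noteq> j"
    and x: "adjacent D k x y" "adjacent D j x z" "adjacent D j y t" "adjacent D k z t"
    and P: "fits x P" "fits y P" "fits z P" "fits t P"
  shows "edge_weight x k P * edge_weight y j P = edge_weight x j P * (edge_weight z k P :: 'r::comm_ring_1 poly)"
proof (cases "arc k 0 \<in> P \<longleftrightarrow> arc j 0 \<in> P")
  case True
  then have eq: "split_weight (arc k 0) P = (split_weight (arc j 0) P :: 'r poly)" by (simp add: split_weight_def)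
  let ?N = "\<lambda>v. card (circles D v)"
  have "?N x < ?N y \<and> ?N y < ?N t \<longleftrightarrow> ?N x < ?N z \<and> ?N z < ?N t"
    "?N x < ?N y \<or> ?N y < ?N t \<longleftrightarrow> ?N x < ?N z \<or> ?N z < ?N t"
    using x[THEN edge_weight_alt(2)] by linarith+
  then show ?thesis unfolding x[THEN edge_weight_alt(1)] eq
    by (cases "?N x < ?N y"; cases "?N y < ?N t"; cases "?N x < ?N z"; cases "?N z < ?N t") simp_all
next
  case False
  have k2: "arc k 2 \<in> P \<longleftrightarrow> arc k 0 \<in> P" and j2: "arc j 2 \<in> P \<longleftrightarrow> arc j 0 \<in> P"
    using compatible_slots[OF x(1) P(1,2), of 2] compatible_slots[OF x(2) P(1,3), of 2] by auto
  have "circ z k = circ x k" "circ' z k = circ' x k"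
    using circle_separated[OF x(2) P(1,3)] False k2 by blast+
  moreover have "circle D y (arc j 0) = circle D x (arc j 0)" "circle D y (arc j 2) = circle D x (arc j 2)"
    using circle_separated[OF x(1) P(1,2)] False j2 by blast+
  ultimately show ?thesis by (simp add: edge_weight_def)
qed

text \<open>One direction is a merge, of weight \<open>1\<close>, and the other one is a
  split.\<close>

lemma edge_weight_back:
  assumes "adjacent D k v w"
  shows "edge_weight v k P * edge_weight w k P = split_weight (arc k 0) P"
  using circle_bifurcation[OF assms] by (auto simp: edge_weight_def)

text \<open>Complementing the state changes the sign of the split factor, and conjugation restores
  it.\<close>

lemma bar_edge_weight: "bar (edge_weight v k (- P)) = (edge_weight v k P :: 'r::comm_ring_1 poly)"
  by (simp add: edge_weight_def bar_split_weight(1))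

text \<open>A merge preserves \<open>vertex_degree\<close> and a split raises it by
  \<open>2\<close>; this sign compensates that of the conjugated split factor.\<close>

lemma bar_edge_weight_degree:
  assumes "adjacent D k v w" "k \<notin> v"
  shows "grading_sign (vertex_degree D w) * bar (edge_weight v k P)
    = grading_sign (vertex_degree D v) * (edge_weight v k P :: 'r::comm_ring_1 poly)"
proof -
  have "card w = card v + 1" using assms finite_subset[of v "{..<n}"] by (auto simp: adjacent_def)
  then have "card (circles D v) = card (circles D w) + 1 \<Longrightarrow> vertex_degree D w = vertex_degree D v"
    "card (circles D w) = card (circles D v) + 1 \<Longrightarrow> vertex_degree D w = vertex_degree D v + 2"
    by (simp_all add: vertex_degree_def)
  with edge_weight_cases[OF assms(1), where 'r = 'r, of P] show ?thesis
    by (elim disjE conjE) (simp_all add: bar_split_weight(2) grading_sign_add_two)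
qed

end

locale signed_diagram = sourced_diagram +
  fixes neg :: "(nat set \<times> nat) set"
  assumes signs: "sign_assignment D neg"
begin

abbreviation "\<delta> \<equiv> differential D neg"
abbreviation "boundaries \<equiv> reduced_boundaries D neg"
abbreviation "cycles \<equiv> reduced_cycles D neg"
abbreviation "hclass \<equiv> homology_class D neg"

definition edge_sign :: "nat set \<Rightarrow> nat \<Rightarrow> 'r::comm_ring_1" where
  "edge_sign v k = (if (v, k) \<in> neg then - 1 else 1)"

abbreviation "edge_term v k P x \<equiv> edge_sign (v - {k}) k *
  (if fits (v - {k}) P then edge_weight (v - {k}) k P * x else 0)"

lemma edge_sign_square: "edge_sign v k * (edge_sign v k * p) = (p :: 'r::comm_ring_1)"
  by (simp add: edge_sign_def)

text \<open>The two products belong to the two paths, each with one forward and one backward step,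
  that join the middle vertices of the square.\<close>

lemma edge_sign_anticommute:
  assumes "vertex v" "k < n" "j < n" "k \<notin> v" "j \<notin> v" "k \<noteq> j"
  shows "edge_sign v k * edge_sign v j = - (edge_sign (insert k v) j * edge_sign (insert j v) k :: 'r::comm_ring_1)"
proof -
  have "odd (card ({(v, k), (insert k v, j), (v, j), (insert j v, k)} \<inter> neg))"
    using signs assms unfolding sign_assignment_def by blast
  moreover have "v \<noteq> insert k v" "v \<noteq> insert j v" "insert k v \<noteq> insert j v" using assms by auto
  ultimately show ?thesis using assms(6)
    by (cases "(v, k) \<in> neg"; cases "(insert k v, j) \<in> neg"; cases "(v, j) \<in> neg"; cases "(insert j v, k) \<in> neg")
       (simp_all add: edge_sign_def Int_insert_left card_insert_if)
qed

lemma adjacent_remove: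
  assumes "vertex w" "k \<in> w" shows "adjacent D k (w - {k}) w"
  using assms by (auto simp: adjacent_def)

lemma adjacent_insert:
  assumes "vertex v" "k < n" "k \<notin> v" shows "adjacent D k v (insert k v)"
  using assms by (auto simp: adjacent_def)

lemma differential_CBN: "\<delta> f \<in> CBN D"
  by (auto simp: CBN_def differential_def)

lemma hat_differential:
  assumes w: "vertex w" and P: "fits w P"
  shows "hat D (\<delta> f) w P = (\<Sum>k\<in>w. edge_term w k P (hat D f (w - {k}) P))"
proof -
  have "hat D (\<delta> f) w P = (\<Sum>T\<in>Pow (circles D w). \<Sum>k\<in>w. edge_sign (w - {k}) k *
      (weight P T * (\<Sum>L\<in>Pow (circles D (w - {k})). edge_coeff D (w - {k}) k L T * f (w - {k}, L))))"
    unfolding hat_def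
  proof (rule sum.cong[OF refl])
    fix T assume "T \<in> Pow (circles D w)"
    then have "(w, T) \<in> gens D" using w by (simp add: gens_def)
    then have "\<delta> f (w, T) = (\<Sum>k\<in>w. edge_sign (w - {k}) k *
      (\<Sum>L\<in>Pow (circles D (w - {k})). edge_coeff D (w - {k}) k L T * f (w - {k}, L)))"
      by (simp add: differential_def edge_sign_def)
    then show "weight P T * \<delta> f (w, T) = (\<Sum>k\<in>w. edge_sign (w - {k}) k *
      (weight P T * (\<Sum>L\<in>Pow (circles D (w - {k})). edge_coeff D (w - {k}) k L T * f (w - {k}, L))))"
      by (simp only: sum_distrib_left[of "weight P T" _ w] mult.left_commute[of "weight P T"])
  qed
  also have "\<dots> = (\<Sum>k\<in>w. edge_sign (w - {k}) k * (\<Sum>T\<in>Pow (circles D w).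
      weight P T * (\<Sum>L\<in>Pow (circles D (w - {k})). edge_coeff D (w - {k}) k L T * f (w - {k}, L))))"
    by (subst sum.swap) (simp only: sum_distrib_left)
  also have "\<dots> = (\<Sum>k\<in>w. edge_term w k P (hat D f (w - {k}) P))"
  proof (rule sum.cong[OF refl])
    fix k assume k: "k \<in> w"
    then have ins: "insert k (w - {k}) = w" by blast
    show "edge_sign (w - {k}) k * (\<Sum>T\<in>Pow (circles D w).
        weight P T * (\<Sum>L\<in>Pow (circles D (w - {k})). edge_coeff D (w - {k}) k L T * f (w - {k}, L)))
      = edge_term w k P (hat D f (w - {k}) P)"
      unfolding edge_coeff_eq ins hat_def
      by (simp only: surgery_hat[OF adjacent_remove[OF w k] P, of "\<lambda>L. f (w - {k}, L)"])
  qed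
  finally show ?thesis .
qed

text \<open>The edge maps of the crossing \<open>k\<close>, traversed backwards.\<close>

definition backward :: "nat \<Rightarrow> 'r::comm_ring_1 chain \<Rightarrow> 'r chain" where
  "backward k f = (\<lambda>(v, T). if (v, T) \<in> gens D \<and> k \<notin> v
     then edge_sign v k * (\<Sum>L\<in>Pow (circles D (insert k v)).
       surgery (insert k v) v k L T * f (insert k v, L))
     else 0)"

lemma backward_CBN: "backward k f \<in> CBN D"
  by (auto simp: backward_def CBN_def)

lemma hat_backward:
  assumes k: "k < n" and v: "vertex v" and P: "fits v P"
  shows "hat D (backward k f) v P = (if k \<in> v then 0 else edge_sign v k *
    (if fits (insert k v) P then edge_weight (insert k v) k P * hat D f (insert k v) P else 0))"
proof (cases "k \<in> v")
  case True
  then show ?thesis by (simp add: hat_def backward_def)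
next
  case False
  have "(v, T) \<in> gens D" if "T \<in> Pow (circles D v)" for T using that v by (simp add: gens_def)
  then have "hat D (backward k f) v P = edge_sign v k * (\<Sum>T\<in>Pow (circles D v). weight P T *
      (\<Sum>L\<in>Pow (circles D (insert k v)).
       surgery (insert k v) v k L T * f (insert k v, L)))"
    using False by (simp add: hat_def backward_def sum_distrib_left[of "edge_sign v k"] mult.left_commute)
  also have "\<dots> = edge_sign v k *
    (if fits (insert k v) P then edge_weight (insert k v) k P * hat D f (insert k v) P else 0)"
    using surgery_hat[OF adjacent_insert[OF v k False, unfolded adjacent_sym[of D k v]] P, of "\<lambda>L. f (insert k v, L)"]
    by (simp add: hat_def)
  finally show ?thesis using False by simp
qed

text \<open>The terms with two different crossings cancel around mixed squares, which leaves the
  edge \<open>k\<close> traversed forth and back. The resulting scalar is the value of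
  \<open>x + x' - H\<close> for the circles at slots \<open>0\<close> and \<open>2\<close>.\<close>

lemma hat_homotopy:
  fixes f :: "'r::comm_ring_1 chain"
  assumes k: "k < n" and v: "vertex v" and P: "fits v P"
  shows "hat D (\<delta> (backward k f) + backward k (\<delta> f)) v P
    = (if arc k 0 \<in> P \<longleftrightarrow> arc k 2 \<in> P then split_weight (arc k 0) P else 0) * hat D f v P"
proof (cases "k \<in> v")
  case True
  let ?u = "v - {k}"
  have u: "?u \<subseteq> {..<n}" "insert k ?u = v" "k \<notin> ?u" using v True by auto
  note adj = adjacent_remove[OF v True]
  \<comment> \<open>\<open>backward k\<close> vanishes at vertices containing \<open>k\<close>, so
    of all edges into \<open>v\<close> only the edge \<open>k\<close> contributes.\<close>
  have other: "hat D (backward k f) (v - {j}) P = 0" if "j \<in> v" "j \<noteq> k" "fits (v - {j}) P" for j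
  proof -
    have "k \<in> v - {j}" "v - {j} \<subseteq> {..<n}" using that True v by auto
    with hat_backward[OF k, of "v - {j}" P f] that(3) show ?thesis by simp
  qed
  have "edge_term v j P (hat D (backward k f) (v - {j}) P) = 0" if "j \<in> v - {k}" for j
    using other[of j] that by auto
  then have "hat D (\<delta> (backward k f)) v P = edge_sign ?u k *
      (if fits ?u P then edge_weight ?u k P * hat D (backward k f) ?u P else 0)"
    unfolding hat_differential[OF v P] using True finite_subset[OF v]
    by (simp add: sum.remove[of v k])
  also have "\<dots> = (if fits ?u P then split_weight (arc k 0) P * hat D f v P else 0)"
  proof (cases "fits ?u P")
    case True
    have "hat D (backward k f) ?u P = edge_sign ?u k * (edge_weight v k P * hat D f v P)"
      using hat_backward[OF k u(1) True] u P by simp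
    then have "edge_sign ?u k * (edge_weight ?u k P * hat D (backward k f) ?u P)
      = edge_sign ?u k * (edge_sign ?u k * ((edge_weight ?u k P * edge_weight v k P) * hat D f v P))"
      by (simp only: mult_ac)
    then show ?thesis using True by (simp only: edge_sign_square edge_weight_back[OF adj] if_True)
  qed simp
  finally show ?thesis
    using hat_backward[OF k v P, of "\<delta> f"] True compatible_adjacent[OF adj P]
    by (simp add: hat_linear)
next
  case False
  let ?w = "insert k v"
  have w: "?w \<subseteq> {..<n}" using v k by auto
  note adj = adjacent_insert[OF v k False] 
  note adj' = adj[unfolded adjacent_sym[of D k v]]
  define F where "F j = edge_sign (v - {j}) j * (if fits (v - {j}) P then
    edge_weight (v - {j}) j P * hat D (backward k f) (v - {j}) P else 0)" for j
  define G where "G j = edge_sign v k * (if fits ?w P then edge_weight ?w k P * (edge_sign (?w - {j}) j *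
    (if fits (?w - {j}) P then edge_weight (?w - {j}) j P * hat D f (?w - {j}) P else 0)) else 0)" for j
  have 1: "hat D (\<delta> (backward k f)) v P = (\<Sum>j\<in>v. F j)"
    unfolding hat_differential[OF v P] F_def ..
  have wk: "?w - {k} = v" using False by auto
  have "hat D (backward k (\<delta> f)) v P = edge_sign v k *
      (if fits ?w P then edge_weight ?w k P * hat D (\<delta> f) ?w P else 0)"
    using hat_backward[OF k v P, of "\<delta> f"] False by simp
  also have "\<dots> = (\<Sum>j\<in>?w. G j)"
    unfolding G_def by (simp add: hat_differential[OF w] sum_distrib_left)
  also have "\<dots> = G k + (\<Sum>j\<in>v. G j)" using finite_subset[OF v] False by simp
  finally have 2: "hat D (backward k (\<delta> f)) v P = G k + (\<Sum>j\<in>v. G j)" .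
  \<comment> \<open>The two paths around the square of \<open>j\<close> and \<open>k\<close> from
    \<open>insert k ?u\<close> to \<open>v\<close>: their weights agree and their signs are
    opposite.\<close>
  have 3: "F j + G j = 0" if j: "j \<in> v" for j
  proof -
    let ?u = "v - {j}"
    have jk: "j \<noteq> k" "j < n" using j False v by auto
    have u: "?u \<subseteq> {..<n}" "k \<notin> ?u" "j \<notin> ?u" "insert j ?u = v" "?w - {j} = insert k ?u"
      "insert j (insert k ?u) = ?w" "insert k ?u \<subseteq> {..<n}" "j \<notin> insert k ?u"
      using j False v k jk by auto
    have a: "adjacent D k ?u (insert k ?u)" "adjacent D j ?u v" "adjacent D j (insert k ?u) ?w"
      by (fact adjacent_insert[OF u(1) k u(2)] adjacent_insert[OF u(1) jk(2) u(3), unfolded u(4)]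
        adjacent_insert[OF u(7) jk(2) u(8), unfolded u(6)])+
    have hb: "hat D (backward k f) ?u P = edge_sign ?u k *
        (if fits (insert k ?u) P then edge_weight (insert k ?u) k P * hat D f (insert k ?u) P else 0)"
      if "fits ?u P"
      unfolding hat_backward[OF k u(1) that] if_not_P[OF u(2)] ..
    have Fj: "F j = (if fits ?u P \<and> fits (insert k ?u) P then
        edge_sign ?u j * (edge_weight ?u j P * (edge_sign ?u k * (edge_weight (insert k ?u) k P * hat D f (insert k ?u) P))) else 0)"
      by (cases "fits ?u P"; cases "fits (insert k ?u) P")
         (simp_all only: F_def hb if_True if_False simp_thms mult_zero_right)
    have Gj: "G j = (if fits ?w P \<and> fits (insert k ?u) P then
        edge_sign v k * (edge_weight ?w k P * (edge_sign (insert k ?u) j * (edge_weight (insert k ?u) j P * hat D f (insert k ?u) P))) else 0)"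
      by (cases "fits ?w P"; cases "fits (insert k ?u) P")
         (simp_all only: G_def u(5) if_True if_False simp_thms mult_zero_right)
    \<comment> \<open>Among states fitting \<open>v\<close> and the starting vertex
      \<open>insert k ?u\<close>, those fitting \<open>?u\<close> are those fitting
      \<open>?w\<close>, so both paths are blocked by the same states.\<close>
    have comp: "fits ?u P \<and> fits (insert k ?u) P \<longleftrightarrow> fits ?w P \<and> fits (insert k ?u) P"
    proof (intro iffI conjI)
      assume Pu: "fits ?u P \<and> fits (insert k ?u) P"
      then have "arc k 0 \<in> P \<longleftrightarrow> arc k 2 \<in> P" using compatible_adjacent[OF a(1), of P] by blast
      then show "fits ?w P" using compatible_adjacent[OF adj' P] by blast
    next
      assume Pw: "fits ?w P \<and> fits (insert k ?u) P"
      then have "arc j 0 \<in> P \<longleftrightarrow> arc j 2 \<in> P"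
        using compatible_adjacent[OF a(3), of P] by blast
      then show "fits ?u P" using compatible_adjacent[OF a(2) P] by blast
    qed (simp_all only: simp_thms)
    show ?thesis
    proof (cases "fits ?u P \<and> fits (insert k ?u) P")
      case True
      with comp have Pw: "fits ?w P" by blast
      have "edge_weight (insert k ?u) k P * edge_weight ?u j P = edge_weight (insert k ?u) j P * (edge_weight ?w k P :: 'r poly)"
        by (rule edge_weight_square[OF jk(1)[symmetric] a(1)[unfolded adjacent_sym[of D k "?u"]] a(3) a(2) adj'])
           (use True Pw P in auto)
      note weights = this
      have signs: "edge_sign ?u j * edge_sign ?u k = - (edge_sign v k * edge_sign (insert k ?u) j :: 'r poly)"
        using edge_sign_anticommute[OF u(1) jk(2) k u(3,2) jk(1)] u(4) by simp
      have "F j = (edge_sign ?u j * edge_sign ?u k) * ((edge_weight (insert k ?u) k P * edge_weight ?u j P) * hat D f (insert k ?u) P)"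
        unfolding Fj if_P[OF True] by (simp only: mult_ac)
      also have "\<dots> = - ((edge_sign v k * edge_sign (insert k ?u) j) *
          ((edge_weight (insert k ?u) j P * edge_weight ?w k P) * hat D f (insert k ?u) P))"
        unfolding signs weights by (simp only: mult_minus_left)
      also have "\<dots> = - G j" unfolding Gj if_P[OF True[unfolded comp]] by (simp only: mult_ac)
      finally show ?thesis by simp
    next
      case False
      with comp show ?thesis unfolding Fj Gj by auto
    qed
  qed
  have 4: "G k = (if arc k 0 \<in> P \<longleftrightarrow> arc k 2 \<in> P then split_weight (arc k 0) P else 0) * hat D f v P"
  proof -
    have "edge_sign v k * (edge_weight ?w k P * (edge_sign v k * (edge_weight v k P * hat D f v P)))
      = edge_sign v k * (edge_sign v k * ((edge_weight v k P * edge_weight ?w k P) * hat D f v P))"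
      by (simp only: mult_ac)
    then show ?thesis unfolding G_def wk compatible_adjacent[OF adj' P]
      using P by (simp only: edge_sign_square edge_weight_back[OF adj]) simp
  qed
  have "(\<Sum>j\<in>v. F j) + (\<Sum>j\<in>v. G j) = 0" using 3 by (simp flip: sum.distrib)
  then show ?thesis unfolding hat_linear 1 2 4 by (simp add: algebra_simps)
qed

end

section \<open>Isomorphisms of the reduced complexes\<close>

lemma reduced_CBN_iff:
  "f \<in> reduced_CBN D p \<longleftrightarrow> f \<in> CBN D \<and> (\<forall>v L. circle D v p \<notin> L \<longrightarrow> f (v, L) = 0)"
  unfolding reduced_CBN_def by blast

lemma reduced_CBN_closed:
  "0 \<in> reduced_CBN D p" "f \<in> reduced_CBN D p \<Longrightarrow> g \<in> reduced_CBN D p \<Longrightarrow> f + g \<in> reduced_CBN D p"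
  "f \<in> reduced_CBN D p \<Longrightarrow> g \<in> reduced_CBN D p \<Longrightarrow> f - g \<in> reduced_CBN D p"
  "f \<in> reduced_CBN D p \<Longrightarrow> (\<lambda>s. a * f s) \<in> reduced_CBN D p"
  by (simp_all add: reduced_CBN_iff CBN_closed)

lemma reduced_CBN_CBN: "f \<in> reduced_CBN D p \<Longrightarrow> f \<in> CBN D"
  by (simp add: reduced_CBN_def)

text \<open>Linear over \<open>R\<close> and not over \<open>R[H]\<close>, because moving the
  basepoint or applying \<open>sign_op\<close> conjugates coefficients.\<close>

definition reduced_iso ::
    "link_diagram \<Rightarrow> (nat set \<times> nat) set \<Rightarrow> nat \<Rightarrow> nat \<Rightarrow> ('r::comm_ring_1 chain \<Rightarrow> 'r chain) \<Rightarrow> bool" where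
  "reduced_iso D neg p q \<Phi> \<longleftrightarrow>
     bij_betw \<Phi> (reduced_CBN D p) (reduced_CBN D q) \<and>
     (\<forall>f\<in>reduced_CBN D p. \<forall>g\<in>reduced_CBN D p. \<Phi> (f + g) = \<Phi> f + \<Phi> g) \<and>
     (\<forall>r. \<forall>f\<in>reduced_CBN D p. \<Phi> (\<lambda>s. [:r:] * f s) = (\<lambda>s. [:r:] * \<Phi> f s)) \<and>
     (\<forall>f\<in>reduced_CBN D p. differential D neg (\<Phi> f) = \<Phi> (differential D neg f)) \<and>
     (\<forall>i j. \<forall>f\<in>reduced_CBN D p. reduced_homogeneous D i j (\<Phi> f) \<longleftrightarrow> reduced_homogeneous D i j f)"

context sourced_diagram
begin

lemma chain_eqI:
  assumes "f \<in> CBN D" "g \<in> CBN D"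
    and "\<And>v P. v \<subseteq> {..<n} \<Longrightarrow> fits v P \<Longrightarrow> hat D f v P = hat D g v P"
  shows "f = g"
  using hat_eqI[OF finite_arcs assms] .

lemma reducedI:
  assumes "p \<in> arcs D" "f \<in> CBN D"
    "\<And>v P. v \<subseteq> {..<n} \<Longrightarrow> fits v P \<Longrightarrow> p \<notin> P \<Longrightarrow> hat D f v P = 0"
  shows "f \<in> reduced p"
  using assms reduced_iff_hat by blast

lemma hat_reduced:
  assumes "p \<in> arcs D" "f \<in> reduced p" "vertex v" "fits v P" "p \<notin> P"
  shows "hat D f v P = 0"
  using assms reduced_iff_hat by blast

lemma multiply_reduced:
  assumes p: "p \<in> arcs D" and u: "multiplier D u" and f: "f \<in> reduced p"
  shows "multiply D u f \<in> reduced p"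
  using multiply[OF u reduced_CBN_CBN[OF f]] hat_reduced[OF p f]
  by (intro reducedI[OF p]) simp_all

lemma multiply_eqI:
  assumes "multiplier D u" "f \<in> CBN D" "g \<in> CBN D"
    "\<And>v P. v \<subseteq> {..<n} \<Longrightarrow> fits v P \<Longrightarrow> hat D g v P = u P * hat D f v P"
  shows "multiply D u f = g"
  using multiply[OF assms(1,2)] assms(3,4) by (intro chain_eqI) simp_all

lemma multiply_add:
  assumes "multiplier D u" "f \<in> CBN D" "g \<in> CBN D"
  shows "multiply D u (f + g) = multiply D u f + multiply D u g"
  using assms
  by (intro multiply_eqI) (simp_all only: CBN_closed multiply hat_linear distrib_left)

lemma multiply_const:
  assumes "f \<in> CBN D"
  shows "multiply D (\<lambda>_. a) f = (\<lambda>s. a * f s)"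
  using assms by (intro multiply_eqI multiplier_const) (simp_all only: CBN_closed hat_linear)

text \<open>Exactly one of \<open>P\<close> and \<open>- P\<close> contains \<open>p\<close>, so on
  a reduced chain one of the two terms of \<open>hat_move_base\<close> vanishes.\<close>

lemma hat_move_base_reduced:
  assumes p: "p \<in> arcs D" "q \<in> arcs D" and f: "f \<in> reduced p" and v: "vertex v" "fits v P"
  shows "hat D (move_base D q f) v P = (if q \<in> P then if p \<in> P then hat D f v P else - bar (hat D f v (- P)) else 0)"
proof -
  have v': "fits v (- P)" using v(2) by simp
  have "hat D f v P = 0" if "p \<notin> P" using hat_reduced[OF p(1) f v] that by simp
  moreover have "hat D f v (- P) = 0" if "p \<in> P" using hat_reduced[OF p(1) f v(1) v'] that by simp
  ultimately show ?thesis by (simp add: hat_move_base[OF p(2) v])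
qed

lemma move_base_reduced:
  assumes "q \<in> arcs D" "f \<in> CBN D"
  shows "move_base D q f \<in> reduced q"
  by (intro reducedI[OF assms(1)] move_base_CBN[OF assms(2)]) (simp add: hat_move_base[OF assms(1)])

text \<open>A state separating \<open>p\<close> and \<open>q\<close> is complemented twice, with a
  sign \<open>- 1\<close> and a conjugation each time.\<close>

lemma move_base_inverse:
  assumes p: "p \<in> arcs D" "q \<in> arcs D" and f: "f \<in> reduced p"
  shows "move_base D p (move_base D q f) = f"
proof (rule chain_eqI)
  fix v P assume v: "vertex v" "fits v P"
  have v': "fits v (- P)" using v(2) by simp
  note g = move_base_reduced[OF p(2) reduced_CBN_CBN[OF f]]
  show "hat D (move_base D p (move_base D q f)) v P = hat D f v P"
    unfolding hat_move_base_reduced[OF p(2,1) g v] hat_move_base_reduced[OF p f v] hat_move_base_reduced[OF p f v(1) v']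
    using hat_reduced[OF p(1) f v] by (cases "p \<in> P"; cases "q \<in> P") simp_all
qed (intro move_base_CBN reduced_CBN_CBN[OF f])+

lemma move_base_same:
  assumes p: "p \<in> arcs D" and f: "f \<in> reduced p"
  shows "move_base D p f = f"
proof (rule chain_eqI)
  fix v P assume v: "vertex v" "fits v P"
  show "hat D (move_base D p f) v P = hat D f v P"
    using hat_reduced[OF p f v] by (simp add: hat_move_base_reduced[OF p p f v])
qed (intro move_base_CBN reduced_CBN_CBN[OF f])+

lemma sign_op_reduced:
  assumes p: "p \<in> arcs D" and f: "f \<in> reduced p"
  shows "sign_op D f \<in> reduced p"
  using hat_reduced[OF p f] by (intro reducedI[OF p] sign_op_CBN reduced_CBN_CBN[OF f]) (simp add: hat_sign_op)

lemma grading_sign_square: "grading_sign j * (grading_sign j * a) = (a :: 'r::comm_ring_1)"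
  by (simp add: grading_sign_def)

lemma bar_grading_sign: "bar (grading_sign j) = grading_sign j"
  by (simp add: grading_sign_def)

lemma sign_op_inverse:
  shows "sign_op D (sign_op D f) = f"
  by (simp add: sign_op_def bar_grading_sign grading_sign_square)

text \<open>The state that witnesses a degree is allowed to change, because moving the basepoint may
  complement it.\<close>

lemma homogeneous_cong:
  assumes "f \<in> CBN D" "g \<in> CBN D" "reduced_homogeneous D i j f"
    and "\<And>v P m. v \<subseteq> {..<n} \<Longrightarrow> fits v P \<Longrightarrow> coeff (hat D g v P) m \<noteq> 0 \<Longrightarrow>
      \<exists>P. fits v P \<and> coeff (hat D f v P) m \<noteq> 0"
  shows "reduced_homogeneous D i j g"
  using assms(3,4) unfolding homogeneous_iff_hat[OF assms(1)] homogeneous_iff_hat[OF assms(2)] by meson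

lemma move_base_homogeneous:
  assumes p: "p \<in> arcs D" "q \<in> arcs D" and f: "f \<in> reduced p" "reduced_homogeneous D i j f"
  shows "reduced_homogeneous D i j (move_base D q f)"
proof (rule homogeneous_cong[OF reduced_CBN_CBN[OF f(1)] _ f(2)])
  fix v P m assume v: "vertex v" "fits v P" and m: "coeff (hat D (move_base D q f) v P) m \<noteq> 0"
  have "coeff (hat D f v P) m \<noteq> 0 \<or> coeff (hat D f v (- P)) m \<noteq> 0"
    using m by (auto simp: hat_move_base_reduced[OF p f(1) v] coeff_bar split: if_splits)
  then show "\<exists>P. fits v P \<and> coeff (hat D f v P) m \<noteq> 0"
    using v(2) compatible_uminus by blast
qed (simp add: move_base_CBN reduced_CBN_CBN[OF f(1)])

lemma sign_op_homogeneous: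
  assumes f: "f \<in> CBN D" "reduced_homogeneous D i j f"
  shows "reduced_homogeneous D i j (sign_op D f)"
proof (rule homogeneous_cong[OF f(1) _ f(2)])
  fix v P m assume v: "vertex v" "fits v P" and m: "coeff (hat D (sign_op D f) v P) m \<noteq> 0"
  then have "coeff (hat D f v P) m \<noteq> 0"
    by (auto simp: hat_sign_op[OF v] grading_sign_def coeff_bar split: if_splits)
  then show "\<exists>P. fits v P \<and> coeff (hat D f v P) m \<noteq> 0" using v(2) by blast
qed (simp add: sign_op_CBN f(1))

end

context signed_diagram
begin

section \<open>Compatibility with the differential\<close>

lemma if_term_distrib:
  "s * (if b then w * (x + y) else 0) = s * (if b then w * x else 0) + s * (if b then w * y else (0 :: 'a::comm_ring_1))"
  by (simp add: distrib_left)

lemma if_term_scale: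
  "s * (if b then w * (a * x) else 0) = a * (s * (if b then w * x else (0 :: 'a::comm_ring_1)))"
  by (simp add: mult.left_commute)

lemma differential_linear:
  shows "\<delta> (f + g) = \<delta> f + \<delta> g"
    and "\<delta> (\<lambda>s. a * f s) = (\<lambda>s. a * \<delta> f s)"
proof -
  show "\<delta> (f + g) = \<delta> f + \<delta> g"
  proof (intro chain_eqI CBN_closed differential_CBN)
    fix v P assume v: "vertex v" "fits v P"
    show "hat D (\<delta> (f + g)) v P = hat D (\<delta> f + \<delta> g) v P"
      by (simp only: hat_linear(1) hat_differential[OF v] if_term_distrib sum.distrib)
  qed
  show "\<delta> (\<lambda>s. a * f s) = (\<lambda>s. a * \<delta> f s)"
  proof (intro chain_eqI CBN_closed differential_CBN)
    fix v P assume v: "vertex v" "fits v P"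
    show "hat D (\<delta> (\<lambda>s. a * f s)) v P = hat D (\<lambda>s. a * \<delta> f s) v P"
      by (simp only: hat_linear(3) hat_differential[OF v] if_term_scale sum_distrib_left)
  qed
qed

lemma differential_zero: "\<delta> (0 :: 'r::comm_ring_1 chain) = 0"
  using differential_linear(1)[of "0 :: 'r chain" 0] by simp

lemma differential_diff:
  shows "\<delta> (f - g) = \<delta> f - \<delta> g"
  using differential_linear(1)[of "f - g" g] by (simp add: algebra_simps)

lemma vertex_remove:
  "vertex v \<Longrightarrow> v - {k} \<subseteq> {..<n}"
  by blast

lemma differential_reduced:
  assumes p: "p \<in> arcs D" and f: "f \<in> reduced p"
  shows "\<delta> f \<in> reduced p"
proof (intro reducedI[OF p] differential_CBN)
  fix v P assume v: "vertex v" "fits v P" "p \<notin> P"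
  show "hat D (\<delta> f) v P = 0"
    unfolding hat_differential[OF v(1,2)]
  proof (rule sum.neutral, rule ballI)
    fix k
    have "hat D f (v - {k}) P = 0" if "fits (v - {k}) P"
      by (rule hat_reduced[OF p f vertex_remove[OF v(1)] that v(3)])
    then show "edge_term v k P (hat D f (v - {k}) P) = 0"
      by (cases "fits (v - {k}) P") simp_all
  qed
qed

lemma differential_multiply:
  assumes u: "multiplier D u" and f: "f \<in> CBN D"
  shows "\<delta> (multiply D u f) = multiply D u (\<delta> f)"
proof (rule multiply_eqI[OF u differential_CBN differential_CBN, symmetric])
  fix v P assume v: "vertex v" "fits v P"
  show "hat D (\<delta> (multiply D u f)) v P = u P * hat D (\<delta> f) v P"
    unfolding hat_differential[OF v] sum_distrib_left
  proof (rule sum.cong[OF refl])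
    fix k
    show "edge_term v k P (hat D (multiply D u f) (v - {k}) P)
      = u P * (edge_term v k P (hat D f (v - {k}) P))"
    proof (cases "fits (v - {k}) P")
      case True
      show ?thesis unfolding if_P[OF True] multiply(2)[OF u f vertex_remove[OF v(1)] True]
        by (simp only: mult_ac)
    qed simp
  qed
qed

lemma differential_move_base:
  fixes f :: "'r::comm_ring_1 chain"
  assumes q: "q \<in> arcs D" and f: "f \<in> CBN D"
  shows "\<delta> (move_base D q f) = move_base D q (\<delta> f)"
proof (rule chain_eqI[OF differential_CBN move_base_CBN[OF differential_CBN]])
  fix v P assume v: "vertex v" "fits v P"
  have v': "fits v (- P)" using v(2) by simp
  have s: "bar (edge_sign w k) = (edge_sign w k :: 'r poly)" for w k by (simp add: edge_sign_def)
  \<comment> \<open>The terms at \<open>P\<close> and the conjugated terms at \<open>- P\<close>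
    carry the same edge factors, by \<open>bar_edge_weight\<close>.\<close>
  have *: "hat D (\<delta> f) v P - bar (hat D (\<delta> f) v (- P))
    = (\<Sum>k\<in>v. edge_sign (v - {k}) k * (if fits (v - {k}) P then edge_weight (v - {k}) k P *
        (hat D f (v - {k}) P - bar (hat D f (v - {k}) (- P))) else 0))"
    unfolding hat_differential[OF v] hat_differential[OF v(1) v'] bar_sum sum_subtractf[symmetric]
  proof (rule sum.cong[OF refl])
    fix k
    show "edge_term v k P (hat D f (v - {k}) P) -
        bar (edge_sign (v - {k}) k *
          (if fits (v - {k}) (- P) then edge_weight (v - {k}) k (- P) * hat D f (v - {k}) (- P) else 0))
      = edge_sign (v - {k}) k * (if fits (v - {k}) P then edge_weight (v - {k}) k P *
        (hat D f (v - {k}) P - bar (hat D f (v - {k}) (- P))) else 0)"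
      by (cases "fits (v - {k}) P")
         (simp_all only: compatible_uminus if_True if_False bar_simps s bar_edge_weight right_diff_distrib mult_zero_right diff_self)
  qed
  show "hat D (\<delta> (move_base D q f)) v P = hat D (move_base D q (\<delta> f)) v P"
  proof (cases "q \<in> P")
    case True
    show ?thesis unfolding hat_move_base[OF q v] if_P[OF True] * unfolding hat_differential[OF v]
    proof (rule sum.cong[OF refl])
      fix k
      show "edge_term v k P (hat D (move_base D q f) (v - {k}) P)
        = edge_sign (v - {k}) k * (if fits (v - {k}) P then edge_weight (v - {k}) k P *
          (hat D f (v - {k}) P - bar (hat D f (v - {k}) (- P))) else 0)"
        using hat_move_base[OF q vertex_remove[OF v(1), of k], of P f] True
        by (cases "fits (v - {k}) P") (simp_all only: if_True if_False)
    qed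
  next
    case False
    show ?thesis unfolding hat_move_base[OF q v] if_not_P[OF False] hat_differential[OF v]
    proof (rule sum.neutral, rule ballI)
      fix k
      show "edge_term v k P (hat D (move_base D q f) (v - {k}) P) = 0"
        using hat_move_base[OF q vertex_remove[OF v(1), of k], of P f] False
        by (cases "fits (v - {k}) P") (simp_all only: if_True if_False mult_zero_right)
    qed
  qed
qed

lemma differential_sign_op:
  fixes f :: "'r::comm_ring_1 chain"
  assumes f: "f \<in> CBN D"
  shows "\<delta> (sign_op D f) = sign_op D (\<delta> f)"
proof (rule chain_eqI[OF differential_CBN sign_op_CBN[OF differential_CBN]])
  fix v P assume v: "vertex v" "fits v P"
  have s: "bar (edge_sign w k) = (edge_sign w k :: 'r poly)" for w k by (simp add: edge_sign_def)
  have w: "(edge_weight (v - {k}) k P :: 'r poly) * (grading_sign (vertex_degree D (v - {k})) * X)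
      = grading_sign (vertex_degree D v) * (bar (edge_weight (v - {k}) k P) * X)" if "k \<in> v" for k X
  proof -
    have e: "grading_sign (vertex_degree D v) * bar (edge_weight (v - {k}) k P)
      = grading_sign (vertex_degree D (v - {k})) * (edge_weight (v - {k}) k P :: 'r poly)"
      by (rule bar_edge_weight_degree[OF adjacent_remove[OF v(1) that]]) simp
    have "edge_weight (v - {k}) k P * (grading_sign (vertex_degree D (v - {k})) * X)
      = (grading_sign (vertex_degree D (v - {k})) * edge_weight (v - {k}) k P) * X" by (simp only: mult_ac)
    also have "\<dots> = grading_sign (vertex_degree D v) * (bar (edge_weight (v - {k}) k P) * X)"
      unfolding e[symmetric] by (simp only: mult_ac)
    finally show ?thesis .
  qed
  show "hat D (\<delta> (sign_op D f)) v P = hat D (sign_op D (\<delta> f)) v P"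
    unfolding hat_sign_op[OF v] hat_differential[OF v] bar_sum sum_distrib_left
  proof (rule sum.cong[OF refl])
    fix k assume k: "k \<in> v"
    show "edge_term v k P (hat D (sign_op D f) (v - {k}) P)
      = grading_sign (vertex_degree D v) * bar (edge_term v k P (hat D f (v - {k}) P))"
    proof (cases "fits (v - {k}) P")
      case True
      show ?thesis unfolding if_P[OF True] hat_sign_op[OF vertex_remove[OF v(1)] True] w[OF k] bar_simps s
        by (simp only: mult_ac)
    qed simp
  qed
qed

lemma reduced_iso_move_base:
  assumes p: "p \<in> arcs D" "q \<in> arcs D"
  shows "reduced_iso D neg p q (move_base D q :: 'r::comm_ring_1 chain \<Rightarrow> _)"
  unfolding reduced_iso_def
proof (intro conjI ballI allI)
  show "bij_betw (move_base D q :: 'r chain \<Rightarrow> _) (reduced p) (reduced q)"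
    using p by (intro bij_betw_byWitness[where f' = "move_base D p"])
      (auto simp: move_base_inverse intro: move_base_reduced reduced_CBN_CBN)
  fix f :: "'r chain" assume f: "f \<in> reduced p"
  note fC = reduced_CBN_CBN[OF f]
  show "\<delta> (move_base D q f) = move_base D q (\<delta> f)"
    by (rule differential_move_base[OF p(2) fC])
  show "reduced_homogeneous D i j (move_base D q f) \<longleftrightarrow> reduced_homogeneous D i j f" for i j
  proof
    assume "reduced_homogeneous D i j (move_base D q f)"
    from move_base_homogeneous[OF p(2,1) move_base_reduced[OF p(2) fC] this]
    show "reduced_homogeneous D i j f" unfolding move_base_inverse[OF p f] .
  qed (rule move_base_homogeneous[OF p f])
  show "move_base D q (\<lambda>s. [:r:] * f s) = (\<lambda>s. [:r:] * move_base D q f s)" for r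
  proof (intro chain_eqI CBN_closed(4) move_base_CBN fC)
    fix v P assume v: "vertex v" "fits v P"
    show "hat D (move_base D q (\<lambda>s. [:r:] * f s)) v P = hat D (\<lambda>s. [:r:] * move_base D q f s) v P"
      unfolding hat_linear hat_move_base[OF p(2) v] bar_simps by (simp only: right_diff_distrib split: if_split) simp
  qed
  fix g :: "'r chain" assume g: "g \<in> reduced p"
  note gC = reduced_CBN_CBN[OF g]
  show "move_base D q (f + g) = move_base D q f + move_base D q g"
  proof (intro chain_eqI CBN_closed(2) move_base_CBN fC gC)
    fix v P assume v: "vertex v" "fits v P"
    show "hat D (move_base D q (f + g)) v P = hat D (move_base D q f + move_base D q g) v P"
      unfolding hat_linear hat_move_base[OF p(2) v] bar_simps by simp
  qed
qed

lemma reduced_iso_sign_op: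
  assumes p: "p \<in> arcs D"
  shows "reduced_iso D neg p p (sign_op D :: 'r::comm_ring_1 chain \<Rightarrow> _)"
  unfolding reduced_iso_def
proof (intro conjI ballI allI)
  show "bij_betw (sign_op D :: 'r chain \<Rightarrow> _) (reduced p) (reduced p)"
    using p by (intro bij_betw_byWitness[where f' = "sign_op D"])
      (auto simp: sign_op_inverse intro: sign_op_reduced)
  fix f :: "'r chain" assume f: "f \<in> reduced p"
  note fC = reduced_CBN_CBN[OF f]
  show "\<delta> (sign_op D f) = sign_op D (\<delta> f)"
    by (rule differential_sign_op[OF fC])
  show "reduced_homogeneous D i j (sign_op D f) \<longleftrightarrow> reduced_homogeneous D i j f" for i j
  proof
    assume "reduced_homogeneous D i j (sign_op D f)"
    from sign_op_homogeneous[OF sign_op_CBN[OF fC] this]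
    show "reduced_homogeneous D i j f" unfolding sign_op_inverse .
  qed (rule sign_op_homogeneous[OF fC])
  show "sign_op D (\<lambda>s. [:r:] * f s) = (\<lambda>s. [:r:] * sign_op D f s)" for r
    unfolding sign_op_def bar_simps by (simp only: mult_ac)
  show "sign_op D (f + g) = sign_op D f + sign_op D g" for g :: "'r chain"
    unfolding sign_op_def by (simp add: fun_eq_iff distrib_left)
qed

lemma reduced_iso_comp:
  fixes \<Phi> \<Psi> :: "'r::comm_ring_1 chain \<Rightarrow> 'r chain"
  assumes \<Phi>: "reduced_iso D neg p q \<Phi>" and \<Psi>: "reduced_iso D neg q q' \<Psi>"
  shows "reduced_iso D neg p q' (\<lambda>f. \<Psi> (\<Phi> f))"
proof -
  have mem: "\<Phi> f \<in> reduced q" if "f \<in> reduced p" for f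
    using \<Phi> that unfolding reduced_iso_def bij_betw_def by blast
  have "bij_betw (\<Psi> \<circ> \<Phi>) (reduced p) (reduced q')"
    using \<Phi> \<Psi> unfolding reduced_iso_def by (blast intro: bij_betw_trans)
  moreover have "\<Psi> (\<Phi> (f + g)) = \<Psi> (\<Phi> f) + \<Psi> (\<Phi> g)"
    if "f \<in> reduced p" "g \<in> reduced p" for f g
    using \<Phi> \<Psi> mem[OF that(1)] mem[OF that(2)] that unfolding reduced_iso_def by simp
  moreover have "\<Psi> (\<Phi> (\<lambda>s. [:r:] * f s)) = (\<lambda>s. [:r:] * \<Psi> (\<Phi> f) s)" if "f \<in> reduced p" for r f
  proof -
    have "\<Phi> (\<lambda>s. [:r:] * f s) = (\<lambda>s. [:r:] * \<Phi> f s)" using \<Phi> that unfolding reduced_iso_def by blast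
    moreover have "\<Psi> (\<lambda>s. [:r:] * \<Phi> f s) = (\<lambda>s. [:r:] * \<Psi> (\<Phi> f) s)"
      using \<Psi> mem[OF that] unfolding reduced_iso_def by blast
    ultimately show ?thesis by simp
  qed
  moreover have "\<delta> (\<Psi> (\<Phi> f)) = \<Psi> (\<Phi> (\<delta> f))" if "f \<in> reduced p" for f
    using \<Phi> \<Psi> mem[OF that] that unfolding reduced_iso_def by simp
  moreover have "reduced_homogeneous D i j (\<Psi> (\<Phi> f)) \<longleftrightarrow> reduced_homogeneous D i j f"
    if "f \<in> reduced p" for i j f
    using \<Phi> \<Psi> mem[OF that] that unfolding reduced_iso_def by simp
  ultimately show ?thesis unfolding reduced_iso_def comp_def by blast
qed

end

section \<open>Homology\<close>

context signed_diagram
begin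

section \<open>Homology classes as cosets of boundaries\<close>

lemma boundaries_reduced:
  assumes "p \<in> arcs D"
  shows "(boundaries p :: 'r::comm_ring_1 chain set) \<subseteq> reduced p"
  unfolding reduced_boundaries_def using differential_reduced[OF assms] by blast

lemma boundaries_closed:
  fixes f g :: "'r::comm_ring_1 chain"
  shows "0 \<in> (boundaries p :: 'r chain set)"
    "f \<in> boundaries p \<Longrightarrow> g \<in> boundaries p \<Longrightarrow> f + g \<in> boundaries p"
    "f \<in> boundaries p \<Longrightarrow> g \<in> boundaries p \<Longrightarrow> f - g \<in> boundaries p"
    "f \<in> boundaries p \<Longrightarrow> (\<lambda>s. a * f s) \<in> boundaries p"
proof -
  show "0 \<in> (boundaries p :: 'r chain set)"
    unfolding reduced_boundaries_def using differential_zero reduced_CBN_closed(1) by (intro image_eqI) auto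
  have mem: "\<delta> h \<in> boundaries p" if "h \<in> reduced p" for h :: "'r chain"
    unfolding reduced_boundaries_def using that by (rule imageI)
  assume "f \<in> boundaries p"
  then obtain f' where f': "f' \<in> reduced p" "f = \<delta> f'"
    unfolding reduced_boundaries_def by blast
  show "(\<lambda>s. a * f s) \<in> boundaries p"
    using mem[OF reduced_CBN_closed(4)[OF f'(1)], of a] unfolding f'(2) differential_linear(2) .
  assume "g \<in> boundaries p"
  then obtain g' where g': "g' \<in> reduced p" "g = \<delta> g'"
    unfolding reduced_boundaries_def by blast
  show "f + g \<in> boundaries p"
    using mem[OF reduced_CBN_closed(2)[OF f'(1) g'(1)]] unfolding f'(2) g'(2) differential_linear(1) .
  show "f - g \<in> boundaries p"
    using mem[OF reduced_CBN_closed(3)[OF f'(1) g'(1)]] unfolding f'(2) g'(2) differential_diff .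
qed

lemma boundaries_multiply:
  assumes "p \<in> arcs D" "multiplier D u" "f \<in> boundaries p"
  shows "multiply D u f \<in> boundaries p"
proof -
  obtain g where g: "g \<in> reduced p" "f = \<delta> g"
    using assms(3) unfolding reduced_boundaries_def by blast
  then have "multiply D u f = \<delta> (multiply D u g)"
    using differential_multiply[OF assms(2) reduced_CBN_CBN] by simp
  then show ?thesis unfolding reduced_boundaries_def
    using multiply_reduced[OF assms(1,2) g(1)] by blast
qed

lemma class_mem: "x \<in> hclass p f \<longleftrightarrow> x - f \<in> boundaries p"
  unfolding homology_class_def by (auto simp: image_iff intro!: bexI[of _ "x - f"])

lemma class_eqI:
  assumes "f - g \<in> boundaries p"
  shows "hclass p f = hclass p g"
proof -
  have "x - f \<in> boundaries p \<longleftrightarrow> x - g \<in> boundaries p" for x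
  proof
    assume "x - f \<in> boundaries p"
    from boundaries_closed(2)[OF this assms] show "x - g \<in> boundaries p" by simp
  next
    assume "x - g \<in> boundaries p"
    from boundaries_closed(3)[OF this assms] show "x - f \<in> boundaries p" by simp
  qed
  then show ?thesis using class_mem by blast
qed

lemma class_self: "(f :: 'r::comm_ring_1 chain) \<in> hclass p f"
  by (simp add: class_mem boundaries_closed)

lemma class_reduced:
  assumes "p \<in> arcs D" "f \<in> reduced p"
  shows "hclass p f \<subseteq> reduced p"
  using boundaries_reduced[OF assms(1)] reduced_CBN_closed(2)[OF assms(2)]
  unfolding homology_class_def by blast

lemma class_add:
  shows "{x + y | x y. x \<in> hclass p f \<and> y \<in> hclass p g} = hclass p (f + g)"
proof (intro equalityI subsetI)
  fix z assume "z \<in> {x + y | x y. x \<in> hclass p f \<and> y \<in> hclass p g}"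
  then obtain x y where "z = x + y" "x - f \<in> boundaries p" "y - g \<in> boundaries p"
    unfolding class_mem by blast
  moreover from this have "z - (f + g) = (x - f) + (y - g)" by simp
  ultimately show "z \<in> hclass p (f + g)" unfolding class_mem by (metis boundaries_closed(2))
next
  fix z assume z: "z \<in> hclass p (f + g)"
  have "z - g \<in> hclass p f" using z unfolding class_mem by (simp add: algebra_simps)
  moreover have "z = (z - g) + g" by simp
  ultimately show "z \<in> {x + y | x y. x \<in> hclass p f \<and> y \<in> hclass p g}"
    using class_self by blast
qed

text \<open>The image of a coset need not be a full coset, as for \<open>M = 0\<close>. Boundaries
  are added to fill it up, as in the scalar multiplication of \<open>BN\<close>.\<close>

lemma class_linear_image:
  assumes "\<And>b. b \<in> boundaries p \<Longrightarrow> M (f + b) = M f + M b"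
    and "\<And>b. b \<in> boundaries p \<Longrightarrow> M b \<in> boundaries p"
  shows "{M x + b | x b. x \<in> hclass p f \<and> b \<in> boundaries p} = hclass p (M f)"
proof (intro equalityI subsetI)
  fix z assume "z \<in> {M x + b | x b. x \<in> hclass p f \<and> b \<in> boundaries p}"
  then obtain b' b where b: "b' \<in> boundaries p" "b \<in> boundaries p" "z = M (f + b') + b"
    unfolding homology_class_def by blast
  then have "z - M f = M b' + b" using assms(1) by simp
  then show "z \<in> hclass p (M f)" unfolding class_mem using assms(2) b boundaries_closed(2) by metis
next
  fix z assume "z \<in> hclass p (M f)"
  then obtain b where "b \<in> boundaries p" "z = M f + b" unfolding homology_class_def by blast
  then show "z \<in> {M x + b | x b. x \<in> hclass p f \<and> b \<in> boundaries p}"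
    using class_self by blast
qed

lemma BN_simps:
  "carrier (BN D neg p) = hclass p ` cycles p"
  "zero (BN D neg p) = boundaries p"
  "add (BN D neg p) X Y = {f + g | f g. f \<in> X \<and> g \<in> Y}"
  "module.smult (BN D neg p) a X = {(\<lambda>s. a * f s) + b | f b. f \<in> X \<and> b \<in> boundaries p}"
  "hpart (BN D neg p) i j = hclass p ` {f \<in> cycles p. reduced_homogeneous D i j f}"
  by (simp_all add: BN_def)

lemma BN_add: "hclass p f \<oplus>\<^bsub>BN D neg p\<^esub> hclass p g
    = hclass p (f + g :: 'r::comm_ring_1 chain)"
  unfolding BN_simps by (rule class_add)

lemma BN_smult: "a \<odot>\<^bsub>BN D neg p\<^esub> hclass p f
    = hclass p (\<lambda>s. a * (f :: 'r::comm_ring_1 chain) s)"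
  unfolding BN_simps
proof (rule class_linear_image)
  show "(\<lambda>s. a * (f + b) s) = (\<lambda>s. a * f s) + (\<lambda>s. a * b s)" for b
    by (simp add: fun_eq_iff distrib_left)
qed (rule boundaries_closed(4))

lemma cyclesD:
  assumes "f \<in> cycles p"
  shows "f \<in> reduced p" "f \<in> CBN D" "\<delta> f = 0"
  using assms by (simp_all add: reduced_cycles_def reduced_CBN_def)

lemma cycles_closed:
  fixes f g :: "'r::comm_ring_1 chain"
  shows "0 \<in> (cycles p :: 'r chain set)"
    "f \<in> cycles p \<Longrightarrow> g \<in> cycles p \<Longrightarrow> f + g \<in> cycles p"
    "f \<in> cycles p \<Longrightarrow> (\<lambda>s. a * f s) \<in> cycles p"
proof -
  show "0 \<in> (cycles p :: 'r chain set)"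
    by (simp add: reduced_cycles_def reduced_CBN_closed(1) differential_zero)
  show "f + g \<in> cycles p" if "f \<in> cycles p" "g \<in> cycles p"
    using that by (simp add: reduced_cycles_def reduced_CBN_closed(2) differential_linear(1))
  show "(\<lambda>s. a * f s) \<in> cycles p" if "f \<in> cycles p"
    using that by (simp add: reduced_cycles_def reduced_CBN_closed(4) differential_linear(2)) (simp add: fun_eq_iff)
qed

lemma cycles_multiply:
  fixes f :: "'r::comm_ring_1 chain"
  assumes "p \<in> arcs D" "multiplier D u" "f \<in> cycles p"
  shows "multiply D u f \<in> cycles p"
proof -
  note f = cyclesD[OF assms(3)]
  have "multiply D u (0 :: 'r chain) = 0"
    by (intro multiply_eqI assms CBN_closed) (simp add: hat_linear)
  then have "\<delta> (multiply D u f) = 0"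
    unfolding differential_multiply[OF assms(2) f(2)] f(3) .
  then show ?thesis
    using multiply_reduced[OF assms(1,2) f(1)] unfolding reduced_cycles_def by blast
qed

text \<open>An isomorphism maps boundaries onto boundaries, so the image of a coset is a full coset
  without further completion.\<close>

lemma reduced_iso_class:
  fixes \<Phi> :: "'r::comm_ring_1 chain \<Rightarrow> 'r chain"
  assumes p: "p \<in> arcs D" and \<Phi>: "reduced_iso D neg p q \<Phi>" and f: "f \<in> reduced p"
  shows "\<Phi> ` hclass p f = hclass q (\<Phi> f)"
proof -
  have bij: "\<Phi> ` reduced p = reduced q"
    using \<Phi> unfolding reduced_iso_def bij_betw_def by blast
  have "\<Phi> ` boundaries p = (\<lambda>f. \<Phi> (\<delta> f)) ` reduced p"
    by (simp add: reduced_boundaries_def image_image)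
  also have "\<dots> = (\<lambda>f. \<delta> (\<Phi> f)) ` reduced p"
    using \<Phi> unfolding reduced_iso_def by (intro image_cong) auto
  also have "\<dots> = boundaries q"
    by (simp add: reduced_boundaries_def bij[symmetric] image_image)
  finally have B: "\<Phi> ` boundaries p = boundaries q" .
  have "\<Phi> ` hclass p f = (\<lambda>b. \<Phi> (f + b)) ` boundaries p"
    by (simp add: homology_class_def image_image)
  also have "\<dots> = (\<lambda>b. \<Phi> f + \<Phi> b) ` boundaries p"
    using \<Phi> f boundaries_reduced[OF p] unfolding reduced_iso_def by (intro image_cong) auto
  also have "\<dots> = hclass q (\<Phi> f)"
    unfolding homology_class_def B[symmetric] by (simp add: image_image)
  finally show ?thesis .
qed

lemma reduced_iso_cycles:
  fixes \<Phi> :: "'r::comm_ring_1 chain \<Rightarrow> 'r chain"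
  assumes p: "p \<in> arcs D" and \<Phi>: "reduced_iso D neg p q \<Phi>"
  shows "\<Phi> ` cycles p = cycles q"
proof -
  have bij: "\<Phi> ` reduced p = reduced q" and inj: "inj_on \<Phi> (reduced p)"
    and d: "\<And>f. f \<in> reduced p \<Longrightarrow> \<delta> (\<Phi> f) = \<Phi> (\<delta> f)"
    and add: "\<Phi> (0 + 0) = \<Phi> 0 + \<Phi> 0"
    using \<Phi> reduced_CBN_closed(1) unfolding reduced_iso_def bij_betw_def by blast+
  have zero: "\<Phi> 0 = 0" using add by simp
  have "\<delta> (\<Phi> f) = 0 \<longleftrightarrow> \<delta> f = 0" if "f \<in> reduced p" for f
  proof
    assume "\<delta> (\<Phi> f) = 0"
    then have "\<Phi> (\<delta> f) = \<Phi> 0" using d[OF that] zero by simp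
    from inj_onD[OF inj this differential_reduced[OF p that] reduced_CBN_closed(1)]
    show "\<delta> f = 0" .
  next
    assume "\<delta> f = 0"
    then show "\<delta> (\<Phi> f) = 0" using d[OF that] zero by simp
  qed
  then show ?thesis unfolding reduced_cycles_def bij[symmetric] by blast
qed

lemma reduced_iso_bigraded:
  fixes \<Phi> :: "'r::comm_ring_1 chain \<Rightarrow> 'r chain"
  assumes p: "p \<in> arcs D" and \<Phi>: "reduced_iso D neg p q \<Phi>"
  shows "bigraded_iso (BN D neg p) (BN D neg q) ((`) \<Phi>)"
  unfolding bigraded_iso_def
proof (intro conjI ballI allI)
  note cl = reduced_iso_class[OF p \<Phi>]
  have inj: "inj_on \<Phi> (reduced p)" using \<Phi> unfolding reduced_iso_def bij_betw_def by blast
  have sub: "X \<subseteq> reduced p" if "X \<in> carrier (BN D neg p)" for X :: "'r chain set"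
    using that class_reduced[OF p cyclesD(1)] unfolding BN_simps by blast
  have "inj_on ((`) \<Phi>) (carrier (BN D neg p))"
    using inj_on_image_eq_iff[OF inj] sub by (intro inj_onI) blast
  moreover have "(`) \<Phi> ` hclass p ` F = hclass q ` \<Phi> ` F"
    if "F \<subseteq> reduced p" for F
    unfolding image_image using that cl by (intro image_cong) auto
  note im = this
  have cyc: "cycles p \<subseteq> (reduced p :: 'r chain set)" by (simp add: reduced_cycles_def)
  have "(`) \<Phi> ` carrier (BN D neg p) = carrier (BN D neg q)"
    unfolding BN_simps im[OF cyc] reduced_iso_cycles[OF p \<Phi>] ..
  ultimately show "bij_betw ((`) \<Phi>) (carrier (BN D neg p)) (carrier (BN D neg q))"
    by (simp add: bij_betw_def)
  show "(`) \<Phi> ` hpart (BN D neg p) i j = hpart (BN D neg q) i j" for i j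
  proof -
    define F :: "'r chain set" where "F = {f \<in> cycles p. reduced_homogeneous D i j f}"
    have hom: "reduced_homogeneous D i j (\<Phi> f) \<longleftrightarrow> reduced_homogeneous D i j f" if "f \<in> cycles p" for f
      using \<Phi> cyclesD(1)[OF that] unfolding reduced_iso_def by blast
    have "F \<subseteq> reduced p" using cyc unfolding F_def by blast
    moreover have "\<Phi> ` F = {f \<in> cycles q. reduced_homogeneous D i j f}"
      unfolding reduced_iso_cycles[OF p \<Phi>, symmetric] F_def using hom by blast
    ultimately show ?thesis unfolding BN_simps F_def[symmetric] by (simp only: im)
  qed
  fix X :: "'r chain set" assume X: "X \<in> carrier (BN D neg p)"
  then obtain f where f: "f \<in> cycles p" "X = hclass p f" unfolding BN_simps by blast
  note fR = cyclesD(1)[OF f(1)]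
  show "\<Phi> ` ([:r:] \<odot>\<^bsub>BN D neg p\<^esub> X) = [:r:] \<odot>\<^bsub>BN D neg q\<^esub> \<Phi> ` X" for r
  proof -
    have "\<Phi> (\<lambda>s. [:r:] * f s) = (\<lambda>s. [:r:] * \<Phi> f s)" using \<Phi> fR unfolding reduced_iso_def by blast
    then show ?thesis unfolding f(2) BN_smult cl[OF fR] cl[OF reduced_CBN_closed(4)[OF fR]] by (simp only:)
  qed
  fix Y :: "'r chain set" assume Y: "Y \<in> carrier (BN D neg p)"
  then obtain g where g: "g \<in> cycles p" "Y = hclass p g" unfolding BN_simps by blast
  note gR = cyclesD(1)[OF g(1)]
  have "\<Phi> (f + g) = \<Phi> f + \<Phi> g" using \<Phi> fR gR unfolding reduced_iso_def by blast
  then show "\<Phi> ` (X \<oplus>\<^bsub>BN D neg p\<^esub> Y) = \<Phi> ` X \<oplus>\<^bsub>BN D neg q\<^esub> \<Phi> ` Y"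
    unfolding f(2) g(2) BN_add cl[OF fR] cl[OF gR] cl[OF reduced_CBN_closed(2)[OF fR gR]] by (simp only:)
qed

section \<open>The actions of H for different basepoints\<close>

lemma backward_reduced:
  assumes p: "p \<in> arcs D" and k: "k < n" and f: "f \<in> reduced p"
  shows "backward k f \<in> reduced p"
proof (intro reducedI[OF p] backward_CBN)
  fix v P assume v: "vertex v" "fits v P" "p \<notin> P"
  have "insert k v \<subseteq> {..<n}" using v(1) k by blast
  then have "hat D f (insert k v) P = 0" if "fits (insert k v) P"
    using hat_reduced[OF p f _ that v(3)] by blast
  then show "hat D (backward k f) v P = 0" unfolding hat_backward[OF k v(1,2)]
    by (cases "fits (insert k v) P") simp_all
qed

text \<open>
  On the reduced complex with basepoint \<open>p0\<close>, the action of \<open>H\<close> for the basepoint \<open>a\<close> is that of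
  \<open>2 x - H\<close>, with \<open>x\<close> the variable of the circle through \<open>a\<close>, up to a sign.  This sign alternates
  along each component, since \<open>x + x' - H\<close> is null homotopic for arcs on opposite sides of a
  crossing.
\<close>

definition base_action :: "nat \<Rightarrow> nat \<Rightarrow> nat set \<Rightarrow> 'r::comm_ring_1 poly" where
  "base_action p0 a P = (if c a = c p0 then split_weight a P else - split_weight a P)"

lemma multiplier_base_action:
  assumes "a \<in> arcs D" shows "multiplier D (base_action p0 a :: _ \<Rightarrow> 'r::comm_ring_1 poly)"
proof -
  have "multiplier D (\<lambda>P. (if c a = c p0 then 1 else - 1) * (split_weight a P :: 'r poly))"
    by (intro multiplier_mult multiplier_const multiplier_split_weight assms)
  also have "(\<lambda>P. (if c a = c p0 then 1 else - 1) * split_weight a P) = (base_action p0 a :: _ \<Rightarrow> 'r poly)"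
    by (rule ext) (simp add: base_action_def)
  finally show ?thesis .
qed

text \<open>A smoothing matches slots \<open>0\<close> and \<open>2\<close> with slots
  \<open>1\<close> and \<open>3\<close>, so both strands give the same sum, the value of
  \<open>2 (x + x' - H)\<close>.\<close>

lemma split_weight_strand:
  assumes k: "k < n" and P: "fits v P" and ab: "(a, b) \<in> {(ui k, uo k), (oi k, oo k)}"
  shows "split_weight a P + split_weight b P
    = 2 * (if arc k 0 \<in> P \<longleftrightarrow> arc k 2 \<in> P then split_weight (arc k 0) P else (0 :: 'r::comm_ring_1 poly))"
proof -
  note P' = P[unfolded compatible_iff, THEN spec, THEN mp, OF k]
  have "split_weight (arc k 1) P + split_weight (arc k 3) P
      = split_weight (arc k 0) P + (split_weight (arc k 2) P :: 'r poly)"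
    using P' by (cases "k \<in> v") (simp_all add: split_weight_def)
  moreover have "split_weight (oi k) P + split_weight (oo k) P
      = split_weight (arc k 1) P + (split_weight (arc k 3) P :: 'r poly)"
    by (simp add: slots_eq add.commute)
  ultimately have "split_weight a P + split_weight b P
      = split_weight (arc k 0) P + (split_weight (arc k 2) P :: 'r poly)"
    using ab by (auto simp: slots_eq)
  then show ?thesis by (simp add: split_weight_def)
qed

text \<open>The colour changes along a strand, so the difference of the signed actions is, up to
  sign, the sum of the two operators \<open>2 x - H\<close>; this is twice the null homotopic
  operator of \<open>hat_homotopy\<close>.\<close>

lemma base_action_strand:
  fixes f :: "'r::comm_ring_1 chain"
  assumes p: "p0 \<in> arcs D" and f: "f \<in> cycles p0" and k: "k < n"
    and ab: "(a, b) \<in> {(ui k, uo k), (oi k, oo k)}"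
  shows "multiply D (base_action p0 a) f - multiply D (base_action p0 b) f \<in> boundaries p0"
proof -
  note fR = cyclesD[OF f]
  have arcs: "a \<in> arcs D" "b \<in> arcs D" using ab strand_ends[OF k] ends_subset by auto
  have "c b = (\<not> c a)" using ab colour[OF k] by auto
  then obtain t :: "'r poly" where t: "base_action p0 a P - base_action p0 b P = t * (split_weight a P + split_weight b P)" for P
    by (cases "c a = c p0") (auto simp: base_action_def intro: that[of 1] that[of "- 1"])
  define g where "g = (\<lambda>s. (t * 2) * backward k f s)"
  have g: "g \<in> reduced p0" unfolding g_def by (intro reduced_CBN_closed backward_reduced p k fR)
  \<comment> \<open>As \<open>f\<close> is a cycle, only the half of the homotopy that is a boundary
    remains.\<close>
  have b0: "backward k (0 :: 'r chain) = 0" by (simp add: backward_def fun_eq_iff)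
  have "multiply D (base_action p0 a) f - multiply D (base_action p0 b) f = \<delta> g"
  proof (intro chain_eqI CBN_closed multiply(1) multiplier_base_action arcs fR differential_CBN)
    fix v P assume v: "vertex v" "fits v P"
    have "hat D (\<delta> g) v P = (t * 2) * hat D (\<delta> (backward k f)) v P"
      unfolding g_def differential_linear(2) hat_linear(3) ..
    also have "hat D (\<delta> (backward k f)) v P
      = (if arc k 0 \<in> P \<longleftrightarrow> arc k 2 \<in> P then split_weight (arc k 0) P else 0) * hat D f v P"
      using hat_homotopy[OF k v, of f] by (simp only: fR b0 add_0_right)
    also have "(t * 2) * \<dots> = t * (split_weight a P + split_weight b P) * hat D f v P"
      unfolding split_weight_strand[OF k v(2) ab] by (simp only: mult_ac)
    finally show "hat D (multiply D (base_action p0 a) f - multiply D (base_action p0 b) f) v P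
      = hat D (\<delta> g) v P"
      by (simp only: hat_linear(2) multiply(2)[OF multiplier_base_action[OF arcs(1)] fR(2) v]
          multiply(2)[OF multiplier_base_action[OF arcs(2)] fR(2) v] t[symmetric] left_diff_distrib)
  qed
  then show ?thesis unfolding reduced_boundaries_def using g by blast
qed

definition strand_rel :: "(nat \<times> nat) set" where
  "strand_rel = (\<Union>x\<in>set (crossings D). {(under_in x, under_out x), (over_in x, over_out x)})"

lemma base_action_component:
  assumes p: "p0 \<in> arcs D" and f: "f \<in> cycles p0" and a: "a \<in> arcs D"
    and b: "b \<in> gen_class strand_rel a"
  shows "b \<in> arcs D" "multiply D (base_action p0 a) f - multiply D (base_action p0 b) f \<in> boundaries p0"
proof -
  let ?m = "\<lambda>a. multiply D (base_action p0 a) f"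
  have "gen_class strand_rel a \<subseteq> {b \<in> arcs D. ?m a - ?m b \<in> boundaries p0}"
  proof (rule gen_class_subset)
    show "a \<in> {b \<in> arcs D. ?m a - ?m b \<in> boundaries p0}" using a boundaries_closed(1) by simp
    fix x y assume "(x, y) \<in> strand_rel"
    then obtain k where k: "k < n" "(x, y) \<in> {(ui k, uo k), (oi k, oo k)}"
      unfolding strand_rel_def n_crossings_def by (auto simp: in_set_conv_nth)
    have arcs: "x \<in> arcs D" "y \<in> arcs D" using k(2) strand_ends[OF k(1)] ends_subset by auto
    note xy = base_action_strand[OF p f k]
    have "?m a - ?m y = (?m a - ?m x) + (?m x - ?m y)" "?m a - ?m x = (?m a - ?m y) - (?m x - ?m y)" by simp_all
    then show "x \<in> {b \<in> arcs D. ?m a - ?m b \<in> boundaries p0}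
      \<longleftrightarrow> y \<in> {b \<in> arcs D. ?m a - ?m b \<in> boundaries p0}"
      using arcs xy boundaries_closed(2,3) by (metis (no_types, lifting) mem_Collect_eq)
  qed
  with b show "b \<in> arcs D" "?m a - ?m b \<in> boundaries p0" by auto
qed

text \<open>Conjugation by \<open>sign_op\<close> replaces the operator \<open>2 x - H\<close> by
  its negative, as \<open>base_action\<close> prescribes for arcs of the other colour.\<close>

definition base_iso :: "nat \<Rightarrow> nat \<Rightarrow> 'r::comm_ring_1 chain \<Rightarrow> 'r chain" where
  "base_iso p0 p f = (if c p = c p0 then move_base D p0 f else sign_op D (move_base D p0 f))"

lemma reduced_iso_base_iso:
  assumes "p \<in> arcs D" "p0 \<in> arcs D"
  shows "reduced_iso D neg p p0 (base_iso p0 p :: 'r::comm_ring_1 chain \<Rightarrow> _)"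
proof (cases "c p = c p0")
  case True
  then have "base_iso p0 p = (move_base D p0 :: 'r chain \<Rightarrow> _)" by (simp add: base_iso_def fun_eq_iff)
  then show ?thesis using reduced_iso_move_base[OF assms, where 'r = 'r] by simp
next
  case False
  then have "base_iso p0 p = (\<lambda>f. sign_op D (move_base D p0 f :: 'r chain))" by (simp add: base_iso_def fun_eq_iff)
  then show ?thesis
    using reduced_iso_comp[OF reduced_iso_move_base[OF assms, where 'r = 'r] reduced_iso_sign_op[OF assms(2)]] by simp
qed

lemma base_iso_polyH:
  assumes p: "p \<in> arcs D" "p0 \<in> arcs D" and f: "f \<in> reduced p"
  shows "base_iso p0 p (\<lambda>s. polyH * f s) = multiply D (base_action p0 p) (base_iso p0 p f)"
proof -
  note fC = reduced_CBN_CBN[OF f] and Hf = reduced_CBN_closed(4)[OF f, of polyH]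
  note HfC = reduced_CBN_CBN[OF Hf]
  \<comment> \<open>If \<open>p\<close> is outside \<open>P\<close>, the value at \<open>P\<close>
    is a conjugate of the one at \<open>- P\<close>, and conjugation turns \<open>H\<close> into
    \<open>- H\<close>; hence the factor of \<open>2 x - H\<close>.\<close>
  have mv: "hat D (move_base D p0 (\<lambda>s. polyH * f s)) v P = split_weight p P * hat D (move_base D p0 f) v P"
    if v: "vertex v" "fits v P" for v P
    by (cases "p0 \<in> P"; cases "p \<in> P")
       (simp_all add: hat_move_base_reduced[OF p f v] hat_move_base_reduced[OF p Hf v] hat_linear(3) split_weight_def)
  have C: "base_iso p0 p f \<in> CBN D" "base_iso p0 p (\<lambda>s. polyH * f s) \<in> CBN D"
    unfolding base_iso_def using fC HfC by (auto intro: move_base_CBN sign_op_CBN)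
  show ?thesis
  proof (rule multiply_eqI[OF multiplier_base_action[OF p(1)] C, symmetric])
    fix v P assume v: "vertex v" "fits v P"
    show "hat D (base_iso p0 p (\<lambda>s. polyH * f s)) v P = base_action p0 p P * hat D (base_iso p0 p f) v P"
    proof (cases "c p = c p0")
      case True
      then show ?thesis by (simp add: base_iso_def base_action_def mv[OF v])
    next
      case False
      then show ?thesis
        by (simp add: base_iso_def base_action_def hat_sign_op[OF v] mv[OF v] bar_split_weight(2) mult.left_commute)
    qed
  qed
qed

definition act_set :: "nat \<Rightarrow> (nat set \<Rightarrow> 'r::comm_ring_1 poly) \<Rightarrow> 'r chain set \<Rightarrow> 'r chain set" where
  "act_set p u X = {multiply D u x + b | x b. x \<in> X \<and> b \<in> boundaries p}"

lemma act_set_class: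
  fixes f :: "'r::comm_ring_1 chain"
  assumes "p \<in> arcs D" "multiplier D u" "f \<in> reduced p"
  shows "act_set p u (hclass p f) = hclass p (multiply D u f)"
  unfolding act_set_def
proof (rule class_linear_image)
  fix b :: "'r chain" assume b: "b \<in> boundaries p"
  then show "multiply D u b \<in> boundaries p" by (rule boundaries_multiply[OF assms(1,2)])
  have "b \<in> CBN D" using b boundaries_reduced[OF assms(1)] reduced_CBN_CBN by blast
  then show "multiply D u (f + b) = multiply D u f + multiply D u b"
    using multiply_add[OF assms(2) reduced_CBN_CBN[OF assms(3)]] by blast
qed

end

section \<open>Polynomial actions\<close>

abbreviation (input) "exps \<equiv> Poly_Mapping.keys"
abbreviation (input) "lkp \<equiv> Poly_Mapping.lookup"

definition eval_monomial :: "(nat \<Rightarrow> 'r::comm_ring_1 poly) \<Rightarrow> (nat \<Rightarrow>\<^sub>0 nat) \<Rightarrow> 'r poly" where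
  "eval_monomial h m = (\<Prod>i\<in>exps m. h i ^ lkp m i)"

text \<open>The variables take values in \<open>R[H]\<close>, later one family of values for each
  state; relations between polynomials then become relations between operators pointwise.\<close>

definition eval_mpoly :: "(nat \<Rightarrow> 'r::comm_ring_1 poly) \<Rightarrow> 'r mpoly \<Rightarrow> 'r poly" where
  "eval_mpoly h f = (\<Sum>m\<in>exps f. [:lkp f m:] * eval_monomial h m)"

lemma eval_monomial_superset:
  assumes "finite S" "exps m \<subseteq> S"
  shows "eval_monomial h m = (\<Prod>i\<in>S. h i ^ lkp m i)"
  unfolding eval_monomial_def using assms
  by (intro prod.mono_neutral_left) (auto simp: in_keys_iff)

lemma eval_monomial_add: "eval_monomial h (a + b) = eval_monomial h a * eval_monomial h b"
proof -
  let ?S = "exps a \<union> exps b"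
  have E: "eval_monomial h m = (\<Prod>i\<in>?S. h i ^ lkp m i)" if "exps m \<subseteq> ?S" for m
    using that by (intro eval_monomial_superset) simp_all
  show ?thesis
    unfolding E[OF Poly_Mapping.keys_add] E[OF Un_upper1] E[OF Un_upper2] lookup_add power_add prod.distrib ..
qed

lemma eval_mpoly_superset:
  assumes "finite S" "exps f \<subseteq> S"
  shows "eval_mpoly h f = (\<Sum>m\<in>S. [:lkp f m:] * eval_monomial h m)"
  unfolding eval_mpoly_def using assms
  by (intro sum.mono_neutral_left) (auto simp: in_keys_iff)

lemma eval_mpoly_add: "eval_mpoly h (f + g) = eval_mpoly h f + eval_mpoly h g"
proof -
  let ?S = "exps f \<union> exps g"
  have E: "eval_mpoly h p = (\<Sum>m\<in>?S. [:lkp p m:] * eval_monomial h m)"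
    if "exps p \<subseteq> ?S" for p
    using that by (intro eval_mpoly_superset) simp_all
  have "[:x + y:] * z = [:x:] * z + [:y:] * z" for x y :: 'a and z
    by (simp add: smult_add_left)
  then show ?thesis
    unfolding E[OF Poly_Mapping.keys_add] E[OF Un_upper1] E[OF Un_upper2] lookup_add sum.distrib[symmetric] by (simp only:)
qed

lemma eval_mpoly_single: "eval_mpoly h (Poly_Mapping.single m r) = [:r:] * eval_monomial h m"
  by (subst eval_mpoly_superset[of "{m}"]) simp_all

lemma eval_mpoly_zero: "eval_mpoly h 0 = 0"
  by (simp add: eval_mpoly_def)

lemma eval_mpoly_sum: "eval_mpoly h (sum F I) = (\<Sum>i\<in>I. eval_mpoly h (F i))"
  by (induction I rule: infinite_finite_induct) (simp_all add: eval_mpoly_zero eval_mpoly_add)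

lemma mpoly_expand: "f = (\<Sum>m\<in>exps f. Poly_Mapping.single m (lkp f m))"
  for f :: "'r::comm_ring_1 mpoly"
proof (rule poly_mapping_eqI)
  fix k
  have "(\<Sum>m\<in>exps f. lkp (Poly_Mapping.single m (lkp f m)) k)
    = (\<Sum>m\<in>exps f. if m = k then lkp f k else 0)"
    by (intro sum.cong) (auto simp: lookup_single when_def)
  then show "lkp f k =
      lkp (\<Sum>m\<in>exps f. Poly_Mapping.single m (lkp f m)) k"
    by (simp add: lookup_sum in_keys_iff)
qed

lemma eval_mpoly_mult: "eval_mpoly h (f * g) = eval_mpoly h f * eval_mpoly h g"
proof -
  let ?s = "\<lambda>f m. Poly_Mapping.single m (lkp f m) :: 'a mpoly"
  have "f * g = (\<Sum>a\<in>exps f. \<Sum>b\<in>exps g. ?s f a * ?s g b)"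
    by (subst mpoly_expand[of f], subst mpoly_expand[of g]) (rule sum_product)
  then have "eval_mpoly h (f * g) = (\<Sum>a\<in>exps f. \<Sum>b\<in>exps g.
      ([:lkp f a:] * eval_monomial h a) * ([:lkp g b:] * eval_monomial h b))"
    by (simp add: eval_mpoly_sum mult_single eval_mpoly_single eval_monomial_add mult_ac)
  then show ?thesis by (simp only: eval_mpoly_def sum_product)
qed

lemma eval_mpoly_const: "eval_mpoly h (mpoly_const r) = [:r:]"
  by (simp add: mpoly_const_def eval_mpoly_single eval_monomial_def)

lemma eval_mpoly_one: "eval_mpoly h 1 = 1"
  using eval_mpoly_const[of h 1] by (simp add: mpoly_const_def pCons_one flip: single_one)

lemma eval_mpoly_var: "eval_mpoly h (mpoly_var i) = h i"
  by (simp add: mpoly_var_def eval_mpoly_single eval_monomial_def pCons_one)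

lemma multiplier_eval_mpoly:
  assumes "\<And>i. multiplier D (h i)"
  shows "multiplier D (\<lambda>P. eval_mpoly (\<lambda>i. h i P) f)"
  unfolding eval_mpoly_def eval_monomial_def
  by (intro multiplier_sum multiplier_mult multiplier_const multiplier_prod multiplier_power assms)

lemma cring_mpoly_ring: "cring (mpoly_ring l :: 'r::comm_ring_1 mpoly ring)"
proof -
  define C where "C = {f :: 'r mpoly. \<forall>m\<in>exps f. exps m \<subseteq> {..<l}}"
  have add: "f + g \<in> C" if "f \<in> C" "g \<in> C" for f g
    using that Poly_Mapping.keys_add[of f g] unfolding C_def by blast
  have mult: "f * g \<in> C" if "f \<in> C" "g \<in> C" for f g
    unfolding C_def
  proof (rule CollectI, rule ballI)
    fix m assume "m \<in> exps (f * g)"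
    then obtain a b where "a \<in> exps f" "b \<in> exps g" "m = a + b"
      using keys_mult[of f g] by blast
    then show "exps m \<subseteq> {..<l}"
      using that Poly_Mapping.keys_add[of a b] unfolding C_def by blast
  qed
  have uminus: "- f \<in> C" if "f \<in> C" for f using that by (simp add: C_def)
  have zero_one: "0 \<in> C" "1 \<in> C" by (simp_all add: C_def)
  note R = mpoly_ring_def[of l, where 'r = 'r, folded C_def]
  have "abelian_group (mpoly_ring l :: 'r mpoly ring)" unfolding R
  proof (rule abelian_groupI)
    fix f assume "f \<in> carrier \<lparr>carrier = C, monoid.mult = (*), one = 1, zero = 0, add = (+)\<rparr>"
    then show "\<exists>g\<in>carrier \<lparr>carrier = C, monoid.mult = (*), one = 1, zero = 0, add = (+)\<rparr>.
        g \<oplus>\<^bsub>\<lparr>carrier = C, monoid.mult = (*), one = 1, zero = 0, add = (+)\<rparr>\<^esub> f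
        = \<zero>\<^bsub>\<lparr>carrier = C, monoid.mult = (*), one = 1, zero = 0, add = (+)\<rparr>\<^esub>"
      by (intro bexI[of _ "- f"]) (simp_all add: uminus)
  qed (simp_all add: add zero_one add_ac)
  moreover have "comm_monoid (mpoly_ring l :: 'r mpoly ring)" unfolding R
    by (rule comm_monoidI) (simp_all add: mult zero_one mult_ac)
  ultimately show ?thesis
    by (rule cringI) (simp add: R distrib_right)
qed

context signed_diagram
begin

section \<open>The module structure on homology\<close>

lemma abelian_group_BN:
  fixes act :: "'c \<Rightarrow> 'r::comm_ring_1 chain set \<Rightarrow> 'r chain set"
  shows "abelian_group (with_scalars (BN D neg p :: ('r poly, 'r chain set) bigraded_module) act)"
proof -
  let ?M = "with_scalars (BN D neg p :: ('r poly, 'r chain set) bigraded_module) act"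
  let ?cl = "hclass p :: 'r chain \<Rightarrow> _"
  have M: "carrier ?M = ?cl ` cycles p" "zero ?M = ?cl 0" "add ?M (?cl f) (?cl g) = ?cl (f + g)" for f g
    by (simp_all add: with_scalars_def BN_simps(1,2) BN_add) (simp add: homology_class_def)
  show ?thesis
  proof (rule abelian_groupI)
    show "\<zero>\<^bsub>?M\<^esub> \<in> carrier ?M" unfolding M using cycles_closed(1) by (rule imageI)
  next
    fix X assume "X \<in> carrier ?M"
    then obtain f where f: "f \<in> cycles p" "X = ?cl f" unfolding M by blast
    show "\<zero>\<^bsub>?M\<^esub> \<oplus>\<^bsub>?M\<^esub> X = X" unfolding f(2) M by simp
    have "(\<lambda>s. (- 1) * f s) \<in> cycles p" using f(1) by (rule cycles_closed(3))
    moreover have "(\<lambda>s. (- 1) * f s) + f = 0" by (simp add: fun_eq_iff)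
    ultimately show "\<exists>Y\<in>carrier ?M. Y \<oplus>\<^bsub>?M\<^esub> X = \<zero>\<^bsub>?M\<^esub>"
      unfolding f(2) by (intro bexI[of _ "?cl (\<lambda>s. (- 1) * f s)"]) (simp_all only: M imageI)
    fix Y assume "Y \<in> carrier ?M"
    then obtain g where g: "g \<in> cycles p" "Y = ?cl g" unfolding M by blast
    show "X \<oplus>\<^bsub>?M\<^esub> Y \<in> carrier ?M" unfolding f(2) g(2) M using cycles_closed(2)[OF f(1) g(1)] by (rule imageI)
    show "X \<oplus>\<^bsub>?M\<^esub> Y = Y \<oplus>\<^bsub>?M\<^esub> X" unfolding f(2) g(2) M by (simp add: add.commute)
    fix Z assume "Z \<in> carrier ?M"
    then obtain h where h: "Z = ?cl h" unfolding M by blast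
    show "X \<oplus>\<^bsub>?M\<^esub> Y \<oplus>\<^bsub>?M\<^esub> Z = X \<oplus>\<^bsub>?M\<^esub> (Y \<oplus>\<^bsub>?M\<^esub> Z)" unfolding f(2) g(2) h M by (simp add: add.assoc)
  qed
qed

text \<open>The axioms already hold on chains: at each state \<open>eval_mpoly\<close> is a ring
  homomorphism, and \<open>multiply\<close> is determined by its scalars.\<close>

lemma module_BN:
  fixes h :: "nat \<Rightarrow> nat set \<Rightarrow> 'r::comm_ring_1 poly"
  assumes p: "p \<in> arcs D" and h: "\<And>i. multiplier D (h i)"
  shows "Module.module (mpoly_ring l) (with_scalars (BN D neg p)
    (\<lambda>F. act_set p (\<lambda>P. eval_mpoly (\<lambda>i. h i P) F)))"
proof (rule moduleI[OF cring_mpoly_ring abelian_group_BN])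
  let ?M = "with_scalars (BN D neg p) (\<lambda>F. act_set p (\<lambda>P. eval_mpoly (\<lambda>i. h i P) F))"
  let ?cl = "hclass p :: 'r chain \<Rightarrow> _"
  let ?u = "\<lambda>F P. eval_mpoly (\<lambda>i. h i P) F"
  have u: "multiplier D (?u F)" for F by (rule multiplier_eval_mpoly[OF h])
  have M: "carrier ?M = ?cl ` cycles p" "add ?M (?cl f) (?cl g) = ?cl (f + g)" for f g
    by (simp_all add: with_scalars_def BN_simps(1) BN_add)
  have act: "F \<odot>\<^bsub>?M\<^esub> ?cl f = ?cl (multiply D (?u F) f)" if "f \<in> cycles p" for F f
    using act_set_class[OF p u cyclesD(1)[OF that]] by (simp add: with_scalars_def)
  have R: "add (mpoly_ring l) F G = F + G" "monoid.mult (mpoly_ring l) F G = F * G" "one (mpoly_ring l) = 1"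
    for F G :: "'r mpoly" by (simp_all add: mpoly_ring_def)
  fix X assume "X \<in> carrier ?M"
  then obtain f where f: "f \<in> cycles p" "X = ?cl f" unfolding M by blast
  note fC = cyclesD(2)[OF f(1)] and uf = cycles_multiply[OF p u f(1)]
  show "\<one>\<^bsub>mpoly_ring l\<^esub> \<odot>\<^bsub>?M\<^esub> X = X"
  proof -
    have "multiply D (?u 1) f = f"
      by (rule multiply_eqI[OF u fC fC]) (simp add: eval_mpoly_one)
    then show ?thesis unfolding f(2) R act[OF f(1)] by simp
  qed
  show "F \<odot>\<^bsub>?M\<^esub> X \<in> carrier ?M" for F unfolding f(2) act[OF f(1)] M using uf by (rule imageI)
  show "(F \<oplus>\<^bsub>mpoly_ring l\<^esub> G) \<odot>\<^bsub>?M\<^esub> X = F \<odot>\<^bsub>?M\<^esub> X \<oplus>\<^bsub>?M\<^esub> G \<odot>\<^bsub>?M\<^esub> X" for F G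
  proof -
    have "multiply D (?u (F + G)) f = multiply D (?u F) f + multiply D (?u G) f"
      by (rule multiply_eqI[OF u fC CBN_closed(2)[OF multiply(1)[OF u fC] multiply(1)[OF u fC]]])
         (simp only: hat_linear multiply(2)[OF u fC] eval_mpoly_add distrib_right)
    then show ?thesis unfolding f(2) R act[OF f(1)] M by simp
  qed
  show "(F \<otimes>\<^bsub>mpoly_ring l\<^esub> G) \<odot>\<^bsub>?M\<^esub> X = F \<odot>\<^bsub>?M\<^esub> (G \<odot>\<^bsub>?M\<^esub> X)" for F G
  proof -
    have "multiply D (?u (F * G)) f = multiply D (?u F) (multiply D (?u G) f)"
      by (rule multiply_eqI[OF u fC multiply(1)[OF u multiply(1)[OF u fC]]])
         (simp only: multiply(2)[OF u fC] multiply(2)[OF u multiply(1)[OF u fC]] eval_mpoly_mult mult.assoc)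
    then show ?thesis unfolding f(2) R act[OF f(1)] act[OF uf] by simp
  qed
  fix Y assume "Y \<in> carrier ?M"
  then obtain g where g: "g \<in> cycles p" "Y = ?cl g" unfolding M by blast
  show "F \<odot>\<^bsub>?M\<^esub> (X \<oplus>\<^bsub>?M\<^esub> Y) = F \<odot>\<^bsub>?M\<^esub> X \<oplus>\<^bsub>?M\<^esub> F \<odot>\<^bsub>?M\<^esub> Y" for F
  proof -
    have "F \<odot>\<^bsub>?M\<^esub> ?cl (f + g) = ?cl (multiply D (?u F) (f + g))"
      by (rule act[OF cycles_closed(2)[OF f(1) g(1)]])
    also have "\<dots> = ?cl (multiply D (?u F) f + multiply D (?u F) g)"
      by (simp only: multiply_add[OF u fC cyclesD(2)[OF g(1)]])
    finally show ?thesis by (simp only: f(2) g(2) M(2) act[OF f(1)] act[OF g(1)])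
  qed
qed

lemma base_iso_same:
  fixes X :: "'r::comm_ring_1 chain set"
  assumes p: "p \<in> arcs D" and X: "X \<in> carrier (BN D neg p)"
  shows "base_iso p p ` X = X"
proof -
  obtain f where f: "f \<in> cycles p" "X = hclass p f" using X unfolding BN_simps by blast
  have "base_iso p p x = x" if "x \<in> X" for x
    using class_reduced[OF p cyclesD(1)[OF f(1)]] that move_base_same[OF p] by (auto simp: f(2) base_iso_def)
  then show ?thesis by simp
qed

text \<open>On chains, \<open>H\<close> at \<open>p\<close> becomes the action attached to
  \<open>p\<close> itself. Replacing \<open>p\<close> by another arc \<open>q\<close> of its
  component changes cycles by boundaries, so the statement is about homology classes.\<close>

lemma base_iso_action:
  fixes X :: "'r::comm_ring_1 chain set"
  assumes p: "p \<in> arcs D" "p0 \<in> arcs D" and q: "q \<in> arcs D" "p \<in> gen_class strand_rel q"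
    and X: "X \<in> carrier (BN D neg p)"
  shows "base_iso p0 p ` (polyH \<odot>\<^bsub>BN D neg p\<^esub> X) = act_set p0 (base_action p0 q) (base_iso p0 p ` X)"
proof -
  obtain f where f: "f \<in> cycles p" "X = hclass p f" using X unfolding BN_simps by blast
  note iso = reduced_iso_base_iso[OF p, where 'r = 'r] and fR = cyclesD(1)[OF f(1)]
  let ?g = "base_iso p0 p f"
  have g: "?g \<in> cycles p0" using reduced_iso_cycles[OF p(1) iso] f(1) by blast
  have "base_iso p0 p ` (polyH \<odot>\<^bsub>BN D neg p\<^esub> X) = hclass p0 (multiply D (base_action p0 p) ?g)"
    unfolding f(2) BN_smult reduced_iso_class[OF p(1) iso reduced_CBN_closed(4)[OF fR]] base_iso_polyH[OF p fR] ..
  also have "\<dots> = hclass p0 (multiply D (base_action p0 q) ?g)"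
    by (rule class_eqI[OF base_action_component(2)[OF p(2) g q], symmetric])
  also have "\<dots> = act_set p0 (base_action p0 q) (base_iso p0 p ` X)"
    unfolding f(2) reduced_iso_class[OF p(1) iso fR]
    by (rule act_set_class[OF p(2) multiplier_base_action[OF q(1)] cyclesD(1)[OF g], symmetric])
  finally show ?thesis .
qed

lemma act_set_const:
  fixes X :: "'r::comm_ring_1 chain set"
  assumes p: "p \<in> arcs D" and X: "X \<in> carrier (BN D neg p)"
  shows "act_set p (\<lambda>_. a) X = a \<odot>\<^bsub>BN D neg p\<^esub> X"
proof -
  obtain f where f: "f \<in> cycles p" "X = hclass p f" using X unfolding BN_simps by blast
  show ?thesis
    unfolding f(2) BN_smult act_set_class[OF p multiplier_const cyclesD(1)[OF f(1)]] multiply_const[OF cyclesD(2)[OF f(1)]] ..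
qed

end

theorem theorem4p34:
  fixes D :: link_diagram
    and neg :: "(nat set \<times> nat) set"
    and l :: nat
  assumes "is_link_diagram D"
    and "sign_assignment D neg"
    and "l = card (link_components D)"
  shows "(\<forall>p\<in>arcs D. \<forall>p'\<in>arcs D. \<exists>\<phi> :: 'r::comm_ring_1 chain set \<Rightarrow> 'r chain set.
      bigraded_iso (BN D neg p) (BN D neg p') \<phi>) \<and>
    (\<forall>comp. bij_betw comp {..<l} (link_components D) \<longrightarrow>
      (\<forall>p0\<in>arcs D.
        \<exists>(act :: 'r mpoly \<Rightarrow> 'r chain set \<Rightarrow> 'r chain set)
          (\<phi> :: nat \<Rightarrow> 'r chain set \<Rightarrow> 'r chain set).
        Module.module (mpoly_ring l) (with_scalars (BN D neg p0) act) \<and>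
        (\<forall>r. \<forall>X\<in>carrier (BN D neg p0).
           act (mpoly_const r) X = [:r:] \<odot>\<^bsub>BN D neg p0\<^esub> X) \<and>
        (\<forall>p\<in>arcs D. bigraded_iso (BN D neg p) (BN D neg p0) (\<phi> p)) \<and>
        (\<forall>X\<in>carrier (BN D neg p0). \<phi> p0 X = X) \<and>
        (\<forall>i<l. \<forall>p\<in>comp i. \<forall>X\<in>carrier (BN D neg p).
           \<phi> p (polyH \<odot>\<^bsub>BN D neg p\<^esub> X) = act (mpoly_var i) (\<phi> p X))))"
proof -
  have wf: "well_formed D" and "planar D" using assms(1) by (simp_all add: is_link_diagram_def)
  then obtain c where "source_sink D c"
    using wf_diagram.planar_source_sink[OF wf_diagram.intro] by blast
  with wf assms(2) interpret signed_diagram D c neg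
    by unfold_locales
  let "_ \<and> (\<forall>comp. _ \<longrightarrow> (\<forall>p0\<in>_. ?M comp p0))" = ?thesis
  show ?thesis
  proof (intro conjI ballI allI impI)
    fix p p' assume "p \<in> arcs D" "p' \<in> arcs D"
    from reduced_iso_bigraded[OF this(1) reduced_iso_base_iso[OF this, where 'r = 'r]]
    show "\<exists>\<phi> :: 'r chain set \<Rightarrow> 'r chain set. bigraded_iso (BN D neg p) (BN D neg p') \<phi>" by blast
  next
    fix comp p0 assume comp: "bij_betw comp {..<l} (link_components D)" and p0: "p0 \<in> arcs D"
    have comp_class: "\<exists>q\<in>arcs D. comp i = gen_class strand_rel q" if "i < l" for i
      using bij_betwE[OF comp] that unfolding link_components_def strand_rel_def[symmetric] by blast
    \<comment> \<open>One arc stands for each component; by \<open>base_action_component\<close> the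
      choice does not affect homology classes.\<close>
    define base where "base i = (SOME q. q \<in> arcs D \<and> comp i = gen_class strand_rel q)" for i
    have base: "base i \<in> arcs D \<and> comp i = gen_class strand_rel (base i)" if "i < l" for i
      unfolding base_def by (rule someI_ex) (use comp_class[OF that] in blast)
    \<comment> \<open>Indices from \<open>l\<close> on name no component; the value \<open>0\<close>
      keeps \<open>h i\<close> a multiplier for every \<open>i\<close>.\<close>
    define h :: "nat \<Rightarrow> nat set \<Rightarrow> 'r poly" where "h i = (if i < l then base_action p0 (base i) else (\<lambda>_. 0))" for i
    have h: "multiplier D (h i)" for i
      unfolding h_def using multiplier_base_action base multiplier_const by auto
    define act where "act F = act_set p0 (\<lambda>P. eval_mpoly (\<lambda>i. h i P) F)" for F
    define \<phi> :: "nat \<Rightarrow> 'r chain set \<Rightarrow> 'r chain set" where "\<phi> p = (`) (base_iso p0 p)" for p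
    show "?M comp p0"
    proof (rule exI[of _ act], rule exI[of _ \<phi>], intro conjI ballI allI impI)
      show "Module.module (mpoly_ring l) (with_scalars (BN D neg p0) act)"
        unfolding act_def by (rule module_BN[OF p0 h])
      show "act (mpoly_const r) X = [:r:] \<odot>\<^bsub>BN D neg p0\<^esub> X" if "X \<in> carrier (BN D neg p0)" for r X
        unfolding act_def eval_mpoly_const by (rule act_set_const[OF p0 that])
      show "bigraded_iso (BN D neg p) (BN D neg p0) (\<phi> p)" if "p \<in> arcs D" for p
        unfolding \<phi>_def by (rule reduced_iso_bigraded[OF that reduced_iso_base_iso[OF that p0]])
      show "\<phi> p0 X = X" if "X \<in> carrier (BN D neg p0)" for X
        unfolding \<phi>_def by (rule base_iso_same[OF p0 that])
      fix i p X assume i: "i < l" and p: "p \<in> comp i" and X: "X \<in> carrier (BN D neg p :: ('r poly, 'r chain set) bigraded_module)"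
      have q: "base i \<in> arcs D" "p \<in> gen_class strand_rel (base i)" using base[OF i] p by auto
      \<comment> \<open>Membership in \<open>arcs D\<close> does not depend on a cycle; the zero
        cycle instantiates the lemma.\<close>
      have pD: "p \<in> arcs D"
        by (rule base_action_component(1)[OF p0 cycles_closed(1)[where 'r = 'r] q])
      show "\<phi> p (polyH \<odot>\<^bsub>BN D neg p\<^esub> X) = act (mpoly_var i) (\<phi> p X)"
        using base_iso_action[OF pD p0 q X] i by (simp add: \<phi>_def act_def eval_mpoly_var h_def)
    qed
  qed
qed

end
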